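(* Let $P\subset\mathbb{R}^2$ be a lattice polygon and let $\Delta$ be a (not necessarily regular) unimodular triangulation of $P$ with skeleton $G$. Suppose that $G$ has a heavy cycle $C$ with vertices $v_1,v_2$ and cut edges $e_1,e_2$, and let $T_1,T_2$ be the triangles of $\Delta$ dual to $v_1,v_2$, let $S_1,S_2$ be split lines dual to $e_1,e_2$, and let $P'$ be the heavy component of $P$. Then the triangles $T_1$ and $T_2$ share an edge $[z,w]$, where $z$ is the interior lattice point of $P$ dual to $C$, and the split lines $S_1$ and $S_2$ intersect in $w$, which is a vertex of $P'$, and which lies in the boundary of $P$.
   Context: A lattice polygon is the (two-dimensional) convex hull of finitely many points of $\mathbb{Z}^2$. A unimodular triangulation of $P$ is a triangulation of $V=P\cap\mathbb{Z}^2$ (a subdivision of $P$ into triangles with vertices in $V$) all of whose triangles have Euclidean area $\tfrac12$. Dual graph and skeleton. The dual graph $\Gamma=\Gamma(\Delta)$ has the triangles of $\Delta$ as nodes; two triangles form an edge of $\Gamma$ if they share an edge in $\Delta$. The skeleton $G=G(\Delta)$ is obtained from $\Gamma$ as follows. First, repeatedly delete nodes of degree one together with the unique incident edge until none are left; the remaining edges of $\Gamma$ are called nonredundant. Second, repeatedly remove a node of degree two and join its two neighbors by an edge, until no nodes of degree two are left. The result is a connected trivalent planar graph (loops and multiple edges allowed), embedded in the plane as induced by $\Delta$. Each node of $G$ is a node of $\Gamma$, i.e., a triangle of $\Delta$ (the triangle dual to that node). Each edge of $G$ arises from an edge path in $\Gamma$; the contraction map $\eta$ is the resulting surjection from nonredundant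 edges of $\Gamma$ onto edges of $G$. The bounded regions of $G$ correspond bijectively to the interior lattice points of $P$; the interior lattice point dual to a cycle bounding a region is the one corresponding to that region. The genus of a graph is its cycle rank (number of edges minus number of nodes plus one, if connected). An edge of a connected graph is a cut edge if deleting it creates two connected components. Heavy cycle. A connected trivalent planar graph $G$ has a heavy cycle if it has a cycle $C$ (bounding a region) containing two distinct vertices $v_1,v_2$ joined by an edge of $C$, such that for $i=1,2$ the vertex $v_i$ is incident with a cut edge $e_i$ (not in $C$) connecting $v_i$ with a subgraph $G_i$ of positive genus; and there is a third subgraph $G_3$, also of positive genus, which shares at least one vertex with $C$. The subgraphs $G_1,G_2,G_3$ are pairwise disjoint and do not contain $v_1,v_2$; $G$ consists of $G_1$, $G_2$, $e_1$, $e_2$, and the connected subgraph $G_3\cup C$, where, apart from the edge between $v_1$ and $v_2$, the cycle $C$ consists of an edge from $v_1$ to $G_3$, an edge from $v_2$ to $G_3$, and a (possibly trivial) path in $G_3$. Splits and heavy component. A split of $V$ is a polytopal subdivision of $V$ with exactly two maximal cells; their common edge spans the split line. If $e$ is a cut edge of $G$, then $\eta^{-1}(e)$ contains a cut edge of $\Gamma$, dual to an edge $s$ of $\Delta$ whose endpoints lie on $\partial P$ and which spans the split line of a split of $V$; such a line is called a split line dual to $e$ (one picks one such $s$). For a heavy cycle let $S_1,S_2$ be split lines dual to $e_1,e_2$, spanned by edges $s_1,s_2$ of $\Delta$. These do not meet in the interior of $P$, so they decompose $P$ into three lattice polygons $P_1,P_2,P'$, and $\Delta$ induces triangulations $\Delta_1,\Delta_2,\Delta'$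 of them, where $\Delta_i$ is the part corresponding to $G_i$ ($i=1,2$) and $\Delta'$ is the part corresponding to $G_3\cup C$. The polygon $P'$ is called the heavy component of $P$. The triangles $T_1,T_2$ dual to $v_1,v_2$ lie in $\Delta'$. *)

theory Defs
  imports "HOL-Analysis.Analysis"
begin

type_synonym point = "real ^ 2"

definition lattice_points :: "point set" where
  "lattice_points = {x. \<forall>i. x $ i \<in> \<int>}"

definition lattice_polygon :: "point set \<Rightarrow> bool" where
  "lattice_polygon P \<longleftrightarrow>
     (\<exists>S. finite S \<and> S \<subseteq> lattice_points \<and> P = convex hull S) \<and> aff_dim P = 2"

text \<open>A polytopal subdivision of the lattice points of \<open>P\<close>, given by its set of maximal cells.\<close>

definition lattice_subdivision :: "point set \<Rightarrow> point set set \<Rightarrow> bool" where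
  "lattice_subdivision P M \<longleftrightarrow>
     finite M \<and> \<Union>M = P \<and> (\<forall>A\<in>M. lattice_polygon A) \<and>
     (\<forall>A\<in>M. \<forall>B\<in>M. A \<inter> B face_of A \<and> A \<inter> B face_of B)"

definition unimodular_triangulation :: "point set \<Rightarrow> point set set \<Rightarrow> bool" where
  "unimodular_triangulation P \<Delta> \<longleftrightarrow>
     lattice_subdivision P \<Delta> \<and> (\<forall>T\<in>\<Delta>. 2 simplex T \<and> measure lebesgue T = 1/2)"

definition split :: "point set \<Rightarrow> point set set \<Rightarrow> bool" where
  "split P M \<longleftrightarrow> lattice_subdivision P M \<and> card M = 2"

text \<open>For a split \<open>M = {A, B}\<close>, \<open>\<Inter>M = A \<inter> B\<close> is the common edge of the two cells.\<close>

definition split_line :: "point set set \<Rightarrow> point set" where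
  "split_line M = affine hull (\<Inter>M)"

text \<open>
  Loops and multiple edges are allowed. \<open>ends\<close> gives the one- or two-element set of end points of
  an edge; a loop is an edge with a single end point. The values of \<open>ends\<close> outside \<open>edges\<close> are
  irrelevant.
\<close>

record ('v, 'e) mgraph =
  nodes :: "'v set"
  edges :: "'e set"
  ends :: "'e \<Rightarrow> 'v set"

definition valency :: "('v, 'e) mgraph \<Rightarrow> 'v \<Rightarrow> nat" where
  "valency G v = card {e \<in> edges G. v \<in> ends G e} + card {e \<in> edges G. ends G e = {v}}"

definition adjacency :: "('v, 'e) mgraph \<Rightarrow> ('v \<times> 'v) set" where
  "adjacency G = {(u, v). \<exists>e\<in>edges G. ends G e = {u, v}}"

definition graph_components :: "('v, 'e) mgraph \<Rightarrow> 'v set set" where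
  "graph_components G = (\<lambda>u. {v \<in> nodes G. (u, v) \<in> (adjacency G)\<^sup>*}) ` nodes G"

definition connected_graph :: "('v, 'e) mgraph \<Rightarrow> bool" where
  "connected_graph G \<longleftrightarrow> (\<exists>K. graph_components G = {K})"

definition trivalent :: "('v, 'e) mgraph \<Rightarrow> bool" where
  "trivalent G \<longleftrightarrow> (\<forall>v\<in>nodes G. valency G v = 3)"

text \<open>The cycle rank; for a connected graph the last summand is one.\<close>

definition genus :: "('v, 'e) mgraph \<Rightarrow> int" where
  "genus G = int (card (edges G)) - int (card (nodes G)) + int (card (graph_components G))"

definition cut_edge :: "('v, 'e) mgraph \<Rightarrow> 'e \<Rightarrow> bool" where
  "cut_edge G e \<longleftrightarrow>
     connected_graph G \<and> e \<in> edges G \<and> card (graph_components (G\<lparr>edges := edges G - {e}\<rparr>)) = 2"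

definition subgraph :: "('v, 'e) mgraph \<Rightarrow> ('v, 'e) mgraph \<Rightarrow> bool" where
  "subgraph H G \<longleftrightarrow>
     nodes H \<subseteq> nodes G \<and> edges H \<subseteq> edges G \<and> ends H = ends G \<and> (\<forall>e\<in>edges H. ends H e \<subseteq> nodes H)"

text \<open>The union of two subgraphs of a common graph (so that their \<open>ends\<close> agree).\<close>

definition graph_union :: "('v, 'e) mgraph \<Rightarrow> ('v, 'e) mgraph \<Rightarrow> ('v, 'e) mgraph" where
  "graph_union G H = \<lparr>nodes = nodes G \<union> nodes H, edges = edges G \<union> edges H, ends = ends G\<rparr>"

text \<open>Paths may be trivial; cycles may be loops or pairs of parallel edges.\<close>

definition path_graph :: "('v, 'e) mgraph \<Rightarrow> 'v \<Rightarrow> 'v \<Rightarrow> bool" where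
  "path_graph Q x y \<longleftrightarrow>
     (\<exists>xs es. distinct xs \<and> length xs = Suc (length es) \<and> hd xs = x \<and> last xs = y \<and>
        nodes Q = set xs \<and> edges Q = set es \<and>
        (\<forall>i<length es. ends Q (es ! i) = {xs ! i, xs ! Suc i}))"

definition cycle_graph :: "('v, 'e) mgraph \<Rightarrow> bool" where
  "cycle_graph C \<longleftrightarrow>
     (\<exists>xs es. xs \<noteq> [] \<and> distinct xs \<and> distinct es \<and> length es = length xs \<and>
        nodes C = set xs \<and> edges C = set es \<and>
        (\<forall>i<length es. ends C (es ! i) = {xs ! i, xs ! (Suc i mod length xs)}))"

text \<open>
  An edge of the dual graph is represented by the edge of \<open>\<Delta>\<close> it is dual to, i.e. the segment
  shared by its two end points.
\<close>

definition dual_graph :: "point set set \<Rightarrow> (point set, point set) mgraph" where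
  "dual_graph \<Delta> =
     \<lparr>nodes = \<Delta>,
      edges = {s. \<exists>T\<in>\<Delta>. \<exists>T'\<in>\<Delta>. T \<noteq> T' \<and> s edge_of T \<and> s edge_of T'},
      ends = (\<lambda>s. {T \<in> \<Delta>. s edge_of T})\<rparr>"

inductive delete_leaf :: "('v, 'e) mgraph \<Rightarrow> ('v, 'e) mgraph \<Rightarrow> bool" where
  "v \<in> nodes G \<Longrightarrow> valency G v = 1 \<Longrightarrow>
   delete_leaf G (G\<lparr>nodes := nodes G - {v}, edges := {e \<in> edges G. v \<notin> ends G e}\<rparr>)"

text \<open>
  In order to keep track of the contraction map, every edge of the graph is labelled by a set of
  edges of the original graph: initially a singleton, and when two edges are merged the union of
  their labels. So an edge of the skeleton literally \<^emph>\<open>is\<close> its fibre under the contraction map.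
  If the two neighbours of the removed node coincide, a loop arises.
\<close>

definition singleton_edges :: "('v, 'e) mgraph \<Rightarrow> ('v, 'e set) mgraph" where
  "singleton_edges G =
     \<lparr>nodes = nodes G, edges = (\<lambda>e. {e}) ` edges G, ends = (\<lambda>E. \<Union>(ends G ` E))\<rparr>"

inductive smooth_node :: "('v, 'e set) mgraph \<Rightarrow> ('v, 'e set) mgraph \<Rightarrow> bool" where
  "v \<in> nodes G \<Longrightarrow> valency G v = 2 \<Longrightarrow> a \<in> edges G \<Longrightarrow> b \<in> edges G \<Longrightarrow> a \<noteq> b \<Longrightarrow>
   v \<in> ends G a \<Longrightarrow> v \<in> ends G b \<Longrightarrow>
   smooth_node G
     \<lparr>nodes = nodes G - {v},
      edges = insert (a \<union> b) (edges G - {a, b}),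
      ends = (ends G)(a \<union> b := (ends G a \<union> ends G b) - {v})\<rparr>"

definition skeleton :: "point set set \<Rightarrow> (point set, point set set) mgraph \<Rightarrow> bool" where
  "skeleton \<Delta> G \<longleftrightarrow>
     (\<exists>H. delete_leaf\<^sup>*\<^sup>* (dual_graph \<Delta>) H \<and> (\<forall>v\<in>nodes H. valency H v \<noteq> 1) \<and>
          smooth_node\<^sup>*\<^sup>* (singleton_edges H) G \<and> (\<forall>v\<in>nodes G. valency G v \<noteq> 2))"

text \<open>
  A triangle is drawn as its barycentre, and the dual of an edge \<open>s\<close> of \<open>\<Delta>\<close> as the two segments
  joining the midpoint of \<open>s\<close> to the barycentres of the two triangles containing \<open>s\<close>. An edge of
  the skeleton is drawn as the union of the curves of the dual edges in its fibre.
\<close>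

definition barycenter :: "point set \<Rightarrow> point" where
  "barycenter X = (1 / real (card {x. x extreme_point_of X})) *\<^sub>R (\<Sum>x | x extreme_point_of X. x)"

definition dual_curve :: "point set set \<Rightarrow> point set \<Rightarrow> point set" where
  "dual_curve \<Delta> s =
     (\<Union>T\<in>ends (dual_graph \<Delta>) s. closed_segment (barycenter s) (barycenter T))"

definition drawing :: "point set set \<Rightarrow> (point set, point set set) mgraph \<Rightarrow> point set" where
  "drawing \<Delta> H = (\<Union>e\<in>edges H. \<Union>s\<in>e. dual_curve \<Delta> s)"

definition bounds_region ::
  "point set set \<Rightarrow> (point set, point set set) mgraph \<Rightarrow> (point set, point set set) mgraph
     \<Rightarrow> point set \<Rightarrow> bool" where
  "bounds_region \<Delta> G C R \<longleftrightarrow>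
     R \<in> components (- drawing \<Delta> G) \<and> bounded R \<and> frontier R = drawing \<Delta> C"

text \<open>The interior lattice point dual to \<open>C\<close> is the one lying in the region bounded by \<open>C\<close>.\<close>

definition dual_lattice_point ::
  "point set \<Rightarrow> point set set \<Rightarrow> (point set, point set set) mgraph
     \<Rightarrow> (point set, point set set) mgraph \<Rightarrow> point \<Rightarrow> bool" where
  "dual_lattice_point P \<Delta> G C z \<longleftrightarrow>
     z \<in> interior P \<inter> lattice_points \<and> (\<exists>R. bounds_region \<Delta> G C R \<and> z \<in> R)"

definition heavy_cycle ::
  "point set set \<Rightarrow> (point set, point set set) mgraph \<Rightarrow> (point set, point set set) mgraph
     \<Rightarrow> point set \<Rightarrow> point set \<Rightarrow> point set set \<Rightarrow> point set set
     \<Rightarrow> (point set, point set set) mgraph \<Rightarrow> (point set, point set set) mgraph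
     \<Rightarrow> (point set, point set set) mgraph \<Rightarrow> bool" where
  "heavy_cycle \<Delta> G C v1 v2 e1 e2 G1 G2 G3 \<longleftrightarrow>
     connected_graph G \<and> trivalent G \<and>
     subgraph C G \<and> cycle_graph C \<and> (\<exists>R. bounds_region \<Delta> G C R) \<and>
     v1 \<in> nodes C \<and> v2 \<in> nodes C \<and> v1 \<noteq> v2 \<and>
     subgraph G1 G \<and> genus G1 > 0 \<and>
     subgraph G2 G \<and> genus G2 > 0 \<and>
     subgraph G3 G \<and> genus G3 > 0 \<and>
     nodes G1 \<inter> nodes G2 = {} \<and> nodes G1 \<inter> nodes G3 = {} \<and> nodes G2 \<inter> nodes G3 = {} \<and>
     {v1, v2} \<inter> (nodes G1 \<union> nodes G2 \<union> nodes G3) = {} \<and>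
     cut_edge G e1 \<and> e1 \<notin> edges C \<and> (\<exists>x\<in>nodes G1. ends G e1 = {v1, x}) \<and>
     cut_edge G e2 \<and> e2 \<notin> edges C \<and> (\<exists>x\<in>nodes G2. ends G e2 = {v2, x}) \<and>
     nodes G3 \<inter> nodes C \<noteq> {} \<and> connected_graph (graph_union G3 C) \<and>
     nodes G = nodes G1 \<union> nodes G2 \<union> nodes (graph_union G3 C) \<and>
     edges G = edges G1 \<union> edges G2 \<union> {e1, e2} \<union> edges (graph_union G3 C) \<and>
     (\<exists>f g1 g2 x1 x2 Q.
        ends G f = {v1, v2} \<and> ends G g1 = {v1, x1} \<and> ends G g2 = {v2, x2} \<and>
        subgraph Q G3 \<and> path_graph Q x1 x2 \<and>
        edges C = {f, g1, g2} \<union> edges Q \<and> nodes C = {v1, v2} \<union> nodes Q)"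

text \<open>\<open>S\<close> is a split line dual to the edge \<open>e\<close> of the skeleton; note that \<open>e\<close> is its own fibre.\<close>

definition dual_split_line ::
  "point set \<Rightarrow> point set set \<Rightarrow> point set set \<Rightarrow> point set \<Rightarrow> bool" where
  "dual_split_line P \<Delta> e S \<longleftrightarrow>
     (\<exists>s\<in>e. cut_edge (dual_graph \<Delta>) s \<and> {x. x extreme_point_of s} \<subseteq> frontier P \<and>
            S = affine hull s \<and> (\<exists>M. split P M \<and> S = split_line M))"

text \<open>
  The split lines decompose \<open>P\<close> into polygons; the heavy component is the one containing the
  triangles belonging to the subgraph \<open>H\<close>, the union of \<open>G3\<close> and the heavy cycle.
\<close>

definition heavy_component ::
  "point set \<Rightarrow> point set \<Rightarrow> point set \<Rightarrow> (point set, point set set) mgraph \<Rightarrow> point set \<Rightarrow> bool"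
  where
  "heavy_component P S1 S2 H P' \<longleftrightarrow>
     P' \<in> closure ` components (P - (S1 \<union> S2)) \<and> (\<forall>T\<in>nodes H. T \<subseteq> P')"

end

(*
  Let T1 = [z, a, b] and T2 = [z, c, d]. Any edge of the triangulation with an interior end point
  lies on a cycle of the dual graph (the triangles around that point), so the edge dual to a cut edge
  has both end points on the boundary of P. Hence [a, b] and [c, d] are chords of P.

  Take coordinates with z = 0, a = (1, 0), b = (0, 1). Since G1 has positive genus, P has an interior
  lattice point beyond the chord [a, b], and convexity together with a, b being boundary points makes
  (1, 1) interior as well. A further convexity argument then forces every interior lattice point of P
  on the near side of [a, b] into the closed negative quadrant, i.e. into z - cone(a - z, b - z).
  The same holds for T2. As G3 has positive genus, there is an interior lattice point p distinct from
  z on the near side of both chords, so z - p lies in the cones of both T1 and T2. Two triangles of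
  the triangulation whose cones at z share a ray have a common edge [z, w] on that ray.

  The triangle beyond [a, b] is [a, b, a + b - z]; it has an interior vertex, therefore it is a node
  of the skeleton and [a, b] is the only edge of the triangulation in the fibre of the cut edge. So
  the split line is the line through a and b.
*)
theory Submission
  imports Defs
begin

section \<open>Unimodular triangulations of a lattice polygon\<close>

text \<open>Genus says nothing about lattice points, so positive genus is first turned into a
  nonempty set of skeleton edges without dead ends. Replacing these edges by their fibres gives dual
  edges among which every triangle that is entered can be left again (\<open>edge_core\<close>).
  Such a set cannot die out at the boundary: beyond a chord it continues over further chords,
  cutting off fewer and fewer triangles, until it uses an edge with an interior end point. The point
  \<open>p\<close> differs from \<open>z\<close> because a core living only on edges at
  \<open>z\<close> would surround \<open>z\<close> and thus use \<open>T1\<close>, which is not a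
  node of \<open>G3\<close>. That \<open>z\<close> is a corner of \<open>T1\<close> and
  \<open>T2\<close> is a statement about a plane drawing. The curves dual to the edges at
  \<open>z\<close> enclose its barycentric dual cell, which the region of \<open>C\<close> cannot
  leave; the barycentres of both triangles lie on the frontier of that region, hence in the cell.
  The skeleton is reached by an arbitrary sequence of contractions, so facts about it are invariants
  of a single step. The convexity arguments share one shape: a boundary point is a weighted mean
  with positive weight on an interior point.\<close>

text \<open>The planar cross product. Unimodularity of a triangle becomes the value 1 or -1, and the
  sign of \<open>det2 (w - u) (p - u)\<close> tells on which side of the directed line from
  \<open>u\<close> to \<open>w\<close> the point \<open>p\<close> lies.\<close>

definition det2 :: "point \<Rightarrow> point \<Rightarrow> real" where
  "det2 u v = u $ 1 * v $ 2 - u $ 2 * v $ 1"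

lemma point_eq_iff: "(p::point) = q \<longleftrightarrow> p $ 1 = q $ 1 \<and> p $ 2 = q $ 2"
  by (simp add: vec_eq_iff forall_2)

text \<open>Cramer's rule with determinant 1. For lattice points the coordinates are therefore
  integers.\<close>

lemma det2_coords:
  assumes "det2 (a - z) (b - z) = 1"
  shows "p = z + det2 (p - z) (b - z) *\<^sub>R (a - z) + det2 (a - z) (p - z) *\<^sub>R (b - z)"
proof -
  have "z $ i + det2 (p - z) (b - z) * (a $ i - z $ i) + det2 (a - z) (p - z) * (b $ i - z $ i)
      = z $ i + (p $ i - z $ i) * det2 (a - z) (b - z)" if "i = 1 \<or> i = 2" for i
    using that by (auto simp: det2_def algebra_simps)
  then show ?thesis
    using assms by (simp add: point_eq_iff)
qed

lemma det2_triangle_combination: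
  assumes "p = z + x *\<^sub>R (a - z) + y *\<^sub>R (b - z)"
  shows "det2 (w - u) (p - u)
    = (1 - x - y) * det2 (w - u) (z - u) + x * det2 (w - u) (a - u) + y * det2 (w - u) (b - u)"
  unfolding assms by (simp add: det2_def algebra_simps)

lemma det2_coords_of_combination:
  assumes "det2 (a - z) (b - z) = 1" "p = z + x *\<^sub>R (a - z) + y *\<^sub>R (b - z)"
  shows "det2 (p - z) (b - z) = x" "det2 (a - z) (p - z) = y"
proof -
  have "det2 (p - z) (b - z) = x * det2 (a - z) (b - z)" "det2 (a - z) (p - z) = y * det2 (a - z) (b - z)"
    unfolding assms(2) by (simp_all add: det2_def algebra_simps)
  then show "det2 (p - z) (b - z) = x" "det2 (a - z) (p - z) = y"
    using assms(1) by simp_all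
qed

lemma mem_triangle_iff:
  assumes "det2 (a - z) (b - z) = 1"
  shows "p \<in> convex hull {z, a, b} \<longleftrightarrow>
    0 \<le> det2 (p - z) (b - z) \<and> 0 \<le> det2 (a - z) (p - z) \<and>
    det2 (p - z) (b - z) + det2 (a - z) (p - z) \<le> 1"
proof -
  have "p \<in> convex hull {z, a, b} \<longleftrightarrow>
     (\<exists>x y. p = z + x *\<^sub>R (a - z) + y *\<^sub>R (b - z) \<and> 0 \<le> x \<and> 0 \<le> y \<and> x + y \<le> 1)"
    unfolding convex_hull_3_alt by blast
  then show ?thesis
    using det2_coords_of_combination[OF assms] det2_coords[OF assms, of p] by metis
qed

lemma det2_cyclic: "det2 (b - a) (z - a) = det2 (a - z) (b - z)"
  by (simp add: det2_def algebra_simps)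

lemma det2_swap: "det2 (b - z) (a - z) = - det2 (a - z) (b - z)"
  by (simp add: det2_def)

lemma det2_swap_base: "det2 (u - w) (p - w) = - det2 (w - u) (p - u)"
  by (simp add: det2_def algebra_simps)

lemma det2_self [simp]: "det2 u u = 0" "det2 u 0 = 0" "det2 0 u = 0"
  by (simp_all add: det2_def)

lemma det2_barycentric:
  assumes "x + y + v = 1"
  shows "det2 (w - u) (x *\<^sub>R u + y *\<^sub>R w + v *\<^sub>R c - u) = v * det2 (w - u) (c - u)"
proof -
  have x: "x = 1 - y - v" using assms by simp
  show ?thesis unfolding x by (simp add: det2_def algebra_simps)
qed

lemma det2_scaleR: "det2 (t *\<^sub>R u) v = t * det2 u v" "det2 u (t *\<^sub>R v) = t * det2 u v"
  by (simp_all add: det2_def algebra_simps)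

lemma det2_lattice:
  assumes "a \<in> lattice_points" "b \<in> lattice_points" "c \<in> lattice_points" "z \<in> lattice_points"
  shows "det2 (a - z) (b - c) \<in> \<int>"
  using assms by (auto simp: lattice_points_def det2_def)

lemma det2_zero_collinear:
  assumes "det2 (w - u) (p - u) = 0" "u \<noteq> w"
  shows "\<exists>t. p = u + t *\<^sub>R (w - u)"
proof (cases "w $ 1 = u $ 1")
  case True
  then have "w $ 2 \<noteq> u $ 2"
    using assms(2) by (auto simp: point_eq_iff)
  then have "p = u + ((p $ 2 - u $ 2) / (w $ 2 - u $ 2)) *\<^sub>R (w - u)"
    using assms(1) True by (auto simp: point_eq_iff det2_def)
  then show ?thesis ..
next
  case False
  define t where "t = (p $ 1 - u $ 1) / (w $ 1 - u $ 1)"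
  have t1: "t * (w $ 1 - u $ 1) = p $ 1 - u $ 1" using False by (simp add: t_def)
  have "(t * (w $ 2 - u $ 2)) * (w $ 1 - u $ 1) = (p $ 2 - u $ 2) * (w $ 1 - u $ 1)"
  proof -
    have "(t * (w $ 2 - u $ 2)) * (w $ 1 - u $ 1) = (t * (w $ 1 - u $ 1)) * (w $ 2 - u $ 2)" by simp
    then show ?thesis using assms(1) unfolding t1 by (simp add: det2_def algebra_simps)
  qed
  then have "t * (w $ 2 - u $ 2) = p $ 2 - u $ 2"
    using False by simp
  then have "p = u + t *\<^sub>R (w - u)"
    using t1 by (simp add: point_eq_iff algebra_simps)
  then show ?thesis ..
qed

section \<open>Weighted means with an interior point\<close>

text \<open>Merging \<open>q\<close> and \<open>r\<close> into one point \<open>s\<close> of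
  \<open>S\<close> reduces the claim to moving from a point of \<open>S\<close> towards an interior
  one.\<close>

lemma interior_combination3:
  fixes S :: "'a::euclidean_space set"
  assumes S: "convex S" and p: "p \<in> interior S" and "q \<in> S" "r \<in> S"
    and pos: "0 < \<alpha>" "0 \<le> \<beta>" "0 \<le> \<gamma>" "\<alpha> + \<beta> + \<gamma> = 1"
  shows "\<alpha> *\<^sub>R p + \<beta> *\<^sub>R q + \<gamma> *\<^sub>R r \<in> interior S"
proof (cases "\<beta> + \<gamma> = 0")
  case True
  then have "\<beta> = 0" "\<gamma> = 0" "\<alpha> = 1"
    using pos by linarith+
  then show ?thesis using p by simp
next
  case False
  define s where "s = (\<beta> / (\<beta> + \<gamma>)) *\<^sub>R q + (\<gamma> / (\<beta> + \<gamma>)) *\<^sub>R r"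
  have "s \<in> S"
    unfolding s_def using assms False by (intro convexD) (auto simp: add_divide_distrib[symmetric])
  moreover have "\<alpha> *\<^sub>R p + \<beta> *\<^sub>R q + \<gamma> *\<^sub>R r = s - \<alpha> *\<^sub>R (s - p)"
  proof -
    have "(1 - \<alpha>) *\<^sub>R s = \<beta> *\<^sub>R q + \<gamma> *\<^sub>R r"
    proof -
      have "1 - \<alpha> = \<beta> + \<gamma>" using pos by simp
      then show ?thesis using False by (simp add: s_def scaleR_add_right)
    qed
    then show ?thesis by (simp add: algebra_simps)
  qed
  ultimately show ?thesis
    using mem_interior_convex_shrink[OF S p, of s \<alpha>] pos by simp
qed

text \<open>Unnormalised weights: later contradictions need a single vector identity and no
  quotients.\<close>

lemma interior_weighted_combination:
  fixes S :: "'a::euclidean_space set"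
  assumes "convex S" "p \<in> interior S" "q \<in> S" "r \<in> S" and pos: "0 < \<alpha>" "0 \<le> \<beta>" "0 \<le> \<gamma>"
    and eq: "\<alpha> *\<^sub>R p + \<beta> *\<^sub>R q + \<gamma> *\<^sub>R r = (\<alpha> + \<beta> + \<gamma>) *\<^sub>R x"
  shows "x \<in> interior S"
proof -
  define n where "n = \<alpha> + \<beta> + \<gamma>"
  have n: "n > 0" using pos by (simp add: n_def)
  have "\<alpha> / n + \<beta> / n + \<gamma> / n = (\<alpha> + \<beta> + \<gamma>) / n" by (simp add: add_divide_distrib)
  then have "\<alpha> / n + \<beta> / n + \<gamma> / n = 1" using n by (simp add: n_def)
  then have "(\<alpha> / n) *\<^sub>R p + (\<beta> / n) *\<^sub>R q + (\<gamma> / n) *\<^sub>R r \<in> interior S"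
    using assms n by (intro interior_combination3) auto
  also have "(\<alpha> / n) *\<^sub>R p + (\<beta> / n) *\<^sub>R q + (\<gamma> / n) *\<^sub>R r = (1 / n) *\<^sub>R (n *\<^sub>R x)"
    unfolding n_def eq[symmetric] by (simp add: algebra_simps)
  finally show ?thesis using n by simp
qed

definition verts :: "point set \<Rightarrow> point set" where
  "verts T = {x. x extreme_point_of T}"

locale unimodular_polygon =
  fixes P :: "point set" and \<Delta> :: "point set set"
  assumes polygon: "lattice_polygon P"
    and triangulation: "unimodular_triangulation P \<Delta>"
begin

lemma P_convex: "convex P" and P_compact: "compact P" and P_closed: "closed P"
proof -
  obtain S where "finite S" "P = convex hull S"
    using polygon by (auto simp: lattice_polygon_def)
  then show "convex P" "compact P" by (auto simp: finite_imp_compact_convex_hull)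
  then show "closed P" by (simp add: compact_imp_closed)
qed

lemma \<Delta>_finite: "finite \<Delta>" and \<Delta>_Union: "\<Union>\<Delta> = P"
  and \<Delta>_Int_face: "\<lbrakk>T \<in> \<Delta>; T' \<in> \<Delta>\<rbrakk> \<Longrightarrow> T \<inter> T' face_of T"
  using triangulation by (auto simp: unimodular_triangulation_def lattice_subdivision_def)

text \<open>Area 1/2 makes the determinant 1 or -1, and exchanging two corners corrects the
  sign.\<close>

lemma triangle_corners:
  assumes "T \<in> \<Delta>"
  shows "\<exists>z a b. verts T = {z, a, b} \<and> T = convex hull {z, a, b} \<and> det2 (a - z) (b - z) = 1
    \<and> {z, a, b} \<subseteq> lattice_points \<and> \<not> affine_dependent {z, a, b}"
proof -
  have "2 simplex T" and meas: "measure lebesgue T = 1/2" and "lattice_polygon T"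
    using assms triangulation by (auto simp: unimodular_triangulation_def lattice_subdivision_def)
  then obtain C where C: "\<not> affine_dependent C" "card C = 3" "T = convex hull C"
    by (auto simp: simplex_def)
  then obtain z a b where zab: "C = {z, a, b}" "z \<noteq> a" "a \<noteq> b" "z \<noteq> b"
    by (auto simp: card_3_iff)
  have V: "verts T = C"
    using C by (auto simp: verts_def extreme_point_of_convex_hull_affine_independent)
  obtain S where "S \<subseteq> lattice_points" "T = convex hull S"
    using \<open>lattice_polygon T\<close> by (auto simp: lattice_polygon_def)
  then have L: "C \<subseteq> lattice_points"
    using V extreme_point_of_convex_hull unfolding verts_def by blast
  have "compact T" using C zab by (simp add: finite_imp_compact_convex_hull)
  then have "measure lebesgue T = measure lborel T"
    by (simp add: borel_compact measure_completion)
  then have "\<bar>(a $ 1 - z $ 1) * (b $ 2 - z $ 2) - (b $ 1 - z $ 1) * (a $ 2 - z $ 2)\<bar> = 1"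
    using meas content_triangle[of z b a] content_triangle[of z a b] C zab
    by (auto simp: abs_if split: if_splits)
  then have "\<bar>det2 (a - z) (b - z)\<bar> = 1"
    by (simp add: det2_def mult.commute)
  then consider "det2 (a - z) (b - z) = 1" | "det2 (b - z) (a - z) = 1"
    by (smt (verit) det2_swap)
  then show ?thesis
  proof cases
    case 1 then show ?thesis using V C L zab by metis
  next
    case 2
    moreover have "C = {z, b, a}" using zab by blast
    ultimately show ?thesis using V C L by metis
  qed
qed

text \<open>Cyclic rotation of the corners preserves the orientation, so any vertex can serve as
  origin.\<close>

lemma corners_at:
  assumes "T \<in> \<Delta>" "z \<in> verts T"
  obtains a b where "verts T = {z, a, b}" "T = convex hull {z, a, b}" "det2 (a - z) (b - z) = 1"
proof -
  obtain x a b where T: "verts T = {x, a, b}" "T = convex hull {x, a, b}" "det2 (a - x) (b - x) = 1"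
    using triangle_corners[OF assms(1)] by metis
  have perm: "{x, a, b} = {a, b, x}" "{x, a, b} = {b, x, a}" by auto
  consider "z = x" | "z = a" | "z = b" using assms(2) T(1) by blast
  then show ?thesis
  proof cases
    case 1
    show ?thesis by (rule that[of a b]; unfold 1; fact)
  next
    case 2
    have "det2 (b - a) (x - a) = 1" using T(3) det2_cyclic[of b a x] by simp
    then show ?thesis using that[of b x] T(1,2) unfolding 2 perm(1) by blast
  next
    case 3
    have "det2 (x - b) (a - b) = 1"
      using T(3) by (simp add: det2_def algebra_simps)
    then show ?thesis using that[of x a] T(1,2) unfolding 3 perm(2) by blast
  qed
qed

lemma corners_edge:
  assumes "T \<in> \<Delta>" "{u, w} \<subseteq> verts T" "u \<noteq> w"
  obtains c where "verts T = {u, w, c}" "T = convex hull {u, w, c}"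
    "det2 (w - u) (c - u) = 1 \<or> det2 (w - u) (c - u) = - 1"
proof -
  obtain a b where T: "verts T = {u, a, b}" "T = convex hull {u, a, b}" "det2 (a - u) (b - u) = 1"
    using corners_at[OF assms(1), of u] assms(2) by blast
  consider "w = a" | "w = b" using assms(2,3) unfolding T(1) by blast
  then show ?thesis
  proof cases
    case 1
    then show ?thesis using that[of b] T by blast
  next
    case 2
    have "{u, a, b} = {u, b, a}" by auto
    moreover have "det2 (b - u) (a - u) = -1" using T(3) det2_swap[of b u a] by simp
    ultimately show ?thesis using that[of a] T(1,2) unfolding 2 by metis
  qed
qed

text \<open>The corner found by \<open>corners_edge\<close> is neither \<open>u\<close> nor
  \<open>w\<close>, as its determinant is nonzero, so it is the prescribed \<open>c\<close>.\<close>

lemma edge_det: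
  assumes "T \<in> \<Delta>" "u \<noteq> w" and V: "verts T = {u, w, c}"
  shows "det2 (w - u) (c - u) = 1 \<or> det2 (w - u) (c - u) = - 1" "T = convex hull {u, w, c}"
    "c \<noteq> u" "c \<noteq> w"
proof -
  obtain d where d: "verts T = {u, w, d}" "T = convex hull {u, w, d}"
    "det2 (w - u) (d - u) = 1 \<or> det2 (w - u) (d - u) = - 1"
    using corners_edge[OF assms(1) _ assms(2)] unfolding V by (metis insertI1 insertI2 insert_subset empty_subsetI)
  have "d \<noteq> u" "d \<noteq> w" using d(3) by auto
  moreover have "d \<in> {u, w, c}" using d(1) unfolding V by simp
  ultimately have "d = c" by simp
  then show "det2 (w - u) (c - u) = 1 \<or> det2 (w - u) (c - u) = - 1" "T = convex hull {u, w, c}"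
    "c \<noteq> u" "c \<noteq> w"
    using d \<open>d \<noteq> u\<close> \<open>d \<noteq> w\<close> by simp_all
qed

lemma verts_lattice: "T \<in> \<Delta> \<Longrightarrow> verts T \<subseteq> lattice_points"
  and verts_independent: "T \<in> \<Delta> \<Longrightarrow> \<not> affine_dependent (verts T)"
  and triangle_hull: "T \<in> \<Delta> \<Longrightarrow> T = convex hull (verts T)"
  using triangle_corners by metis+

lemma verts_subset: "verts T \<subseteq> T"
  by (auto simp: verts_def extreme_point_of_def)

lemma triangle_subset_P: "T \<in> \<Delta> \<Longrightarrow> T \<subseteq> P"
  using \<Delta>_Union by blast

lemma triangle_closed: "T \<in> \<Delta> \<Longrightarrow> closed T"
  using triangulation
  by (auto simp: unimodular_triangulation_def lattice_subdivision_def lattice_polygon_def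
      intro!: compact_imp_closed finite_imp_compact_convex_hull)

lemma triangle_convex: "T \<in> \<Delta> \<Longrightarrow> convex T"
  using triangulation
  by (auto simp: unimodular_triangulation_def lattice_subdivision_def lattice_polygon_def)

lemma verts_inj: "\<lbrakk>T \<in> \<Delta>; T' \<in> \<Delta>; verts T = verts T'\<rbrakk> \<Longrightarrow> T = T'"
  using triangle_hull by metis

lemma face_hull:
  assumes "T \<in> \<Delta>" "F face_of T"
  shows "verts F \<subseteq> verts T" "F = convex hull (verts F)"
proof -
  show "verts F \<subseteq> verts T"
    using assms(2) by (auto simp: verts_def extreme_point_of_face)
  obtain c where c: "c \<subseteq> verts T" "F = convex hull c"
    using face_of_convex_hull_affine_independent[OF verts_independent[OF assms(1)]]
      triangle_hull[OF assms(1)] assms(2) by metis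
  then have "\<not> affine_dependent c"
    using verts_independent[OF assms(1)] affine_independent_subset by blast
  then have "verts F = c"
    using c by (auto simp: verts_def extreme_point_of_convex_hull_affine_independent)
  then show "F = convex hull (verts F)" using c by simp
qed

text \<open>The intersection is a face of both triangles, and a face of a simplex is spanned by
  corners. From here on incidence of triangles is a question about finite vertex sets.\<close>

lemma triangle_Int:
  assumes "T \<in> \<Delta>" "T' \<in> \<Delta>"
  shows "T \<inter> T' = convex hull (verts T \<inter> verts T')"
proof
  have "verts (T \<inter> T') \<subseteq> verts T" "verts (T \<inter> T') \<subseteq> verts T'"
    using face_hull(1)[OF assms(1) \<Delta>_Int_face[OF assms]]
      face_hull(1)[OF assms(2) \<Delta>_Int_face[OF assms(2,1)]] by (simp_all add: Int_commute)
  then show "T \<inter> T' \<subseteq> convex hull (verts T \<inter> verts T')"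
    using face_hull(2)[OF assms(1) \<Delta>_Int_face[OF assms]] by (metis hull_mono le_inf_iff)
  show "convex hull (verts T \<inter> verts T') \<subseteq> T \<inter> T'"
    using triangle_hull[OF assms(1)] triangle_hull[OF assms(2)] hull_mono[of "verts T \<inter> verts T'" "verts T" convex]
      hull_mono[of "verts T \<inter> verts T'" "verts T'" convex] by auto
qed

lemma edge_of_iff:
  assumes "T \<in> \<Delta>"
  shows "s edge_of T \<longleftrightarrow> (\<exists>u w. u \<noteq> w \<and> {u, w} \<subseteq> verts T \<and> s = closed_segment u w)"
proof
  assume "s edge_of T"
  then have s: "s face_of T" "aff_dim s = 1" by (auto simp: edge_of_def)
  have sub: "verts s \<subseteq> verts T" and hull: "s = convex hull (verts s)"
    using face_hull[OF assms s(1)] by auto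
  have ind: "\<not> affine_dependent (verts s)"
    using sub verts_independent[OF assms] affine_independent_subset by blast
  have "aff_dim (verts s) = 1" using s hull aff_dim_convex_hull by metis
  then have "int (card (verts s)) = 2"
    using ind by (simp add: affine_independent_iff_card)
  then obtain u w where "verts s = {u, w}" "u \<noteq> w"
    by (metis card_2_iff of_nat_eq_iff of_nat_numeral)
  then show "\<exists>u w. u \<noteq> w \<and> {u, w} \<subseteq> verts T \<and> s = closed_segment u w"
    using sub hull by (metis segment_convex_hull)
next
  assume "\<exists>u w. u \<noteq> w \<and> {u, w} \<subseteq> verts T \<and> s = closed_segment u w"
  then obtain u w where uw: "u \<noteq> w" "{u, w} \<subseteq> verts T" "s = closed_segment u w" by blast
  have "s face_of convex hull (verts T)"
    using uw face_of_convex_hull_affine_independent[OF verts_independent[OF assms]]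
    by (metis segment_convex_hull)
  then have "s face_of T" using triangle_hull[OF assms] by simp
  moreover have "aff_dim s = 1"
    using uw by (simp add: segment_convex_hull aff_dim_convex_hull)
  ultimately show "s edge_of T" by (simp add: edge_of_def)
qed

lemma segment_edge_iff:
  assumes "T \<in> \<Delta>" "u \<noteq> w"
  shows "closed_segment u w edge_of T \<longleftrightarrow> {u, w} \<subseteq> verts T"
  using edge_of_iff[OF assms(1)] assms(2) by (metis closed_segment_eq)

text \<open>The coordinates are nonnegative integers with sum at most 1, which leaves only the three
  corners.\<close>

lemma lattice_point_vert:
  assumes "T \<in> \<Delta>" "p \<in> T" "p \<in> lattice_points"
  shows "p \<in> verts T"
proof -
  obtain z a b where T: "verts T = {z, a, b}" "T = convex hull {z, a, b}" "det2 (a - z) (b - z) = 1"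
    "{z, a, b} \<subseteq> lattice_points"
    using triangle_corners[OF assms(1)] by metis
  define x y where "x = det2 (p - z) (b - z)" and "y = det2 (a - z) (p - z)"
  have "x \<in> \<int>" "y \<in> \<int>"
    unfolding x_def y_def using T assms by (auto intro!: det2_lattice)
  then obtain i j :: int where ij: "x = of_int i" "y = of_int j" by (auto simp: Ints_def)
  have "0 \<le> x" "0 \<le> y" "x + y \<le> 1"
    using assms(2) T(2) mem_triangle_iff[OF T(3)] unfolding x_def y_def by auto
  then have "0 \<le> i" "0 \<le> j" "i + j \<le> 1" unfolding ij by linarith+
  then have "(i = 0 \<and> j = 0) \<or> (i = 1 \<and> j = 0) \<or> (i = 0 \<and> j = 1)" by arith
  moreover have "p = z + x *\<^sub>R (a - z) + y *\<^sub>R (b - z)"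
    unfolding x_def y_def by (rule det2_coords[OF T(3)])
  ultimately show ?thesis using T(1) ij by auto
qed

lemma lattice_point_covered:
  assumes "p \<in> P" "p \<in> lattice_points"
  obtains T where "T \<in> \<Delta>" "p \<in> verts T"
  using assms \<Delta>_Union lattice_point_vert by blast

text \<open>The finitely many triangles missing \<open>x\<close> have a closed union, whose
  complement is a neighbourhood of \<open>x\<close>.\<close>

lemma local_triangles:
  assumes "x \<in> interior P"
  obtains r where "r > 0" "ball x r \<subseteq> P" "\<And>T y. \<lbrakk>T \<in> \<Delta>; y \<in> T; y \<in> ball x r\<rbrakk> \<Longrightarrow> x \<in> T"
proof -
  let ?U = "interior P - \<Union>{T \<in> \<Delta>. x \<notin> T}"
  have "closed (\<Union>{T \<in> \<Delta>. x \<notin> T})"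
    using \<Delta>_finite triangle_closed by (intro closed_Union) auto
  then have "open ?U" by (intro open_Diff) auto
  moreover have "x \<in> ?U" using assms by auto
  ultimately obtain r where "r > 0" "ball x r \<subseteq> ?U" using open_contains_ball by blast
  then show ?thesis using that[of r] interior_subset by blast
qed

text \<open>Third corners on the same side would have equal height over the edge, hence differ by a
  multiple of its direction; the triangles would then overlap near the middle of the edge, off their
  common face.\<close>

lemma opposite_sides:
  assumes "T \<in> \<Delta>" "T' \<in> \<Delta>" "T \<noteq> T'" "u \<noteq> w" "verts T = {u, w, c}" "verts T' = {u, w, c'}"
  shows "det2 (w - u) (c - u) * det2 (w - u) (c' - u) = - 1"
proof (rule ccontr)
  assume neg: "\<not> ?thesis"
  note e = edge_det[OF assms(1,4,5)] and e' = edge_det[OF assms(2,4,6)]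
  have eq: "det2 (w - u) (c' - u) = det2 (w - u) (c - u)" (is "?D' = ?D")
    using e(1) e'(1) neg by auto
  have D: "?D = 1 \<or> ?D = -1" by (rule e(1))
  have cc: "c \<noteq> c'" using assms verts_inj by metis
  have "det2 (w - u) ((c' - c + u) - u) = 0"
    using eq by (simp add: det2_def algebra_simps)
  then obtain k where "c' - c + u = u + k *\<^sub>R (w - u)" using det2_zero_collinear[OF _ assms(4)] by blast
  then have k: "c = c' - k *\<^sub>R (w - u)" by (simp add: algebra_simps)
  \<comment> \<open>This size gives \<open>|k| * \<epsilon> = 1/2 - \<epsilon>\<close>, so the point
    \<open>y\<close> below has nonnegative weights in both triangles.\<close>
  define \<epsilon> where "\<epsilon> = 1 / (2 * (\<bar>k\<bar> + 1))"
  have \<epsilon>: "0 < \<epsilon>" "\<epsilon> \<le> 1/2" "\<bar>k\<bar> * \<epsilon> \<le> 1/2 - \<epsilon>"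
    unfolding \<epsilon>_def by (auto simp: field_simps)
  have ke: "k * \<epsilon> \<le> 1/2 - \<epsilon>" "- (k * \<epsilon>) \<le> 1/2 - \<epsilon>"
    using \<epsilon>(3) abs_ge_self[of "k * \<epsilon>"] abs_ge_minus_self[of "k * \<epsilon>"] \<epsilon>(1) unfolding abs_mult by linarith+
  define y where "y = (1/2 - \<epsilon>) *\<^sub>R u + (1/2) *\<^sub>R w + \<epsilon> *\<^sub>R c"
  have "y \<in> convex hull {u, w, c}"
    unfolding y_def convex_hull_3 using \<epsilon> by force
  moreover have "y = (1/2 - \<epsilon> + k * \<epsilon>) *\<^sub>R u + (1/2 - k * \<epsilon>) *\<^sub>R w + \<epsilon> *\<^sub>R c'"
    unfolding y_def k by (simp add: algebra_simps)
  moreover have "0 \<le> 1/2 - \<epsilon> + k * \<epsilon>" "0 \<le> 1/2 - k * \<epsilon>" "0 \<le> \<epsilon>"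
    "1/2 - \<epsilon> + k * \<epsilon> + (1/2 - k * \<epsilon>) + \<epsilon> = 1"
    using \<epsilon> ke by linarith+
  ultimately have "y \<in> convex hull {u, w, c'}" "y \<in> convex hull {u, w, c}"
    unfolding convex_hull_3 by blast+
  then have "y \<in> T \<inter> T'" using e(2) e'(2) by simp
  then have "y \<in> convex hull ({u, w, c} \<inter> {u, w, c'})" using triangle_Int assms by metis
  moreover have "{u, w, c} \<inter> {u, w, c'} = {u, w}"
    using cc e(3,4) e'(3,4) by auto
  ultimately have "y \<in> closed_segment u w" by (simp add: segment_convex_hull)
  then obtain t where t: "y = (1 - t) *\<^sub>R u + t *\<^sub>R w" by (auto simp: closed_segment_def)
  have "det2 (w - u) (y - u) = 0" unfolding t by (simp add: det2_def algebra_simps)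
  moreover have "det2 (w - u) (y - u) = \<epsilon> * ?D"
    unfolding y_def by (rule det2_barycentric) simp
  ultimately show False using \<epsilon> D by auto
qed

text \<open>Three pairwise opposite sides are impossible: the product of the three relations would
  be a real square equal to -1.\<close>

lemma at_most_two_triangles:
  assumes "T \<in> \<Delta>" "T' \<in> \<Delta>" "T'' \<in> \<Delta>" "T \<noteq> T'" "u \<noteq> w"
    "{u, w} \<subseteq> verts T" "{u, w} \<subseteq> verts T'" "{u, w} \<subseteq> verts T''"
  shows "T'' = T \<or> T'' = T'"
proof (rule ccontr)
  assume "\<not> ?thesis"
  then have ne: "T \<noteq> T''" "T' \<noteq> T''" by auto
  obtain c where c: "verts T = {u, w, c}" using corners_edge[OF assms(1,6,5)] by metis
  obtain c' where c': "verts T' = {u, w, c'}" using corners_edge[OF assms(2,7,5)] by metis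
  obtain c'' where c'': "verts T'' = {u, w, c''}" using corners_edge[OF assms(3,8,5)] by metis
  have "det2 (w - u) (c - u) * det2 (w - u) (c' - u) = - 1" (is "?x * ?y = _")
       "det2 (w - u) (c - u) * det2 (w - u) (c'' - u) = - 1" (is "_ * ?z = _")
       "det2 (w - u) (c' - u) * det2 (w - u) (c'' - u) = - 1"
    using opposite_sides assms ne c c' c'' by blast+
  then have "(?x * ?y) * (?x * ?z) * (?y * ?z) = -1" by simp
  moreover have "(?x * ?y) * (?x * ?z) * (?y * ?z) = (?x * ?y * ?z)\<^sup>2" by (simp add: power2_eq_square)
  ultimately show False by (metis not_numeral_le_zero zero_le_power2 neg_0_le_iff_le not_one_le_zero)
qed

lemma midpoint_in_interior_segment:
  assumes "u \<in> interior P" "w \<in> P" "u \<noteq> w"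
  shows "midpoint u w \<in> interior P"
proof -
  have "open_segment u w \<subseteq> interior P"
    using in_interior_closure_convex_segment[OF P_convex assms(1)] assms(2) closure_subset by blast
  then show ?thesis using assms(3) midpoint_in_open_segment by blast
qed

text \<open>Push the midpoint slightly away from the third corner. A triangle found there still
  contains the midpoint, hence by the face property both ends of the edge, and it contains a point
  on the other side.\<close>

lemma second_triangle:
  assumes "T \<in> \<Delta>" "u \<noteq> w" "{u, w} \<subseteq> verts T" "midpoint u w \<in> interior P"
  obtains T' where "T' \<in> \<Delta>" "T' \<noteq> T" "{u, w} \<subseteq> verts T'"
proof -
  obtain c where c: "verts T = {u, w, c}" "T = convex hull {u, w, c}"
    "det2 (w - u) (c - u) = 1 \<or> det2 (w - u) (c - u) = - 1"
    using corners_edge[OF assms(1,3,2)] by metis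
  let ?m = "midpoint u w"
  obtain r where r: "r > 0" "ball ?m r \<subseteq> P" "\<And>T y. \<lbrakk>T \<in> \<Delta>; y \<in> T; y \<in> ball ?m r\<rbrakk> \<Longrightarrow> ?m \<in> T"
    using local_triangles[OF assms(4)] by metis
  define e where "e = r / (2 * (norm (c - ?m) + 1))"
  have n: "norm (c - ?m) + 1 > 0" by (smt (verit) norm_ge_zero)
  have e: "e > 0" using r n by (simp add: e_def)
  have "e * norm (c - ?m) < r"
    using n r unfolding e_def by (simp add: field_simps) (smt (verit) mult_nonneg_nonneg norm_ge_zero)
  define y where "y = ?m - e *\<^sub>R (c - ?m)"
  have y: "y \<in> ball ?m r" using \<open>e * norm (c - ?m) < r\<close> e by (simp add: y_def dist_norm)
  then obtain T' where T': "T' \<in> \<Delta>" "y \<in> T'" using r \<Delta>_Union by blast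
  have "?m \<in> T'" using r(3)[OF T' y] .
  moreover have "?m \<in> T" using c assms(2) triangle_convex[OF assms(1)]
    by (metis assms(1,3) convex_contains_segment in_mono insert_subset midpoint_in_closed_segment verts_subset)
  ultimately have m: "?m \<in> T \<inter> T'" by simp
  have "u \<in> T" "w \<in> T" using assms verts_subset by blast+
  then have "u \<in> T \<inter> T'" "w \<in> T \<inter> T'"
    using face_ofD[OF \<Delta>_Int_face[OF assms(1) T'(1)] midpoint_in_open_segment[THEN iffD2, OF assms(2)] _ _ m] by auto
  then have "{u, w} \<subseteq> verts T'" using lattice_point_vert[OF T'(1)] verts_lattice[OF assms(1)] assms(3) by blast
  moreover have "T' \<noteq> T"
  proof
    assume "T' = T"
    then have "y \<in> convex hull {u, w, c}" using T' c by simp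
    then obtain \<alpha> \<beta> \<gamma> where abc: "y = \<alpha> *\<^sub>R u + \<beta> *\<^sub>R w + \<gamma> *\<^sub>R c" "0 \<le> \<gamma>" "\<alpha> + \<beta> + \<gamma> = 1"
      unfolding convex_hull_3 by blast
    have "det2 (w - u) (y - u) = \<gamma> * det2 (w - u) (c - u)"
      unfolding abc(1) using abc(3) by (rule det2_barycentric)
    moreover have "det2 (w - u) (y - u) = - e * det2 (w - u) (c - u)"
    proof -
      have "det2 (w - u) (?m - u) = 0" by (simp add: det2_def midpoint_def field_simps)
      moreover have "det2 (w - u) (y - u)
          = (1 + e) * det2 (w - u) (?m - u) - e * det2 (w - u) (c - u)"
        unfolding y_def by (simp add: det2_def algebra_simps)
      ultimately show ?thesis by simp
    qed
    ultimately have "\<gamma> = - e" using c by auto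
    then show False using abc e by simp
  qed
  ultimately show ?thesis using that T' by blast
qed

end

section \<open>The triangles around an interior vertex\<close>

text \<open>The slit ball is star-shaped about a point on the ray opposite to the slit.\<close>

lemma connected_slit_ball:
  fixes v u :: "'a::real_normed_vector"
  assumes "r > 0" "u \<noteq> v"
  shows "connected {y \<in> ball v r. \<forall>t\<ge>0. y \<noteq> v + t *\<^sub>R (u - v)}"
proof -
  let ?B = "{y \<in> ball v r. \<forall>t\<ge>0. y \<noteq> v + t *\<^sub>R (u - v)}"
  define k where "k = r / (2 * norm (u - v))"
  define c where "c = v - k *\<^sub>R (u - v)"
  have k: "k > 0" using assms by (simp add: k_def)
  have "c \<in> ball v r"
    using assms by (simp add: c_def k_def dist_norm)
  have neg: "t < 0" if "c = v + t *\<^sub>R (u - v)" for t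
  proof -
    have "(t + k) *\<^sub>R (u - v) = 0" using that by (simp add: c_def algebra_simps)
    then show ?thesis using assms(2) k by simp
  qed
  have "closed_segment c y \<subseteq> ?B" if y: "y \<in> ?B" for y
  proof
    fix x assume x: "x \<in> closed_segment c y"
    then have "x \<in> ball v r"
      using \<open>c \<in> ball v r\<close> y closed_segment_subset[of c "ball v r" y] by auto
    moreover have False if t: "t \<ge> 0" "x = v + t *\<^sub>R (u - v)" for t
    proof -
      obtain l where l: "x = (1 - l) *\<^sub>R c + l *\<^sub>R y" "0 \<le> l" "l \<le> 1"
        using x by (auto simp: closed_segment_def)
      have "l \<noteq> 0" using l t neg[of t] by auto
      have "l *\<^sub>R y = v + t *\<^sub>R (u - v) - (1 - l) *\<^sub>R c" using l(1) t(2) by (simp add: algebra_simps)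
      also have "\<dots> = l *\<^sub>R v + (t + (1 - l) * k) *\<^sub>R (u - v)" by (simp add: c_def algebra_simps)
      also have "\<dots> = l *\<^sub>R (v + ((t + (1 - l) * k) / l) *\<^sub>R (u - v))"
        using \<open>l \<noteq> 0\<close> by (simp add: scaleR_add_right)
      finally have "y = v + ((t + (1 - l) * k) / l) *\<^sub>R (u - v)" using \<open>l \<noteq> 0\<close> by simp
      moreover have "(t + (1 - l) * k) / l \<ge> 0" using l t k by simp
      ultimately show False using y by blast
    qed
    ultimately show "x \<in> ?B" by blast
  qed
  moreover have "c \<in> ?B" using \<open>c \<in> ball v r\<close> neg by force
  ultimately show ?thesis by (intro starlike_imp_connected) (auto simp: starlike_def)
qed

context unimodular_polygon
begin

text \<open>A triangle leaves \<open>v\<close> in two independent directions, and only one of them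
  can run along the slit.\<close>

lemma triangle_neighbourhood_point:
  assumes "T \<in> \<Delta>" "v \<in> verts T" "r > 0" "u \<noteq> v"
  shows "T \<inter> {y \<in> ball v r. \<forall>t\<ge>0. y \<noteq> v + t *\<^sub>R (u - v)} \<noteq> {}"
proof -
  obtain a b where T: "verts T = {v, a, b}" "T = convex hull {v, a, b}" "det2 (a - v) (b - v) = 1"
    using corners_at[OF assms(1,2)] by metis
  have near: "\<exists>\<epsilon>>0. v + \<epsilon> *\<^sub>R (p - v) \<in> T \<inter> ball v r" if p: "p \<in> {a, b}" for p
  proof -
    define N where "N = norm (p - v) + 1"
    define \<epsilon> where "\<epsilon> = min 1 (r / (2 * N))"
    have n: "N > 0" unfolding N_def by (smt (verit) norm_ge_zero)
    then have "0 < \<epsilon>" "\<epsilon> \<le> 1" using assms(3) by (auto simp: \<epsilon>_def)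
    have "\<epsilon> * N \<le> r / (2 * N) * N"
      using n by (intro mult_right_mono) (auto simp: \<epsilon>_def)
    also have "\<dots> < r" using n assms(3) by simp
    finally have "\<epsilon> * norm (p - v) < r" using \<open>0 < \<epsilon>\<close> by (simp add: N_def algebra_simps)
    then have "v + \<epsilon> *\<^sub>R (p - v) \<in> ball v r" using \<open>0 < \<epsilon>\<close> by (simp add: dist_norm)
    moreover have "v \<in> T" "p \<in> T"
      unfolding T(2) using p by (auto intro: hull_inc)
    then have "v + \<epsilon> *\<^sub>R (p - v) \<in> T"
      using triangle_convex[OF assms(1)] \<open>0 < \<epsilon>\<close> \<open>\<epsilon> \<le> 1\<close>
        convexD_alt[of T v p \<epsilon>] by (simp add: algebra_simps)
    ultimately show ?thesis using \<open>0 < \<epsilon>\<close> by blast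
  qed
  obtain e f where ef: "e > 0" "v + e *\<^sub>R (a - v) \<in> T \<inter> ball v r" "f > 0" "v + f *\<^sub>R (b - v) \<in> T \<inter> ball v r"
    using near by (metis insertI1 insertI2)
  have "\<not> (\<exists>t\<ge>0. v + e *\<^sub>R (a - v) = v + t *\<^sub>R (u - v)) \<or> \<not> (\<exists>t\<ge>0. v + f *\<^sub>R (b - v) = v + t *\<^sub>R (u - v))"
  proof (rule ccontr)
    assume "\<not> ?thesis"
    then obtain s t where st: "e *\<^sub>R (a - v) = s *\<^sub>R (u - v)" "f *\<^sub>R (b - v) = t *\<^sub>R (u - v)" by auto
    have "e * f * det2 (a - v) (b - v) = det2 (e *\<^sub>R (a - v)) (f *\<^sub>R (b - v))"
      by (simp add: det2_def algebra_simps)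
    also have "\<dots> = 0" unfolding st by (simp add: det2_def)
    finally show False using T(3) ef by simp
  qed
  then show ?thesis using ef by blast
qed

text \<open>One step of a walk around \<open>v\<close> that avoids one prescribed dual edge, the
  spoke to \<open>u0\<close>.\<close>

definition star_adjacent :: "point \<Rightarrow> point \<Rightarrow> (point set \<times> point set) set" where
  "star_adjacent v u0 = {(X, Y). X \<in> \<Delta> \<and> Y \<in> \<Delta> \<and> X \<noteq> Y \<and>
     (\<exists>u. u \<noteq> v \<and> u \<noteq> u0 \<and> {v, u} \<subseteq> verts X \<and> {v, u} \<subseteq> verts Y)}"

text \<open>
  The triangles around an interior vertex remain connected when one spoke is cut, because a disc
  slit along a radius is connected.
\<close>

lemma star_connected:
  assumes v: "v \<in> interior P" and "u0 \<noteq> v" and T: "T \<in> \<Delta>" "v \<in> verts T" and T': "T' \<in> \<Delta>" "v \<in> verts T'"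
  shows "(T, T') \<in> (star_adjacent v u0)\<^sup>*"
proof -
  let ?R = "star_adjacent v u0"
  obtain r where r: "r > 0" "ball v r \<subseteq> P" "\<And>T y. \<lbrakk>T \<in> \<Delta>; y \<in> T; y \<in> ball v r\<rbrakk> \<Longrightarrow> v \<in> T"
    using local_triangles[OF v] by metis
  let ?B = "{y \<in> ball v r. \<forall>t\<ge>0. y \<noteq> v + t *\<^sub>R (u0 - v)}"
  define N where "N = {X \<in> \<Delta>. v \<in> verts X \<and> (T, X) \<in> ?R\<^sup>*}"
  define M where "M = {X \<in> \<Delta>. v \<in> verts X \<and> (T, X) \<notin> ?R\<^sup>*}"
  have fin: "finite N" "finite M" and sub: "N \<subseteq> \<Delta>" "M \<subseteq> \<Delta>"
    using \<Delta>_finite by (auto simp: N_def M_def)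
  have vlat: "v \<in> lattice_points" using verts_lattice T by blast
  have "closed (\<Union>N)" "closed (\<Union>M)"
    using fin sub triangle_closed by (auto intro!: closed_Union)
  moreover have "?B \<subseteq> \<Union>N \<union> \<Union>M"
  proof
    fix y assume y: "y \<in> ?B"
    then obtain X where X: "X \<in> \<Delta>" "y \<in> X" using r(2) \<Delta>_Union by blast
    then have "v \<in> verts X" using r(3) y lattice_point_vert vlat by blast
    then show "y \<in> \<Union>N \<union> \<Union>M" using X by (auto simp: N_def M_def)
  qed
  \<comment> \<open>If the common corners were only \<open>v\<close> and possibly \<open>u0\<close>,
    a shared point would lie on the slit. Sharing a point off the slit thus means sharing an
    admissible spoke, which would put \<open>Y\<close> into \<open>N\<close>.\<close>
  moreover have "\<Union>N \<inter> \<Union>M \<inter> ?B = {}"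
  proof -
    have False if X: "X \<in> N" "y \<in> X" and Y: "Y \<in> M" "y \<in> Y" and y: "y \<in> ?B" for X Y y
    proof -
      have XY: "X \<in> \<Delta>" "Y \<in> \<Delta>" "v \<in> verts X" "v \<in> verts Y" using X Y by (auto simp: N_def M_def)
      have "X \<noteq> Y" using X Y by (auto simp: N_def M_def)
      then have "verts X \<noteq> verts Y" using verts_inj XY by blast
      have hull: "y \<in> convex hull (verts X \<inter> verts Y)" using triangle_Int XY X Y by blast
      have "\<exists>u. u \<in> verts X \<inter> verts Y \<and> u \<noteq> v \<and> u \<noteq> u0"
      proof (rule ccontr)
        assume "\<not> ?thesis"
        then have "verts X \<inter> verts Y \<subseteq> {v, u0}" by blast
        then have "y \<in> closed_segment v u0"
          using hull hull_mono[of "verts X \<inter> verts Y" "{v, u0}" convex] by (auto simp: segment_convex_hull)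
        then obtain t where "0 \<le> t" "y = v + t *\<^sub>R (u0 - v)"
          by (auto simp: closed_segment_def algebra_simps)
        then show False using y by blast
      qed
      then have "(X, Y) \<in> ?R" using XY \<open>X \<noteq> Y\<close> by (auto simp: star_adjacent_def)
      then show False using X Y by (auto simp: N_def M_def intro: rtrancl_into_rtrancl)
    qed
    then show ?thesis by blast
  qed
  moreover have "T \<in> N" using T by (auto simp: N_def)
  then have "\<Union>N \<inter> ?B \<noteq> {}"
    using triangle_neighbourhood_point[OF T r(1) assms(2)] by blast
  ultimately have "\<Union>M \<inter> ?B = {}"
    using connected_closedD[OF connected_slit_ball[OF r(1) assms(2)]] by blast
  then have "T' \<notin> M" using triangle_neighbourhood_point[OF T' r(1) assms(2)] by blast
  then show ?thesis using T' by (auto simp: M_def)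
qed

text \<open>A supporting line at a boundary midpoint contains both end points and so is the line of
  the edge; but the two third corners lie strictly on opposite sides of it.\<close>

lemma shared_edge_midpoint_interior:
  assumes "T \<in> \<Delta>" "T' \<in> \<Delta>" "T \<noteq> T'" "u \<noteq> w" "{u, w} \<subseteq> verts T" "{u, w} \<subseteq> verts T'"
  shows "midpoint u w \<in> interior P"
proof (rule ccontr)
  assume "midpoint u w \<notin> interior P"
  obtain c where c: "verts T = {u, w, c}" using corners_edge[OF assms(1,5,4)] by metis
  obtain c' where c': "verts T' = {u, w, c'}" using corners_edge[OF assms(2,6,4)] by metis
  have op: "det2 (w - u) (c - u) * det2 (w - u) (c' - u) = - 1"
    using opposite_sides[OF assms(1-4) c c'] .
  have inP: "u \<in> P" "w \<in> P" "c \<in> P" "c' \<in> P"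
    using c c' verts_subset triangle_subset_P[OF assms(1)] triangle_subset_P[OF assms(2)] by blast+
  have "midpoint u w \<in> P"
    using inP P_convex by (meson convex_contains_segment in_mono midpoint_in_closed_segment)
  moreover have "rel_interior P = interior P"
    using polygon by (intro rel_interior_interior) (simp add: lattice_polygon_def aff_dim_eq_full[symmetric])
  ultimately obtain n where n: "n \<noteq> 0" "\<And>y. y \<in> P \<Longrightarrow> n \<bullet> midpoint u w \<le> n \<bullet> y"
    using supporting_hyperplane_rel_boundary[OF P_convex, of "midpoint u w"] \<open>midpoint u w \<notin> interior P\<close>
    by metis
  have "n \<bullet> midpoint u w = (n \<bullet> u + n \<bullet> w) / 2"
    by (simp add: midpoint_def inner_add_right)
  then have eq: "n \<bullet> u = n \<bullet> w" "n \<bullet> midpoint u w = n \<bullet> u" using n(2)[OF inP(1)] n(2)[OF inP(2)] by auto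
  have "n \<bullet> (w - u) = 0" using eq by (simp add: inner_diff_right)
  then have n0: "n $ 1 * (w $ 1 - u $ 1) + n $ 2 * (w $ 2 - u $ 2) = 0"
    by (simp add: inner_vec_def sum_2)
  \<comment> \<open>\<open>n\<close> is orthogonal to the edge, so up to the factor \<open>k\<close>
    its inner product with \<open>y - u\<close> is the determinant.\<close>
  obtain k where k: "n $ 1 = - k * (w $ 2 - u $ 2)" "n $ 2 = k * (w $ 1 - u $ 1)"
  proof (cases "w $ 1 = u $ 1")
    case True
    then have "w $ 2 \<noteq> u $ 2" using assms(4) by (auto simp: point_eq_iff)
    then show ?thesis using that[of "- n $ 1 / (w $ 2 - u $ 2)"] n0 True by simp
  next
    case False
    then show ?thesis using that[of "n $ 2 / (w $ 1 - u $ 1)"] n0 by (simp add: field_simps)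
  qed
  have in_det: "n \<bullet> (y - u) = k * det2 (w - u) (y - u)" for y
    by (simp add: k inner_vec_def sum_2 det2_def algebra_simps)
  have "k \<noteq> 0" using n(1) k by (auto simp: point_eq_iff)
  have "0 \<le> n \<bullet> (c - u)" "0 \<le> n \<bullet> (c' - u)"
    using n(2)[OF inP(3)] n(2)[OF inP(4)] eq by (auto simp: inner_diff_right)
  then have "0 \<le> (k * det2 (w - u) (c - u)) * (k * det2 (w - u) (c' - u))"
    unfolding in_det by (rule mult_nonneg_nonneg)
  also have "\<dots> = k\<^sup>2 * (det2 (w - u) (c - u) * det2 (w - u) (c' - u))" by (simp add: power2_eq_square)
  finally show False unfolding op using \<open>k \<noteq> 0\<close> by simp
qed

section \<open>Chords\<close>

lemma segment_subset_triangle: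
  assumes "T \<in> \<Delta>" "{u, w} \<subseteq> verts T"
  shows "closed_segment u w \<subseteq> T"
  using assms verts_subset[of T] by (intro closed_segment_subset triangle_convex) auto

text \<open>Boundary end points are expressed as not being interior; membership in \<open>P\<close>
  comes from the triangles. Asking for two triangles excludes the edges on the boundary.\<close>

definition chord :: "point \<Rightarrow> point \<Rightarrow> bool" where
  "chord u w \<longleftrightarrow> u \<noteq> w \<and> u \<notin> interior P \<and> w \<notin> interior P \<and>
     (\<exists>T\<in>\<Delta>. \<exists>T'\<in>\<Delta>. T \<noteq> T' \<and> {u, w} \<subseteq> verts T \<and> {u, w} \<subseteq> verts T')"

text \<open>The far side is the left of the directed line from \<open>u\<close> to \<open>w\<close>,
  so reversing a chord exchanges its sides. One vertex strictly on the left suffices, because no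
  triangle straddles a chord (\<open>chord_side\<close>).\<close>

definition beyond :: "point \<Rightarrow> point \<Rightarrow> point set \<Rightarrow> bool" where
  "beyond u w X \<longleftrightarrow> (\<exists>y\<in>verts X. 0 < det2 (w - u) (y - u))"

lemma chord_commute: "chord u w \<longleftrightarrow> chord w u"
  unfolding chord_def by auto

lemma chord_in_P: "chord u w \<Longrightarrow> u \<in> P \<and> w \<in> P"
  unfolding chord_def using verts_subset triangle_subset_P by blast

lemma chord_midpoint: "chord u w \<Longrightarrow> midpoint u w \<in> interior P"
  unfolding chord_def using shared_edge_midpoint_interior by blast

text \<open>Otherwise \<open>u\<close> lies strictly between a point of \<open>P\<close> and the
  interior midpoint of the chord, and would itself be interior.\<close>

lemma chord_ray:
  assumes "chord u w" "u + t *\<^sub>R (w - u) \<in> P"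
  shows "0 \<le> t"
proof (rule ccontr)
  assume "\<not> 0 \<le> t"
  then have t: "1/2 - t > 0" "t < 0" by auto
  \<comment> \<open>The weights solve \<open>\<alpha> / 2 + \<beta> * t = 0\<close> with sum 1,
    which places the combination at \<open>u\<close>.\<close>
  define \<alpha> where "\<alpha> = - t / (1/2 - t)"
  define \<beta> where "\<beta> = (1/2) / (1/2 - t)"
  have ab: "\<alpha> > 0" "\<beta> \<ge> 0" "\<alpha> + \<beta> = 1" "\<alpha> / 2 + \<beta> * t = 0"
    using t by (auto simp: \<alpha>_def \<beta>_def field_simps)
  have "\<alpha> *\<^sub>R midpoint u w + \<beta> *\<^sub>R (u + t *\<^sub>R (w - u)) + 0 *\<^sub>R u \<in> interior P"
    using ab chord_midpoint[OF assms(1)] assms(2) chord_in_P[OF assms(1)]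
    by (intro interior_combination3[OF P_convex]) auto
  moreover have "\<alpha> *\<^sub>R midpoint u w + \<beta> *\<^sub>R (u + t *\<^sub>R (w - u)) + 0 *\<^sub>R u
    = (\<alpha> + \<beta>) *\<^sub>R u + (\<alpha> / 2 + \<beta> * t) *\<^sub>R (w - u)"
  proof -
    have m: "midpoint u w = u + (1/2) *\<^sub>R (w - u)" by (simp add: point_eq_iff midpoint_def field_simps)
    show ?thesis unfolding m by (simp add: algebra_simps)
  qed
  ultimately have "u \<in> interior P" using ab by simp
  then show False using assms(1) by (simp add: chord_def)
qed

lemma chord_line:
  assumes "chord u w" "p \<in> P" "det2 (w - u) (p - u) = 0"
  shows "p \<in> closed_segment u w"
proof -
  obtain t where t: "p = u + t *\<^sub>R (w - u)"
    using det2_zero_collinear assms by (metis chord_def)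
  have "p = w + (1 - t) *\<^sub>R (u - w)" unfolding t by (simp add: algebra_simps)
  then have "0 \<le> 1 - t" using chord_ray[of w u "1 - t"] assms chord_commute by metis
  moreover have "0 \<le> t" using chord_ray[OF assms(1)] assms(2) t by simp
  ultimately show ?thesis unfolding t by (auto simp: closed_segment_def algebra_simps intro!: exI[of _ t])
qed

lemma chord_endpoint:
  assumes "chord u w" "p \<in> P" "det2 (w - u) (p - u) = 0" "p \<in> lattice_points"
  shows "p = u \<or> p = w"
proof -
  obtain T where T: "T \<in> \<Delta>" "{u, w} \<subseteq> verts T" "u \<noteq> w"
    using assms(1) by (auto simp: chord_def)
  have "closed_segment u w \<subseteq> T"
    by (rule segment_subset_triangle[OF T(1,2)])
  then have p: "p \<in> verts T" using chord_line[OF assms(1-3)] lattice_point_vert[OF T(1)] assms(4) by blast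
  obtain c where c: "verts T = {u, w, c}" using corners_edge[OF T] by metis
  have "p \<noteq> c" using edge_det(1)[OF T(1,3) c] assms(3) by auto
  then show ?thesis using p unfolding c by blast
qed

text \<open>An edge of \<open>X\<close> crossing the line meets it within the chord, hence in a
  triangle \<open>T\<close> at the chord. The face property moves both ends of that edge into
  \<open>T\<close>, which has only one corner off the line.\<close>

lemma chord_side:
  assumes "chord u w" "X \<in> \<Delta>"
  shows "(\<forall>y\<in>verts X. 0 \<le> det2 (w - u) (y - u)) \<or> (\<forall>y\<in>verts X. det2 (w - u) (y - u) \<le> 0)"
proof (rule ccontr)
  let ?g = "\<lambda>y. det2 (w - u) (y - u)"
  assume "\<not> ?thesis"
  then obtain p q where pq: "p \<in> verts X" "q \<in> verts X" "?g p > 0" "?g q < 0"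
    by (metis linorder_not_le)
  define l where "l = ?g p / (?g p - ?g q)"
  have l: "0 < l" "l < 1" using pq by (auto simp: l_def field_simps)
  define y where "y = (1 - l) *\<^sub>R p + l *\<^sub>R q"
  have "p \<noteq> q" using pq by auto
  then have yo: "y \<in> open_segment p q"
    unfolding y_def in_segment using l by blast
  have pqX: "p \<in> X" "q \<in> X" using pq verts_subset by blast+
  then have yX: "y \<in> X"
    using yo triangle_convex[OF assms(2)] closed_segment_subset open_closed_segment by blast
  have "?g y = (1 - l) * ?g p + l * ?g q"
    unfolding y_def by (simp add: det2_def algebra_simps)
  also have "\<dots> = 0"
  proof -
    have "l * (?g p - ?g q) = ?g p" using pq by (simp add: l_def)
    then show ?thesis by (simp add: algebra_simps)
  qed
  finally have "y \<in> closed_segment u w"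
    using chord_line[OF assms(1)] yX triangle_subset_P[OF assms(2)] by blast
  moreover obtain T where T: "T \<in> \<Delta>" "{u, w} \<subseteq> verts T" "u \<noteq> w"
    using assms(1) by (auto simp: chord_def)
  ultimately have "y \<in> X \<inter> T"
    using yX segment_subset_triangle[OF T(1,2)] by blast
  then have "p \<in> T" "q \<in> T"
    using face_ofD[OF \<Delta>_Int_face[OF assms(2) T(1)] yo pqX] by auto
  then have "p \<in> verts T" "q \<in> verts T"
    using lattice_point_vert[OF T(1)] verts_lattice[OF assms(2)] pq by blast+
  moreover obtain c where c: "verts T = {u, w, c}" using corners_edge[OF T] by metis
  ultimately have "p = c" "q = c" using pq(3,4) by auto
  then show False using pq(3,4) by simp
qed

text \<open>The triangles lie on different closed sides, so their common edge lies on the line of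
  the chord, where the only lattice points of \<open>P\<close> are \<open>u\<close> and
  \<open>w\<close>.\<close>

lemma chord_adjacent:
  assumes "chord u w" "X \<in> \<Delta>" "Y \<in> \<Delta>" "p \<noteq> q" "{p, q} \<subseteq> verts X" "{p, q} \<subseteq> verts Y"
    "beyond u w X" "\<not> beyond u w Y"
  shows "{p, q} = {u, w}"
proof -
  have "\<forall>y\<in>verts X. 0 \<le> det2 (w - u) (y - u)"
    using chord_side[OF assms(1,2)] assms(7) by (force simp: beyond_def)
  then have "det2 (w - u) (p - u) = 0" "det2 (w - u) (q - u) = 0"
    using assms(5,6,8) by (force simp: beyond_def)+
  then have "p = u \<or> p = w" "q = u \<or> q = w"
    using chord_endpoint[OF assms(1)] assms(2,5) verts_lattice verts_subset triangle_subset_P by blast+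
  then show ?thesis using assms(4) by blast
qed

lemma chord_two_sides:
  assumes "chord u w"
  obtains T T' c c' where "T \<in> \<Delta>" "T' \<in> \<Delta>" "verts T = {u, w, c}" "verts T' = {u, w, c'}"
    "det2 (w - u) (c - u) = 1" "det2 (w - u) (c' - u) = - 1" "T \<noteq> T'"
proof -
  obtain T T' where T: "T \<in> \<Delta>" "T' \<in> \<Delta>" "T \<noteq> T'" "{u, w} \<subseteq> verts T" "{u, w} \<subseteq> verts T'" "u \<noteq> w"
    using assms by (auto simp: chord_def)
  obtain c where c: "verts T = {u, w, c}" using corners_edge[OF T(1,4,6)] by metis
  obtain c' where c': "verts T' = {u, w, c'}" using corners_edge[OF T(2,5,6)] by metis
  have "det2 (w - u) (c - u) * det2 (w - u) (c' - u) = - 1"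
    using opposite_sides[OF T(1-3,6) c c'] .
  moreover have "det2 (w - u) (c - u) = 1 \<or> det2 (w - u) (c - u) = - 1" using edge_det(1)[OF T(1,6) c] .
  ultimately show ?thesis using that[OF T(1,2) c c'] that[OF T(2,1) c' c] T(3) by auto
qed

lemma beyond_third:
  assumes "verts T = {u, w, c}"
  shows "beyond u w T \<longleftrightarrow> 0 < det2 (w - u) (c - u)"
  by (auto simp: beyond_def assms)

text \<open>For nonpositive \<open>t\<close>, the point \<open>p\<close> would be a weighted mean of
  the interior midpoint, \<open>y\<close> and \<open>c\<close>; the weight \<open>- 2 * x\<close>
  cancels the component along \<open>a - p\<close>.\<close>

lemma no_point_behind_apex:
  assumes "p \<notin> interior P" "midpoint p a \<in> interior P" "c \<in> P" "y \<in> P"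
    "y = p + x *\<^sub>R (a - p) + t *\<^sub>R (c - p)" "x < 0"
  shows "0 < t"
proof (rule ccontr)
  assume "\<not> 0 < t"
  have eq: "(- 2 * x) *\<^sub>R midpoint p a + 1 *\<^sub>R y + (- t) *\<^sub>R c = (- 2 * x + 1 + - t) *\<^sub>R p"
    unfolding assms(5) by (simp add: point_eq_iff midpoint_def algebra_simps)
  have "p \<in> interior P"
    using assms(2-4,6) \<open>\<not> 0 < t\<close> by (intro interior_weighted_combination[OF P_convex _ _ _ _ _ _ eq]) auto
  then show False using assms(1) by simp
qed

text \<open>Replacing a chord by another side of the triangle behind it cuts off a smaller piece of
  \<open>P\<close>, which makes the descent through successive chords terminate.\<close>

lemma beyond_nested:
  assumes "chord u w" "T \<in> \<Delta>" "verts T = {u, w, c}" "det2 (w - u) (c - u) = 1" "y \<in> P"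
    "0 < det2 (c - u) (y - u) \<or> 0 < det2 (w - c) (y - c)"
  shows "0 < det2 (w - u) (y - u)"
proof -
  have c: "c \<in> P" using assms verts_subset triangle_subset_P by blast
  have ui: "u \<notin> interior P" "w \<notin> interior P" using assms(1) by (auto simp: chord_def)
  note m = chord_midpoint[OF assms(1)] chord_midpoint[OF assms(1)[unfolded chord_commute[of u]]]
  from assms(6) show ?thesis
  proof
    assume "0 < det2 (c - u) (y - u)"
    then have "det2 (y - u) (c - u) < 0" by (simp add: det2_def algebra_simps)
    then show ?thesis using no_point_behind_apex[OF ui(1) m(1) c assms(5) det2_coords[OF assms(4)]] by simp
  next
    assume "0 < det2 (w - c) (y - c)"
    then have neg: "det2 (c - w) (y - w) < 0" by (simp add: det2_def algebra_simps)
    have d: "det2 (c - w) (u - w) = 1" using assms(4) by (simp add: det2_def algebra_simps)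
    have "y = w + det2 (c - w) (y - w) *\<^sub>R (u - w) + det2 (y - w) (u - w) *\<^sub>R (c - w)"
      using det2_coords[OF d, of y] by (simp add: algebra_simps)
    then have "0 < det2 (y - w) (u - w)" using no_point_behind_apex[OF ui(2) m(2) c assms(5) _ neg] by simp
    then show ?thesis by (simp add: det2_def algebra_simps)
  qed
qed

section \<open>Sets of dual edges without dead ends\<close>

text \<open>A subgraph of the dual graph in which every node met has degree at least two. In this
  form positive genus can be compared with the geometry.\<close>

definition edge_core :: "point set set \<Rightarrow> bool" where
  "edge_core F \<longleftrightarrow> F \<subseteq> edges (dual_graph \<Delta>) \<and>
     (\<forall>s\<in>F. \<forall>T\<in>\<Delta>. s edge_of T \<longrightarrow> (\<exists>s'\<in>F. s' \<noteq> s \<and> s' edge_of T))"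

lemma dual_edge_obtain:
  assumes "s \<in> edges (dual_graph \<Delta>)"
  obtains u w T T' where "s = closed_segment u w" "u \<noteq> w" "T \<in> \<Delta>" "T' \<in> \<Delta>" "T \<noteq> T'"
    "{u, w} \<subseteq> verts T" "{u, w} \<subseteq> verts T'"
proof -
  obtain T T' where T: "T \<in> \<Delta>" "T' \<in> \<Delta>" "T \<noteq> T'" "s edge_of T" "s edge_of T'"
    using assms by (auto simp: dual_graph_def)
  obtain u w where "u \<noteq> w" "s = closed_segment u w" using edge_of_iff[OF T(1)] T(4) by blast
  then show ?thesis using that[of u w T T'] T segment_edge_iff by metis
qed

lemma dual_edgeI:
  assumes "T \<in> \<Delta>" "T' \<in> \<Delta>" "T \<noteq> T'" "u \<noteq> w" "{u, w} \<subseteq> verts T" "{u, w} \<subseteq> verts T'"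
  shows "closed_segment u w \<in> edges (dual_graph \<Delta>)"
  using assms(1-3,5,6) segment_edge_iff[OF assms(1,4)] segment_edge_iff[OF assms(2,4)]
  unfolding dual_graph_def mgraph.simps mem_Collect_eq by blast

lemma dual_edge_chord:
  assumes "closed_segment u w \<in> edges (dual_graph \<Delta>)" "u \<notin> interior P" "w \<notin> interior P" "u \<noteq> w"
  shows "chord u w"
  using assms segment_edge_iff by (fastforce simp: chord_def dual_graph_def)

text \<open>
  Crossing a chord leads to a triangle with another edge of the core; unless its third vertex is
  interior, that edge is again a chord and has fewer triangles beyond it.
\<close>

lemma core_interior_beyond:
  assumes "edge_core F" "chord u w" "closed_segment u w \<in> F"
  shows "\<exists>p q. closed_segment p q \<in> F \<and> p \<noteq> q \<and> p \<in> interior P \<and> p \<in> lattice_points \<and>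
    0 < det2 (w - u) (p - u)"
  using assms(2,3)
proof (induction "card {X \<in> \<Delta>. beyond u w X}" arbitrary: u w rule: less_induct)
  case less
  obtain T c where T: "T \<in> \<Delta>" "verts T = {u, w, c}" "det2 (w - u) (c - u) = 1"
    using chord_two_sides[OF less.prems(1)] by metis
  have uw: "u \<noteq> w" "u \<notin> interior P" "w \<notin> interior P" using less.prems(1) by (auto simp: chord_def)
  have "closed_segment u w edge_of T" using segment_edge_iff[OF T(1) uw(1)] T(2) by simp
  then obtain s' where s': "s' \<in> F" "s' \<noteq> closed_segment u w" "s' edge_of T"
    using assms(1) less.prems(2) T(1) unfolding edge_core_def by blast
  obtain p q where pq: "p \<noteq> q" "{p, q} \<subseteq> {u, w, c}" "s' = closed_segment p q"
    using edge_of_iff[OF T(1)] s'(3) T(2) by metis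
  have cases: "s' = closed_segment u c \<and> u \<noteq> c \<or> s' = closed_segment c w \<and> c \<noteq> w"
    using pq s'(2) by (auto simp: closed_segment_commute)
  have clat: "c \<in> lattice_points" using verts_lattice[OF T(1)] T(2) by blast
  show ?case
  proof (cases "c \<in> interior P")
    case True
    then show ?thesis using cases s'(1) T(3) clat by (metis closed_segment_commute zero_less_one)
  next
    case False
    have "\<exists>u' w'. s' = closed_segment u' w' \<and> chord u' w' \<and> \<not> beyond u' w' T \<and>
      (\<forall>y\<in>P. 0 < det2 (w' - u') (y - u') \<longrightarrow> 0 < det2 (w - u) (y - u))"
    proof -
      have F: "s' \<in> edges (dual_graph \<Delta>)" using s'(1) assms(1) by (auto simp: edge_core_def)
      from cases show ?thesis
      proof
        assume c: "s' = closed_segment u c \<and> u \<noteq> c"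
        have "verts T = {u, c, w}" using T(2) by auto
        then have "\<not> beyond u c T" using beyond_third[of T u c w] T(3) det2_swap[of c u w] by simp
        then show ?thesis
          using c F uw False dual_edge_chord beyond_nested[OF less.prems(1) T] by blast
      next
        assume c: "s' = closed_segment c w \<and> c \<noteq> w"
        have "verts T = {c, w, u}" using T(2) by auto
        moreover have "det2 (w - c) (u - c) = -1" using T(3) by (simp add: det2_def algebra_simps)
        ultimately have "\<not> beyond c w T" using beyond_third[of T c w u] by simp
        then show ?thesis
          using c F uw False dual_edge_chord beyond_nested[OF less.prems(1) T] by blast
      qed
    qed
    then obtain u' w' where u': "s' = closed_segment u' w'" "chord u' w'" "\<not> beyond u' w' T"
      "\<And>y. y \<in> P \<Longrightarrow> 0 < det2 (w' - u') (y - u') \<Longrightarrow> 0 < det2 (w - u) (y - u)" by blast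
    have "beyond u w X" if "beyond u' w' X" "X \<in> \<Delta>" for X
      using that u'(4) verts_subset triangle_subset_P unfolding beyond_def by blast
    moreover have "beyond u w T" using beyond_third[OF T(2)] T(3) by simp
    \<comment> \<open>\<open>T\<close> is beyond the old chord but not beyond the new one, so the
      count drops strictly.\<close>
    ultimately have "{X \<in> \<Delta>. beyond u' w' X} \<subset> {X \<in> \<Delta>. beyond u w X}"
      using u'(3) T(1) by blast
    then have "card {X \<in> \<Delta>. beyond u' w' X} < card {X \<in> \<Delta>. beyond u w X}"
      using \<Delta>_finite by (intro psubset_card_mono) auto
    then obtain p q where "closed_segment p q \<in> F" "p \<noteq> q" "p \<in> interior P" "p \<in> lattice_points"
      "0 < det2 (w' - u') (p - u')" using less.hyps u'(1,2) s'(1) by blast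
    then show ?thesis using u'(4) interior_subset by blast
  qed
qed

lemma core_interior_endpoint:
  assumes "edge_core F" "F \<noteq> {}"
  shows "\<exists>p q. closed_segment p q \<in> F \<and> p \<noteq> q \<and> p \<in> interior P \<and> p \<in> lattice_points"
proof -
  obtain s where s: "s \<in> F" "s \<in> edges (dual_graph \<Delta>)" using assms by (auto simp: edge_core_def)
  obtain u w T where uw: "s = closed_segment u w" "u \<noteq> w" "T \<in> \<Delta>" "{u, w} \<subseteq> verts T"
    using dual_edge_obtain[OF s(2)] by metis
  then have lat: "u \<in> lattice_points" "w \<in> lattice_points" using verts_lattice by blast+
  show ?thesis
  proof (cases "u \<in> interior P \<or> w \<in> interior P")
    case True
    then show ?thesis using s(1) uw lat by (metis closed_segment_commute)
  next
    case False
    then have "chord u w" using dual_edge_chord s uw by blast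
    then show ?thesis using core_interior_beyond[OF assms(1)] s(1) uw(1) by blast
  qed
qed

text \<open>
  A core all of whose edges contain \<open>z\<close> consists of all triangles around \<open>z\<close>.
\<close>

lemma core_second_interior_endpoint:
  assumes F: "edge_core F" "F \<noteq> {}" and z: "z \<in> interior P" "z \<in> lattice_points"
    and T: "T \<in> \<Delta>" "z \<in> verts T" "\<And>s. s \<in> F \<Longrightarrow> \<not> s edge_of T"
  shows "\<exists>p q. closed_segment p q \<in> F \<and> p \<noteq> q \<and> p \<in> interior P \<and> p \<in> lattice_points \<and> p \<noteq> z"
proof (rule ccontr)
  assume none: "\<not> ?thesis"
  have zP: "z \<in> P" using z interior_subset by blast
  \<comment> \<open>Orient the chord so that \<open>z\<close> is not beyond it; the interior end
    point that the core has beyond it is then different from \<open>z\<close>.\<close>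
  have no_chord: "\<not> chord u w" if "closed_segment u w \<in> F" for u w
  proof
    assume c: "chord u w"
    have cu: "closed_segment w u \<in> F" using that by (simp add: closed_segment_commute)
    have "det2 (w - u) (z - u) \<noteq> 0"
      using chord_endpoint[OF c zP _ z(2)] c z(1) by (auto simp: chord_def)
    then have "det2 (w - u) (z - u) < 0 \<or> det2 (u - w) (z - w) < 0"
      by (simp add: det2_swap_base[of u w] linorder_neq_iff)
    then show False
      using core_interior_beyond[OF F(1) c that] core_interior_beyond[OF F(1) c[unfolded chord_commute[of u]] cu]
        none by (metis order.asym)
  qed
  have spoke: "\<exists>u. s = closed_segment z u \<and> u \<noteq> z" if s: "s \<in> F" for s
  proof -
    have sd: "s \<in> edges (dual_graph \<Delta>)" using s F by (auto simp: edge_core_def)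
    obtain u w T where uw: "s = closed_segment u w" "u \<noteq> w" "T \<in> \<Delta>" "{u, w} \<subseteq> verts T"
      using dual_edge_obtain[OF sd] by metis
    then have lat: "u \<in> lattice_points" "w \<in> lattice_points" using verts_lattice by blast+
    have "u \<in> interior P \<or> w \<in> interior P"
      using no_chord dual_edge_chord uw s sd by blast
    then have "u = z \<or> w = z"
      using none s uw(1,2) lat by (metis closed_segment_commute)
    then show ?thesis using uw by (metis closed_segment_commute)
  qed
  \<comment> \<open>A triangle has exactly two spokes at \<open>z\<close>. If one is in the core, so
    is the other, and crossing either leads to a triangle that the core meets as well.\<close>
  have two: "\<exists>s\<in>F. s edge_of Y" if X: "s \<in> F" "s edge_of X" "X \<in> \<Delta>" and XY: "(X, Y) \<in> star_adjacent z u0" for s X Y u0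
  proof -
    obtain u where u: "Y \<in> \<Delta>" "u \<noteq> z" "{z, u} \<subseteq> verts X" "{z, u} \<subseteq> verts Y"
      using XY by (auto simp: star_adjacent_def)
    obtain s' where s': "s' \<in> F" "s' \<noteq> s" "s' edge_of X" using F(1) X unfolding edge_core_def by blast
    obtain a b where ab: "s = closed_segment z a" "a \<noteq> z" "s' = closed_segment z b" "b \<noteq> z"
      using spoke X(1) s'(1) by metis
    have "a \<in> verts X" "b \<in> verts X" "a \<noteq> b" "z \<in> verts X"
      using X s' ab segment_edge_iff by auto
    moreover obtain c d where "verts X = {z, c, d}" using corners_at[OF X(3)] \<open>z \<in> verts X\<close> by metis
    ultimately have "u = a \<or> u = b" using u(2,3) ab by auto
    then have "closed_segment z u \<in> F" using ab X(1) s'(1) by blast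
    then show ?thesis using segment_edge_iff[OF u(1), of z u] u(2,4) by blast
  qed
  obtain s where s: "s \<in> F" using F(2) by blast
  then obtain X where X: "X \<in> \<Delta>" "s edge_of X" using F(1)
    unfolding edge_core_def dual_graph_def mgraph.simps by blast
  obtain u where u: "s = closed_segment z u" "u \<noteq> z" using spoke[OF s] by blast
  then have "z \<in> verts X" using segment_edge_iff X by (metis insert_subset)
  \<comment> \<open>Any slit will do, since the core spreads around \<open>z\<close> for every
    choice of \<open>u0\<close>.\<close>
  obtain u0 where u0: "u0 \<noteq> z" using u(2) by blast
  have "(X, T) \<in> (star_adjacent z u0)\<^sup>*"
    using star_connected[OF z(1) u0 X(1) \<open>z \<in> verts X\<close> T(1,2)] .
  then have "T \<in> \<Delta> \<and> (\<exists>s\<in>F. s edge_of T)"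
  proof (induction rule: rtrancl_induct)
    case base then show ?case using s X by blast
  next
    case (step Y Z)
    have "Z \<in> \<Delta>" using step.hyps(2) unfolding star_adjacent_def by blast
    then show ?case using step two by blast
  qed
  then show False using T(3) by blast
qed

end

section \<open>Local lattice geometry at an interior vertex\<close>

context unimodular_polygon
begin

lemma triangle_integer_coords:
  assumes "T \<in> \<Delta>" "verts T = {z, a, b}" "det2 (a - z) (b - z) = 1" "p \<in> lattice_points"
  obtains i j :: int where "p = z + of_int i *\<^sub>R (a - z) + of_int j *\<^sub>R (b - z)"
    "det2 (p - z) (b - z) = of_int i" "det2 (a - z) (p - z) = of_int j"
proof -
  have "{z, a, b} \<subseteq> lattice_points" using verts_lattice[OF assms(1)] assms(2) by simp
  then have "det2 (p - z) (b - z) \<in> \<int>" "det2 (a - z) (p - z) \<in> \<int>"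
    using assms(4) by (auto intro: det2_lattice)
  then show ?thesis using that det2_coords[OF assms(3), of p] by (metis Ints_cases)
qed

text \<open>If \<open>x\<close> were nonpositive, \<open>b\<close> would be a weighted mean of
  \<open>p\<close>, \<open>z\<close> and \<open>a\<close> with weights 1, \<open>y + x - 1\<close>
  and \<open>- x\<close>.\<close>

lemma positive_coord:
  assumes z: "z \<in> interior P" and b: "b \<notin> interior P"
    and p: "p \<in> interior P" "p = z + x *\<^sub>R (a - z) + y *\<^sub>R (b - z)" and "x + y > 1" "a \<in> P"
  shows "0 < x"
proof (rule ccontr)
  assume "\<not> 0 < x"
  then have xy: "x \<le> 0" "y > 1" using assms by auto
  have eq: "1 *\<^sub>R p + (y + x - 1) *\<^sub>R z + (- x) *\<^sub>R a = (1 + (y + x - 1) + (- x)) *\<^sub>R b"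
    unfolding p(2) by (simp add: algebra_simps)
  have "b \<in> interior P"
    using xy assms interior_subset by (intro interior_weighted_combination[OF P_convex p(1) _ _ _ _ _ eq]) auto
  then show False using b by blast
qed

text \<open>Both coordinates of \<open>p\<close> are positive integers, and the point (1, 1) is the
  weighted mean of \<open>p\<close>, \<open>a\<close> and \<open>b\<close> with weights 1,
  \<open>y - 1\<close> and \<open>x - 1\<close>.\<close>

lemma parallelogram_point_interior:
  fixes i j :: int
  assumes z: "z \<in> interior P" and ab: "a \<notin> interior P" "b \<notin> interior P" "a \<in> P" "b \<in> P"
    and p: "p \<in> interior P" "p = z + of_int i *\<^sub>R (a - z) + of_int j *\<^sub>R (b - z)" and ij: "i + j > 1"
  shows "a + b - z \<in> interior P"
proof -
  define x y where "x = real_of_int i" and "y = real_of_int j"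
  have p': "p = z + x *\<^sub>R (a - z) + y *\<^sub>R (b - z)" "p = z + y *\<^sub>R (b - z) + x *\<^sub>R (a - z)"
    using p(2) by (simp_all add: x_def y_def)
  have xy: "x + y > 1" using ij unfolding x_def y_def by linarith
  have "0 < x" using positive_coord[OF z ab(2) p(1) p'(1) xy ab(3)] .
  moreover have "0 < y" using positive_coord[OF z ab(1) p(1) p'(2) _ ab(4)] xy by simp
  ultimately have xy1: "x \<ge> 1" "y \<ge> 1" unfolding x_def y_def by simp_all
  have eq: "1 *\<^sub>R p + (y - 1) *\<^sub>R a + (x - 1) *\<^sub>R b = (1 + (y - 1) + (x - 1)) *\<^sub>R (a + b - z)"
    unfolding p'(1) by (simp add: algebra_simps)
  show ?thesis
    using xy1 ab by (intro interior_weighted_combination[OF P_convex p(1) _ _ _ _ _ eq]) auto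
qed

text \<open>A point with \<open>j\<close> at least 1, hence \<open>i\<close> at most 0, would make
  \<open>b\<close> a weighted mean of that point, (1, 1) and \<open>z\<close>.\<close>

lemma nonpositive_coord:
  fixes i j :: int
  assumes z: "z \<in> interior P" and ab: "b \<notin> interior P"
    and q: "a + b - z \<in> interior P"
    and p: "p \<in> interior P" "p = z + of_int i *\<^sub>R (a - z) + of_int j *\<^sub>R (b - z)" and ij: "i + j \<le> 1"
  shows "j \<le> 0"
proof (rule ccontr)
  assume "\<not> j \<le> 0"
  define x y where "x = real_of_int i" and "y = real_of_int j"
  have xy: "x \<le> 0" "y \<ge> 1" using ij \<open>\<not> j \<le> 0\<close> unfolding x_def y_def by linarith+
  have p': "p = z + x *\<^sub>R (a - z) + y *\<^sub>R (b - z)" using p(2) by (simp add: x_def y_def)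
  have eq: "1 *\<^sub>R p + (- x) *\<^sub>R (a + b - z) + (y - 1) *\<^sub>R z = (1 + (- x) + (y - 1)) *\<^sub>R b"
    unfolding p' by (simp add: algebra_simps)
  have "b \<in> interior P"
    using xy z q interior_subset
    by (intro interior_weighted_combination[OF P_convex p(1) _ _ _ _ _ eq]) auto
  then show False using ab by blast
qed

text \<open>The level \<open>i + j = 2\<close> carries the apex of the triangle across
  \<open>[a, b]\<close>. If \<open>i = 1 + k\<close> with \<open>k\<close> at least 1, then
  \<open>a\<close> is a weighted mean of \<open>z\<close>, (1, 1) and \<open>p\<close>.\<close>

lemma height_two_coord:
  fixes i j :: int
  assumes z: "z \<in> interior P" and a: "a \<notin> interior P" and q: "a + b - z \<in> interior P"
    and p: "p \<in> P" "p = z + of_int i *\<^sub>R (a - z) + of_int j *\<^sub>R (b - z)" and ij: "i + j = 2"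
  shows "i \<le> 1"
proof (rule ccontr)
  assume "\<not> i \<le> 1"
  define k where "k = real_of_int i - 1"
  have k: "k \<ge> 1" using \<open>\<not> i \<le> 1\<close> unfolding k_def by linarith
  have j: "real_of_int j = 1 - k" using ij unfolding k_def by linarith
  have i: "real_of_int i = 1 + k" by (simp add: k_def)
  have eq: "k *\<^sub>R z + (k - 1) *\<^sub>R (a + b - z) + 1 *\<^sub>R p = (k + (k - 1) + 1) *\<^sub>R a"
    unfolding p(2) i j by (simp add: point_eq_iff algebra_simps)
  have "a \<in> interior P"
    using k q p interior_subset
    by (intro interior_weighted_combination[OF P_convex z _ _ _ _ _ eq]) auto
  then show False using a by blast
qed

text \<open>Unimodularity puts the new corner on level 2, where each coordinate is at most 1 by
  \<open>height_two_coord\<close> and its mirror image.\<close>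

lemma opposite_triangle_apex:
  assumes T: "T \<in> \<Delta>" "verts T = {z, a, b}" "det2 (a - z) (b - z) = 1"
    and T': "T' \<in> \<Delta>" "T' \<noteq> T" "{a, b} \<subseteq> verts T'"
    and int: "z \<in> interior P" "a \<notin> interior P" "b \<notin> interior P" "a + b - z \<in> interior P"
  shows "verts T' = {a, b, a + b - z}"
proof -
  have ne: "a \<noteq> b" using T(3) by (auto simp: det2_def)
  obtain q where q: "verts T' = {a, b, q}" using corners_edge[OF T'(1,3) ne] by metis
  have "verts T = {a, b, z}" using T(2) by auto
  then have "det2 (b - a) (z - a) * det2 (b - a) (q - a) = - 1"
    using opposite_sides[OF T(1) T'(1) T'(2)[symmetric] ne _ q] by blast
  then have D: "det2 (b - a) (q - a) = - 1" using T(3) det2_cyclic[of b a z] by simp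
  have qP: "q \<in> P" "q \<in> lattice_points"
    using q verts_subset triangle_subset_P[OF T'(1)] verts_lattice[OF T'(1)] by blast+
  obtain i j :: int where ij: "q = z + of_int i *\<^sub>R (a - z) + of_int j *\<^sub>R (b - z)"
    using triangle_integer_coords[OF T qP(2)] by metis
  have "det2 (b - a) (q - a) = (1 - of_int i - of_int j) * det2 (b - a) (z - a)"
    unfolding det2_triangle_combination[OF ij] by (simp add: det2_def algebra_simps)
  then have "real_of_int (i + j) = 2" using D T(3) det2_cyclic[of b a z] by simp
  then have "i + j = 2" by linarith
  then have "i \<le> 1" "j \<le> 1"
    using height_two_coord[OF int(1,2,4) qP(1) ij] height_two_coord[OF int(1,3) _ qP(1), of a j i] int(4) ij
    by (auto simp: algebra_simps)
  then have "i = 1" "j = 1" using \<open>i + j = 2\<close> by auto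
  then have "q = a + b - z" using ij by simp
  then show ?thesis using q by simp
qed

text \<open>The ray from \<open>z\<close> away from \<open>p\<close> lies in both cones. A short
  step along it stays in both triangles, so they share a corner besides \<open>z\<close>; sharing
  three would make them equal.\<close>

lemma common_vertex:
  assumes T: "T \<in> \<Delta>" "verts T = {z, a, b}" and T': "T' \<in> \<Delta>" "verts T' = {z, c, d}" and "T \<noteq> T'"
    and p: "p \<noteq> z" "p = z + i *\<^sub>R (a - z) + j *\<^sub>R (b - z)" "i \<le> 0" "j \<le> 0"
      "p = z + k *\<^sub>R (c - z) + l *\<^sub>R (d - z)" "k \<le> 0" "l \<le> 0"
  obtains w where "w \<noteq> z" "verts T \<inter> verts T' = {z, w}"
proof -
  \<comment> \<open>The denominator dominates the coordinate sums in both triangles at once.\<close>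
  define e where "e = 1 / (1 - i - j - k - l)"
  have e: "e > 0" "e * (- i) + e * (- j) \<le> 1" "e * (- k) + e * (- l) \<le> 1"
  proof -
    have N: "1 - i - j - k - l > 0" using p by linarith
    then show "e > 0" by (simp add: e_def)
    then have "e * i \<le> 0" "e * j \<le> 0" "e * k \<le> 0" "e * l \<le> 0" using p by (simp_all add: mult_nonneg_nonpos)
    moreover have "e * (1 - i - j - k - l) = 1" using N by (simp add: e_def)
    then have "e - e * i - e * j - e * k - e * l = 1" by (simp add: algebra_simps)
    ultimately show "e * (- i) + e * (- j) \<le> 1" "e * (- k) + e * (- l) \<le> 1"
      using \<open>e > 0\<close> by auto
  qed
  define r where "r = z - e *\<^sub>R (p - z)"
  have "r = z + (e * (- i)) *\<^sub>R (a - z) + (e * (- j)) *\<^sub>R (b - z)"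
    unfolding r_def p(2) by (simp add: algebra_simps)
  moreover have "0 \<le> e * (- i)" "0 \<le> e * (- j)" "0 \<le> e * (- k)" "0 \<le> e * (- l)"
    using e p by (auto simp: mult_nonneg_nonpos)
  ultimately have "r \<in> convex hull {z, a, b}"
    unfolding convex_hull_3_alt using e by blast
  moreover have "r = z + (e * (- k)) *\<^sub>R (c - z) + (e * (- l)) *\<^sub>R (d - z)"
    unfolding r_def p(5) by (simp add: algebra_simps)
  then have "r \<in> convex hull {z, c, d}"
    unfolding convex_hull_3_alt using e \<open>0 \<le> e * (- k)\<close> \<open>0 \<le> e * (- l)\<close> by blast
  ultimately have "r \<in> T \<inter> T'" using triangle_hull[OF T(1)] triangle_hull[OF T'(1)]
    unfolding T(2) T'(2) by simp
  then have r: "r \<in> convex hull (verts T \<inter> verts T')" using triangle_Int[OF T(1) T'(1)] by simp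
  have "r \<noteq> z" using e p(1) by (simp add: r_def)
  have z: "z \<in> verts T \<inter> verts T'" using T T' by simp
  have "verts T \<inter> verts T' \<noteq> {z}"
  proof
    assume eq: "verts T \<inter> verts T' = {z}"
    show False using r \<open>r \<noteq> z\<close> unfolding eq by simp
  qed
  then obtain w where w: "w \<in> verts T \<inter> verts T'" "w \<noteq> z" using z by blast
  have "verts T \<inter> verts T' \<subseteq> {z, w}"
  proof
    fix y assume y: "y \<in> verts T \<inter> verts T'"
    show "y \<in> {z, w}"
    proof (rule ccontr)
      assume "y \<notin> {z, w}"
      then have "{z, a, b} = {z, w, y}" "{z, c, d} = {z, w, y}"
        using y w unfolding T(2) T'(2) by blast+
      then have "verts T = verts T'" unfolding T(2) T'(2) by simp
      then show False using verts_inj T(1) T'(1) assms(5) by blast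
    qed
  qed
  then show ?thesis using that w z by blast
qed

text \<open>By \<open>chord_endpoint\<close>, \<open>d\<close> could lie on the line only by being
  \<open>a\<close>, and the two triangles would coincide.\<close>

lemma adjacent_chord_lines_differ:
  assumes "chord a w" "T' \<in> \<Delta>" "T \<in> \<Delta>" "verts T = {z, a, w}" "verts T' = {z, w, d}" "T \<noteq> T'" "d \<noteq> w"
  shows "det2 (w - a) (d - a) \<noteq> 0"
proof
  assume "det2 (w - a) (d - a) = 0"
  then have "d = a \<or> d = w"
    using chord_endpoint[OF assms(1)] assms(2,5) verts_lattice verts_subset triangle_subset_P by blast
  then have "verts T' = verts T" using assms by auto
  then show False using verts_inj assms by blast
qed

section \<open>The barycentric dual cell of an interior vertex\<close>

lemma dual_ends: "ends (dual_graph \<Delta>) s = {T \<in> \<Delta>. s edge_of T}"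
  by (simp add: dual_graph_def)

lemma barycenter_segment: "u \<noteq> w \<Longrightarrow> barycenter (closed_segment u w) = midpoint u w"
proof -
  assume "u \<noteq> w"
  moreover have "{x. x extreme_point_of closed_segment u w} = {u, w}"
    by (auto simp: extreme_point_of_segment)
  ultimately show ?thesis by (simp add: barycenter_def midpoint_def)
qed

lemma barycenter_triangle:
  assumes "T \<in> \<Delta>" "verts T = {z, a, b}" "det2 (a - z) (b - z) = 1"
  shows "barycenter T = z + (1/3) *\<^sub>R (a - z) + (1/3) *\<^sub>R (b - z)"
proof -
  have "z \<noteq> a" "z \<noteq> b" "a \<noteq> b" using assms(3) by (auto simp: det2_def)
  then have "barycenter T = (1/3) *\<^sub>R (z + (a + b))"
    unfolding barycenter_def assms(2)[unfolded verts_def] by simp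
  then show ?thesis by (simp add: point_eq_iff field_simps)
qed

text \<open>With barycentric coordinates x at \<open>a\<close> and y at \<open>b\<close>, the
  inequality \<open>2 * x + y <= 1\<close> says that x is at most the coordinate
  \<open>1 - x - y\<close> at \<open>z\<close>. The cell is the quadrilateral spanned by
  \<open>z\<close>, the midpoints of the two spokes and the barycentre.\<close>

definition corner_cell :: "point \<Rightarrow> point \<Rightarrow> point \<Rightarrow> point set" where
  "corner_cell z a b = {p. 0 \<le> det2 (p - z) (b - z) \<and> 0 \<le> det2 (a - z) (p - z) \<and>
     2 * det2 (p - z) (b - z) + det2 (a - z) (p - z) \<le> 1 \<and>
     det2 (p - z) (b - z) + 2 * det2 (a - z) (p - z) \<le> 1}"

text \<open>The orientation condition lists each triangle at \<open>z\<close> exactly once.\<close>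

definition star_corners :: "point \<Rightarrow> (point \<times> point) set" where
  "star_corners z = {(a, b). det2 (a - z) (b - z) = 1 \<and> (\<exists>T\<in>\<Delta>. verts T = {z, a, b})}"

definition dual_cell :: "point \<Rightarrow> point set" where
  "dual_cell z = (\<Union>(a, b)\<in>star_corners z. corner_cell z a b)"

lemma star_corners_finite: "finite (star_corners z)"
proof -
  have "finite (verts T)" if "T \<in> \<Delta>" for T
    using triangle_corners[OF that] by (metis finite.emptyI finite_insert)
  then have "finite (\<Union>(verts ` \<Delta>))" using \<Delta>_finite by blast
  moreover have "star_corners z \<subseteq> \<Union>(verts ` \<Delta>) \<times> \<Union>(verts ` \<Delta>)"
    by (auto simp: star_corners_def)
  ultimately show ?thesis using finite_subset by blast
qed

lemma corner_cell_closed: "closed (corner_cell z a b)"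
  unfolding corner_cell_def det2_def
  by (intro closed_Collect_conj closed_Collect_le continuous_intros)

lemma dual_cell_closed: "closed (dual_cell z)"
  unfolding dual_cell_def using star_corners_finite corner_cell_closed by (intro closed_UN) auto

lemma corner_cell_subset:
  assumes "(a, b) \<in> star_corners z"
  obtains T where "T \<in> \<Delta>" "verts T = {z, a, b}" "det2 (a - z) (b - z) = 1" "corner_cell z a b \<subseteq> T"
proof -
  obtain T where T: "T \<in> \<Delta>" "verts T = {z, a, b}" "det2 (a - z) (b - z) = 1"
    using assms by (auto simp: star_corners_def)
  have "corner_cell z a b \<subseteq> convex hull {z, a, b}"
    by (auto simp: corner_cell_def mem_triangle_iff[OF T(3)])
  then have "corner_cell z a b \<subseteq> T" using triangle_hull[OF T(1)] unfolding T(2) by simp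
  then show ?thesis by (rule that[OF T])
qed

text \<open>Only the comparisons with the coordinate at \<open>z\<close> are kept, so that the set
  is open in the plane; its part inside the triangle lies in the corner cell.\<close>

definition strict_corner :: "point \<Rightarrow> point \<Rightarrow> point \<Rightarrow> point set" where
  "strict_corner z a b = {p. 2 * det2 (p - z) (b - z) + det2 (a - z) (p - z) < 1 \<and>
     det2 (p - z) (b - z) + 2 * det2 (a - z) (p - z) < 1}"

lemma strict_corner_open: "open (strict_corner z a b)"
  unfolding strict_corner_def det2_def
  by (intro open_Collect_conj open_Collect_less continuous_intros)

text \<open>Two different triangles at \<open>z\<close> meet in \<open>z\<close> or in a spoke, and
  along a spoke both read the condition as \<open>2 * t < 1\<close>.\<close>

lemma strict_corner_transfer:
  assumes ab: "(a, b) \<in> star_corners z" and x: "x \<in> corner_cell z a b" "x \<in> strict_corner z a b"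
    and ab': "(a', b') \<in> star_corners z" "x \<in> convex hull {z, a', b'}"
  shows "x \<in> strict_corner z a' b'"
proof -
  obtain T where T: "T \<in> \<Delta>" "verts T = {z, a, b}" "det2 (a - z) (b - z) = 1" "corner_cell z a b \<subseteq> T"
    using corner_cell_subset[OF ab] by metis
  obtain T' where T': "T' \<in> \<Delta>" "verts T' = {z, a', b'}" "det2 (a' - z) (b' - z) = 1"
    using ab' by (auto simp: star_corners_def)
  have spoke: "x \<in> strict_corner z a' b'" if "0 \<le> t" "x = z + t *\<^sub>R (w - z)" "w \<in> {z, a, b}" "w \<in> {z, a', b'}" for t w
  proof (cases "x = z")
    case True
    then show ?thesis by (simp add: strict_corner_def)
  next
    case False
    then have w: "w = a \<or> w = b" "w = a' \<or> w = b'" using that by auto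
    have "2 * t < 1"
      using w(1) x(2) T(3) unfolding that(2) strict_corner_def by (auto simp: det2_scaleR)
    then show ?thesis
      using w(2) T'(3) that(1) unfolding that(2) strict_corner_def by (auto simp: det2_scaleR)
  qed
  show ?thesis
  proof (cases "T = T'")
    case True
    then have "{z, a, b} = {z, a', b'}" using T T' by simp
    moreover have "a \<noteq> z" "b \<noteq> z" "a' \<noteq> z" "b' \<noteq> z" using T T' by auto
    ultimately have "{a, b} = {a', b'}"
      using insert_ident[of z "{a, b}" "{a', b'}"] by simp
    then have "a = a' \<and> b = b' \<or> a = b' \<and> b = a'" by (simp add: doubleton_eq_iff)
    moreover have "\<not> (a = b' \<and> b = a')"
      using T(3) T'(3) det2_swap[of b z a] by auto
    ultimately show ?thesis using x(2) by simp
  next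
    case False
    have "x \<in> T'" using ab'(2) triangle_hull[OF T'(1)] unfolding T'(2) by simp
    then have xh: "x \<in> convex hull (verts T \<inter> verts T')" using x T triangle_Int[OF T(1) T'(1)] by blast
    have "\<exists>w\<in>verts T. verts T \<inter> verts T' \<subseteq> {z, w} \<and> (w \<in> verts T' \<or> verts T \<inter> verts T' \<subseteq> {z})"
    proof -
      have "\<not> {a, b} \<subseteq> {a', b'}"
      proof
        assume "{a, b} \<subseteq> {a', b'}"
        moreover have "a \<noteq> b" using T(3) by auto
        ultimately have "{a, b} = {a', b'}" by auto
        then have "verts T = verts T'" using T(2) T'(2) by simp
        then show False using False verts_inj T T' by blast
      qed
      moreover have "a \<noteq> z" "b \<noteq> z" using T by auto
      ultimately have "a \<notin> verts T' \<or> b \<notin> verts T'" using T' by auto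
      then show ?thesis unfolding T(2) by blast
    qed
    then obtain w where w: "w \<in> verts T" "verts T \<inter> verts T' \<subseteq> {z, w}" "w \<in> verts T' \<or> verts T \<inter> verts T' \<subseteq> {z}"
      by blast
    have "\<exists>w'\<in>verts T \<inter> verts T'. verts T \<inter> verts T' \<subseteq> {z, w'}"
      using w T(2) T'(2) by (cases "w \<in> verts T'") auto
    then obtain w' where w': "w' \<in> verts T \<inter> verts T'" "verts T \<inter> verts T' \<subseteq> {z, w'}" by blast
    have "x \<in> closed_segment z w'"
      using xh hull_mono[OF w'(2), of convex] by (auto simp: segment_convex_hull)
    then obtain t where t: "0 \<le> t" "x = (1 - t) *\<^sub>R z + t *\<^sub>R w'"
      by (auto simp: closed_segment_def)
    have "x = z + t *\<^sub>R (w' - z)" unfolding t(2) by (simp add: algebra_simps)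
    moreover have "w' \<in> {z, a, b}" "w' \<in> {z, a', b'}" using w'(1) unfolding T(2) T'(2) by blast+
    ultimately show ?thesis by (rule spoke[OF t(1)])
  qed
qed

text \<open>Near \<open>x\<close> only triangles containing \<open>x\<close> occur. All have the
  corner \<open>z\<close>, for otherwise \<open>x\<close> would lie on \<open>[a, b]\<close>, where
  the coordinate at \<open>z\<close> is 0; strictness persists in each of them near
  \<open>x\<close>.\<close>

lemma strict_corner_interior:
  assumes z: "z \<in> interior P" and ab: "(a, b) \<in> star_corners z"
    and x: "x \<in> corner_cell z a b" "x \<in> strict_corner z a b"
  shows "x \<in> interior (dual_cell z)"
proof -
  obtain T where T: "T \<in> \<Delta>" "verts T = {z, a, b}" "det2 (a - z) (b - z) = 1" "corner_cell z a b \<subseteq> T"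
    using corner_cell_subset[OF ab] by metis
  define s t where "s = det2 (x - z) (b - z)" and "t = det2 (a - z) (x - z)"
  have st: "0 \<le> s" "0 \<le> t" "2 * s + t < 1" "s + 2 * t < 1"
    using x unfolding corner_cell_def strict_corner_def s_def t_def by auto
  have abP: "a \<in> P" "b \<in> P" using T verts_subset triangle_subset_P by blast+
  have xe: "x = z + s *\<^sub>R (a - z) + t *\<^sub>R (b - z)" unfolding s_def t_def by (rule det2_coords[OF T(3)])
  have "(1 - s - t) *\<^sub>R z + s *\<^sub>R a + t *\<^sub>R b \<in> interior P"
    using st abP z by (intro interior_combination3[OF P_convex]) auto
  then have xi: "x \<in> interior P" unfolding xe by (simp add: algebra_simps)
  have z_in: "z \<in> verts X" if X: "X \<in> \<Delta>" "x \<in> X" for X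
  proof (rule ccontr)
    assume "z \<notin> verts X"
    then have sub: "verts T \<inter> verts X \<subseteq> {a, b}" using T(2) by auto
    have "x \<in> convex hull (verts T \<inter> verts X)" using triangle_Int[OF T(1) X(1)] X(2) x(1) T(4) by blast
    then have "x \<in> closed_segment a b" using hull_mono[OF sub, of convex] by (auto simp: segment_convex_hull)
    then obtain l where l: "x = (1 - l) *\<^sub>R a + l *\<^sub>R b" by (auto simp: closed_segment_def)
    have "x = z + (1 - l) *\<^sub>R (a - z) + l *\<^sub>R (b - z)" unfolding l by (simp add: algebra_simps)
    then have "s = 1 - l" "t = l" using det2_coords_of_combination[OF T(3)] unfolding s_def t_def by auto
    then show False using st by simp
  qed
  obtain r where r: "r > 0" "ball x r \<subseteq> P" "\<And>T y. \<lbrakk>T \<in> \<Delta>; y \<in> T; y \<in> ball x r\<rbrakk> \<Longrightarrow> x \<in> T"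
    using local_triangles[OF xi] by metis
  define I where "I = {(a', b') \<in> star_corners z. x \<in> convex hull {z, a', b'}}"
  define U where "U = ball x r \<inter> (\<Inter>(a', b')\<in>I. strict_corner z a' b')"
  have "finite I" using star_corners_finite finite_subset[of I "star_corners z"] by (auto simp: I_def)
  then have "open U"
    unfolding U_def using strict_corner_open by (intro open_Int open_INT) auto
  moreover have "x \<in> U"
    unfolding U_def using r(1) strict_corner_transfer[OF ab x] by (auto simp: I_def)
  moreover have "U \<subseteq> dual_cell z"
  proof
    fix y assume y: "y \<in> U"
    then obtain X where X: "X \<in> \<Delta>" "y \<in> X" using r(2) \<Delta>_Union unfolding U_def by blast
    then have xX: "x \<in> X" using r(3) y unfolding U_def by blast
    obtain a' b' where X': "verts X = {z, a', b'}" "X = convex hull {z, a', b'}" "det2 (a' - z) (b' - z) = 1"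
      using corners_at[OF X(1) z_in[OF X(1) xX]] by metis
    have mem: "(a', b') \<in> star_corners z" using X X' by (auto simp: star_corners_def)
    then have "(a', b') \<in> I" using xX X'(2) by (auto simp: I_def)
    then have "y \<in> strict_corner z a' b'" using y unfolding U_def by blast
    then have "y \<in> corner_cell z a' b'"
      using X(2) mem_triangle_iff[OF X'(3), of y] X'(2) unfolding strict_corner_def corner_cell_def by auto
    then show "y \<in> dual_cell z" using mem unfolding dual_cell_def by blast
  qed
  ultimately show ?thesis by (rule interiorI)
qed

lemma spoke_dual_edge:
  assumes "z \<in> interior P" "T \<in> \<Delta>" "z \<noteq> u" "{z, u} \<subseteq> verts T"
  shows "closed_segment z u \<in> edges (dual_graph \<Delta>)"
proof -
  have "u \<in> P" using assms(2,4) verts_subset triangle_subset_P by blast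
  then obtain T' where "T' \<in> \<Delta>" "T' \<noteq> T" "{z, u} \<subseteq> verts T'"
    using second_triangle[OF assms(2-4)] midpoint_in_interior_segment[OF assms(1) _ assms(3)] by metis
  then show ?thesis using dual_edgeI[OF assms(2) _ _ assms(3,4)] by metis
qed

lemma dual_curve_spoke:
  assumes "z \<noteq> u" "T \<in> \<Delta>" "{z, u} \<subseteq> verts T"
  shows "closed_segment (midpoint z u) (barycenter T) \<subseteq> dual_curve \<Delta> (closed_segment z u)"
proof -
  have "T \<in> ends (dual_graph \<Delta>) (closed_segment z u)"
    using segment_edge_iff[OF assms(2,1)] assms(2,3) by (simp add: dual_ends)
  then show ?thesis
    unfolding dual_curve_def using barycenter_segment[OF assms(1)] by force
qed

text \<open>A point of the cell that is not interior satisfies one comparison with equality. This is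
  the equation of the segment from the midpoint of a spoke to the barycentre, one half of a dual
  curve.\<close>

lemma dual_cell_frontier:
  assumes z: "z \<in> interior P" and x: "x \<in> frontier (dual_cell z)"
  shows "\<exists>a. a \<noteq> z \<and> closed_segment z a \<in> edges (dual_graph \<Delta>) \<and> x \<in> dual_curve \<Delta> (closed_segment z a)"
proof -
  have x': "x \<in> dual_cell z" "x \<notin> interior (dual_cell z)"
    using x dual_cell_closed by (auto simp: frontier_def)
  then obtain a b where ab: "(a, b) \<in> star_corners z" "x \<in> corner_cell z a b" by (auto simp: dual_cell_def)
  have ns: "x \<notin> strict_corner z a b" using strict_corner_interior[OF z ab] x' by blast
  obtain T where T: "T \<in> \<Delta>" "verts T = {z, a, b}" "det2 (a - z) (b - z) = 1"
    using corner_cell_subset[OF ab(1)] by metis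
  define s t where "s = det2 (x - z) (b - z)" and "t = det2 (a - z) (x - z)"
  have st: "0 \<le> s" "0 \<le> t" "2 * s + t \<le> 1" "s + 2 * t \<le> 1"
    using ab(2) unfolding corner_cell_def s_def t_def by auto
  have xe: "x = z + s *\<^sub>R (a - z) + t *\<^sub>R (b - z)" unfolding s_def t_def by (rule det2_coords[OF T(3)])
  have ne: "z \<noteq> a" "z \<noteq> b" using T by auto
  have sub: "{z, a} \<subseteq> verts T" "{z, b} \<subseteq> verts T" unfolding T(2) by auto
  note bary = barycenter_triangle[OF T]
  \<comment> \<open>The coordinate \<open>l\<close> runs from 0 at the midpoint to 1/3 at the
    barycentre, hence the factor 3.\<close>
  have mid: "x \<in> closed_segment (midpoint z u) (barycenter T)"
    if "x = (1 - 3 * l) *\<^sub>R midpoint z u + (3 * l) *\<^sub>R barycenter T" "0 \<le> l" "3 * l \<le> 1" for u l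
    using that unfolding closed_segment_def by (intro CollectI exI[of _ "3 * l"]) auto
  have "2 * s + t = 1 \<or> s + 2 * t = 1" using ns st unfolding strict_corner_def s_def t_def by auto
  then show ?thesis
  proof
    assume eq: "2 * s + t = 1"
    then have s: "s = (1 - t) / 2" by simp
    have xm: "x = (1 - 3 * t) *\<^sub>R midpoint z a + (3 * t) *\<^sub>R barycenter T"
      unfolding xe bary s by (simp add: point_eq_iff midpoint_def field_simps)
    have "3 * t \<le> 1" using eq st by linarith
    then have "x \<in> closed_segment (midpoint z a) (barycenter T)" by (rule mid[OF xm st(2)])
    then show ?thesis
      using dual_curve_spoke[OF ne(1) T(1) sub(1)] spoke_dual_edge[OF z T(1) ne(1) sub(1)] ne(1)[symmetric] by blast
  next
    assume eq: "s + 2 * t = 1"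
    then have t: "t = (1 - s) / 2" by simp
    have xm: "x = (1 - 3 * s) *\<^sub>R midpoint z b + (3 * s) *\<^sub>R barycenter T"
      unfolding xe bary t by (simp add: point_eq_iff midpoint_def field_simps)
    have "3 * s \<le> 1" using eq st by linarith
    then have "x \<in> closed_segment (midpoint z b) (barycenter T)" by (rule mid[OF xm st(1)])
    then show ?thesis
      using dual_curve_spoke[OF ne(2) T(1) sub(2)] spoke_dual_edge[OF z T(1) ne(2) sub(2)] ne(2)[symmetric] by blast
  qed
qed

text \<open>
  The curves dual to the edges at \<open>z\<close> bound the set of points of the star of \<open>z\<close> whose barycentric
  coordinate at \<open>z\<close> is the largest one; a region containing \<open>z\<close> cannot leave this set.
\<close>

lemma region_vertex:
  assumes z: "z \<in> interior P" "z \<in> lattice_points" "z \<in> R" and R: "connected R"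
    and avoid: "\<And>a. a \<noteq> z \<Longrightarrow> closed_segment z a \<in> edges (dual_graph \<Delta>) \<Longrightarrow> R \<inter> dual_curve \<Delta> (closed_segment z a) = {}"
    and T: "T \<in> \<Delta>" "barycenter T \<in> closure R"
  shows "z \<in> verts T"
proof -
  have "R \<inter> frontier (dual_cell z) = {}" using dual_cell_frontier[OF z(1)] avoid by blast
  moreover obtain X where X: "X \<in> \<Delta>" "z \<in> verts X"
    using lattice_point_covered z interior_subset by blast
  then obtain a b where ab: "verts X = {z, a, b}" "det2 (a - z) (b - z) = 1"
    using corners_at by metis
  then have "(a, b) \<in> star_corners z" "z \<in> corner_cell z a b"
    using X by (auto simp: star_corners_def corner_cell_def)
  then have "z \<in> dual_cell z" unfolding dual_cell_def by blast
  ultimately have "R \<subseteq> dual_cell z" using connected_Int_frontier[OF R, of "dual_cell z"] z(3) by blast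
  then have "barycenter T \<in> dual_cell z" using T(2) closure_minimal[OF _ dual_cell_closed] by blast
  then obtain c d where cd: "(c, d) \<in> star_corners z" "barycenter T \<in> corner_cell z c d"
    unfolding dual_cell_def by blast
  obtain Y where Y: "Y \<in> \<Delta>" "verts Y = {z, c, d}" and "corner_cell z c d \<subseteq> Y"
    using corner_cell_subset[OF cd(1)] by metis
  then have bY: "barycenter T \<in> Y" using cd(2) by blast
  \<comment> \<open>The barycentre has all coordinates equal to 1/3, so it lies in no proper face of
    \<open>T\<close>; a triangle containing it has every corner of \<open>T\<close>.\<close>
  have "verts T \<subseteq> verts Y"
  proof
    fix u assume u: "u \<in> verts T"
    obtain p q where pq: "verts T = {u, p, q}" "det2 (p - u) (q - u) = 1"
      using corners_at[OF T(1) u] by metis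
    have b: "barycenter T = u + (1/3) *\<^sub>R (p - u) + (1/3) *\<^sub>R (q - u)" using barycenter_triangle[OF T(1) pq] .
    show "u \<in> verts Y"
    proof (rule ccontr)
      assume "u \<notin> verts Y"
      then have sub: "verts T \<inter> verts Y \<subseteq> {p, q}" using pq by auto
      have "T = convex hull {u, p, q}" using triangle_hull[OF T(1)] unfolding pq(1) .
      then have "barycenter T \<in> T"
        unfolding b using \<open>T = convex hull {u, p, q}\<close> convex_hull_3_alt[of u p q] by force
      then have "barycenter T \<in> convex hull (verts T \<inter> verts Y)" using triangle_Int[OF T(1) Y(1)] bY by blast
      then have "barycenter T \<in> closed_segment p q" using hull_mono[OF sub, of convex] by (auto simp: segment_convex_hull)
      then obtain l where l: "barycenter T = (1 - l) *\<^sub>R p + l *\<^sub>R q" by (auto simp: closed_segment_def)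
      have "barycenter T = u + (1 - l) *\<^sub>R (p - u) + l *\<^sub>R (q - u)" unfolding l by (simp add: algebra_simps)
      then have "1/3 = 1 - l" "1/3 = l"
        using det2_coords_of_combination[OF pq(2)] b by metis+
      then show False by simp
    qed
  qed
  moreover have "card (verts T) = 3" "card (verts Y) = 3" "finite (verts Y)"
  proof -
    have "card (verts X) = 3 \<and> finite (verts X)" if "X \<in> \<Delta>" for X
    proof -
      obtain z a b where v: "verts X = {z, a, b}" "det2 (a - z) (b - z) = 1" using triangle_corners[OF \<open>X \<in> \<Delta>\<close>] by metis
      then have "z \<noteq> a" "z \<noteq> b" "a \<noteq> b" by auto
      then show ?thesis unfolding v(1) by simp
    qed
    then show "card (verts T) = 3" "card (verts Y) = 3" "finite (verts Y)" using T(1) Y(1) by blast+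
  qed
  ultimately have "verts T = verts Y" by (simp add: card_subset_eq)
  then show ?thesis using Y by simp
qed

end

section \<open>Graphs and their smoothings\<close>

definition graph_component :: "('v, 'e) mgraph \<Rightarrow> 'v \<Rightarrow> 'v set" where
  "graph_component G u = {v \<in> nodes G. (u, v) \<in> (adjacency G)\<^sup>*}"

lemma graph_components_eq: "graph_components G = graph_component G ` nodes G"
  by (simp add: graph_components_def graph_component_def)

lemma sym_adjacency: "sym (adjacency G)"
  by (auto simp: sym_def adjacency_def insert_commute)

lemma adjacency_rtrancl_sym: "(u, v) \<in> (adjacency G)\<^sup>* \<Longrightarrow> (v, u) \<in> (adjacency G)\<^sup>*"
  using sym_rtrancl[OF sym_adjacency] by (rule symD)

lemma graph_component_eqI: "(u, v) \<in> (adjacency G)\<^sup>* \<Longrightarrow> graph_component G u = graph_component G v"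
  unfolding graph_component_def using adjacency_rtrancl_sym rtrancl_trans by (metis (no_types, lifting))

lemma doubleton_with:
  assumes "\<exists>u w. S = {u, w}" "v \<in> S"
  obtains p where "S = {v, p}"
  using assms by (elim exE) (metis insertE insert_commute singletonD)

text \<open>Cutting the edge isolates \<open>v\<close> as a component of its own, and the others
  still cover the components of \<open>G\<close>, because \<open>v\<close> had the neighbour
  \<open>u\<close>. This keeps the genus from dropping.\<close>

lemma leaf_edge_components:
  assumes fin: "finite (nodes G)" and e: "e \<in> edges G" "ends G e = {v, u}" "u \<noteq> v" "u \<in> nodes G" "v \<in> nodes G"
    and leaf: "\<And>e'. e' \<in> edges G \<Longrightarrow> v \<in> ends G e' \<Longrightarrow> e' = e"
  shows "card (graph_components G) + 1 \<le> card (graph_components (G\<lparr>edges := edges G - {e}\<rparr>))"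
proof -
  define G' where "G' = G\<lparr>edges := edges G - {e}\<rparr>"
  have n: "nodes G' = nodes G" by (simp add: G'_def)
  have "adjacency G' \<subseteq> adjacency G" by (auto simp: adjacency_def G'_def)
  then have mono: "(adjacency G')\<^sup>* \<subseteq> (adjacency G)\<^sup>*" by (rule rtrancl_mono)
  have isolated: "x = v" if "(v, x) \<in> (adjacency G')\<^sup>*" for x
    using that
  proof (induction rule: rtrancl_induct)
    case (step y x)
    then have "(v, x) \<in> adjacency G'" by simp
    then obtain e' where "e' \<in> edges G" "e' \<noteq> e" "ends G e' = {v, x}" by (auto simp: adjacency_def G'_def)
    then show ?case using leaf[of e'] by auto
  qed simp
  define \<psi> where "\<psi> K = \<Union>(graph_component G ` K)" for K
  have \<psi>: "\<psi> (graph_component G' x) = graph_component G x" if x: "x \<in> nodes G" for x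
  proof -
    have "graph_component G y = graph_component G x" if "y \<in> graph_component G' x" for y
    proof -
      have "(x, y) \<in> (adjacency G)\<^sup>*" using that mono by (auto simp: graph_component_def)
      then show ?thesis by (rule graph_component_eqI[symmetric])
    qed
    moreover have "x \<in> graph_component G' x" using x n by (simp add: graph_component_def)
    ultimately show ?thesis unfolding \<psi>_def by blast
  qed
  have gv: "graph_component G' v = {v}" using isolated e n by (auto simp: graph_component_def)
  have "graph_components G \<subseteq> \<psi> ` (graph_components G' - {{v}})"
  proof
    fix K assume "K \<in> graph_components G"
    then obtain x where x: "x \<in> nodes G" "K = graph_component G x" by (auto simp: graph_components_eq)
    have uv: "(v, u) \<in> adjacency G" using e by (auto simp: adjacency_def)
    obtain y where y: "y \<in> nodes G" "y \<noteq> v" "K = graph_component G y"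
    proof (cases "x = v")
      case True
      then have "K = graph_component G u" using x graph_component_eqI[OF r_into_rtrancl[OF uv]] by simp
      then show ?thesis using that e by blast
    next
      case False
      then show ?thesis using that x by blast
    qed
    have "y \<in> graph_component G' y" using y n by (simp add: graph_component_def)
    then have "graph_component G' y \<in> graph_components G' - {{v}}"
      using y n by (auto simp: graph_components_eq)
    then show "K \<in> \<psi> ` (graph_components G' - {{v}})" using \<psi> y by (intro image_eqI) auto
  qed
  moreover have fin': "finite (graph_components G')" using fin n by (simp add: graph_components_eq)
  ultimately have "card (graph_components G) \<le> card (graph_components G' - {{v}})"
    by (metis surj_card_le finite_Diff)
  moreover have vin: "{v} \<in> graph_components G'" using gv e n by (auto simp: graph_components_eq)
  moreover have "card (graph_components G') > 0" using fin' vin card_gt_0_iff by blast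
  ultimately show ?thesis using fin' unfolding G'_def[symmetric] by simp
qed

text \<open>Strip leaf edges one by one. Each lost edge is compensated by a new component, so the
  genus stays positive; without edges it would be 0, hence the stripping stops at a nonempty set. A
  loop is its own continuation.\<close>

lemma genus_pos_core:
  fixes G :: "('v, 'e) mgraph"
  assumes "finite (nodes G)" "finite (edges G)" "genus G > 0"
    and "\<And>e. e \<in> edges G \<Longrightarrow> ends G e \<subseteq> nodes G \<and> (\<exists>u v. ends G e = {u, v})"
  shows "\<exists>F\<subseteq>edges G. F \<noteq> {} \<and>
    (\<forall>e\<in>F. \<forall>v\<in>ends G e. ends G e = {v} \<or> (\<exists>e'\<in>F. e' \<noteq> e \<and> v \<in> ends G e'))"
  using assms
proof (induction "card (edges G)" arbitrary: G rule: less_induct)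
  case less
  show ?case
  proof (cases "edges G \<noteq> {} \<and>
      (\<forall>e\<in>edges G. \<forall>v\<in>ends G e. ends G e = {v} \<or> (\<exists>e'\<in>edges G. e' \<noteq> e \<and> v \<in> ends G e'))")
    case True
    then show ?thesis by (intro exI[of _ "edges G"]) simp
  next
    case False
    have "edges G \<noteq> {}"
    proof
      assume no: "edges G = {}"
      then have "adjacency G = {}" by (simp add: adjacency_def)
      then have "graph_components G = (\<lambda>u. {u}) ` nodes G"
        by (auto simp: graph_components_def)
      then have "card (graph_components G) = card (nodes G)" by (simp add: card_image)
      then show False using less.prems(3) no by (simp add: genus_def)
    qed
    then obtain e v where ev: "e \<in> edges G" "v \<in> ends G e" "ends G e \<noteq> {v}"
      "\<And>e'. e' \<in> edges G \<Longrightarrow> v \<in> ends G e' \<Longrightarrow> e' = e"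
      using False by metis
    obtain u where u: "ends G e = {v, u}" using doubleton_with less.prems(4)[OF ev(1)] ev(2) by metis
    have uv: "u \<noteq> v" using ev(3) unfolding u by auto
    have uvn: "u \<in> nodes G" "v \<in> nodes G" using less.prems(4)[OF ev(1)] unfolding u by auto
    define G' where "G' = G\<lparr>edges := edges G - {e}\<rparr>"
    have cc: "card (graph_components G) + 1 \<le> card (graph_components G')"
      unfolding G'_def using leaf_edge_components[OF less.prems(1) ev(1) u uv uvn ev(4)] .
    have ce: "card (edges G) = card (edges G') + 1" "card (edges G') < card (edges G)"
    proof -
      have "0 < card (edges G)" using less.prems(2) ev(1) by (auto simp: card_gt_0_iff)
      then show "card (edges G) = card (edges G') + 1" "card (edges G') < card (edges G)"
        using less.prems(2) ev(1) by (simp_all add: G'_def card_Diff_singleton)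
    qed
    have "genus G' > 0" using less.prems(3) cc ce by (simp add: genus_def G'_def)
    moreover have "edges G' \<subseteq> edges G" "nodes G' = nodes G" "ends G' = ends G" by (auto simp: G'_def)
    moreover from this have subs: "ends G' e \<subseteq> nodes G'" "\<exists>u v. ends G' e = {u, v}" if "e \<in> edges G'" for e
      using less.prems(4)[of e] that by auto
    ultimately have "\<exists>F\<subseteq>edges G'. F \<noteq> {} \<and>
      (\<forall>e\<in>F. \<forall>v\<in>ends G' e. ends G' e = {v} \<or> (\<exists>e'\<in>F. e' \<noteq> e \<and> v \<in> ends G' e'))"
      using less.prems(1,2) subs by (intro less.hyps[OF ce(2)]) (auto intro: finite_subset)
    then show ?thesis
      unfolding \<open>ends G' = ends G\<close> using \<open>edges G' \<subseteq> edges G\<close> by (meson subset_trans)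
  qed
qed

section \<open>Pruning of leaves\<close>

text \<open>Deleting a leaf removes a node with all its edges, so what survives pruning is
  determined by its nodes.\<close>

definition induced_subgraph :: "('v, 'e) mgraph \<Rightarrow> ('v, 'e) mgraph \<Rightarrow> bool" where
  "induced_subgraph H G \<longleftrightarrow> nodes H \<subseteq> nodes G \<and> ends H = ends G \<and>
     edges H = {e \<in> edges G. ends G e \<subseteq> nodes H}"

lemma delete_leaf_induced:
  assumes "delete_leaf\<^sup>*\<^sup>* G H" "\<And>e. e \<in> edges G \<Longrightarrow> ends G e \<subseteq> nodes G"
  shows "induced_subgraph H G"
  using assms(1)
proof (induction rule: rtranclp_induct)
  case base
  then show ?case using assms(2) by (auto simp: induced_subgraph_def)
next
  case (step H K)
  from step.hyps(2) show ?case
    by cases (use step.IH in \<open>auto simp: induced_subgraph_def\<close>)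
qed

text \<open>Every node of \<open>X\<close> keeps two edges within \<open>X\<close>, hence never
  becomes a leaf.\<close>

lemma delete_leaf_keeps:
  assumes "delete_leaf\<^sup>*\<^sup>* G H" "finite (edges G)" "X \<subseteq> nodes G"
    and X: "\<And>v. v \<in> X \<Longrightarrow> \<exists>e e'. e \<in> edges G \<and> e' \<in> edges G \<and> e \<noteq> e' \<and> v \<in> ends G e \<inter> ends G e' \<and>
      ends G e \<subseteq> X \<and> ends G e' \<subseteq> X"
    and ends: "\<And>e. e \<in> edges G \<Longrightarrow> ends G e \<subseteq> nodes G"
  shows "X \<subseteq> nodes H"
  using assms(1)
proof (induction rule: rtranclp_induct)
  case base
  then show ?case using assms(3) .
next
  case (step H K)
  have H: "induced_subgraph H G" using delete_leaf_induced[OF step.hyps(1) ends] .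
  from step.hyps(2) show ?case
  proof cases
    case (1 v)
    have "v \<notin> X"
    proof
      assume "v \<in> X"
      obtain e e' where e: "e \<in> edges G" "e' \<in> edges G" "e \<noteq> e'" "v \<in> ends G e \<inter> ends G e'"
        "ends G e \<subseteq> X" "ends G e' \<subseteq> X" using X[OF \<open>v \<in> X\<close>] by (elim exE conjE)
      have "{e, e'} \<subseteq> {e \<in> edges H. v \<in> ends H e}"
        using e H step.IH unfolding induced_subgraph_def by auto
      moreover have "finite {e \<in> edges H. v \<in> ends H e}"
        using assms(2) H by (auto simp: induced_subgraph_def)
      ultimately have "card {e, e'} \<le> card {e \<in> edges H. v \<in> ends H e}" by (intro card_mono)
      then show False using 1(3) e(3) by (simp add: valency_def)
    qed
    then show ?thesis using step.IH 1 by auto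
  qed
qed

section \<open>Invariants of the removal of nodes of degree two\<close>

text \<open>Multiplicity of \<open>v\<close> as an end of \<open>e\<close>: a loop counts twice, as
  in \<open>valency\<close>.\<close>

definition end_mult :: "('v, 'e) mgraph \<Rightarrow> 'e \<Rightarrow> 'v \<Rightarrow> nat" where
  "end_mult G e v = (if v \<in> ends G e then 1 else 0) + (if ends G e = {v} then 1 else 0)"

lemma valency_sum:
  assumes "finite (edges G)"
  shows "valency G v = (\<Sum>e\<in>edges G. end_mult G e v)"
proof -
  have "card {e \<in> edges G. Q e} = (\<Sum>e\<in>edges G. if Q e then 1 else 0)" for Q
    using assms by (simp add: sum.inter_filter[symmetric])
  then show ?thesis by (simp add: valency_def end_mult_def sum.distrib)
qed

text \<open>
  The invariant of the contraction; the edges of \<open>G\<close> are their own fibres. The last two clauses make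
  fibres behave like paths: a surviving node meets a fibre as often as the edge ends there, while a
  node that was smoothed away is never a dead end of a fibre.
\<close>

definition smoothing :: "('v, 'e) mgraph \<Rightarrow> ('v, 'e set) mgraph \<Rightarrow> bool" where
  "smoothing H G \<longleftrightarrow> finite (edges G) \<and> nodes G \<subseteq> nodes H \<and> \<Union>(edges G) = edges H \<and>
     (\<forall>E\<in>edges G. \<forall>E'\<in>edges G. E \<inter> E' \<noteq> {} \<longrightarrow> E = E') \<and>
     (\<forall>E\<in>edges G. E \<noteq> {} \<and> ends G E \<subseteq> nodes G \<and> (\<exists>u v. ends G E = {u, v}) \<and>
       (\<forall>v\<in>nodes G. card {s \<in> E. v \<in> ends H s} = end_mult G E v) \<and>
       (\<forall>v\<in>nodes H - nodes G. card {s \<in> E. v \<in> ends H s} \<noteq> 1))"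

lemma smoothingD:
  assumes "smoothing H G"
  shows "finite (edges G)" "nodes G \<subseteq> nodes H" "\<Union>(edges G) = edges H"
    "\<lbrakk>E \<in> edges G; E' \<in> edges G; E \<inter> E' \<noteq> {}\<rbrakk> \<Longrightarrow> E = E'"
    "E \<in> edges G \<Longrightarrow> E \<noteq> {}" "E \<in> edges G \<Longrightarrow> ends G E \<subseteq> nodes G"
    "E \<in> edges G \<Longrightarrow> \<exists>u v. ends G E = {u, v}"
    "\<lbrakk>E \<in> edges G; v \<in> nodes G\<rbrakk> \<Longrightarrow> card {s \<in> E. v \<in> ends H s} = end_mult G E v"
    "\<lbrakk>E \<in> edges G; v \<in> nodes H - nodes G\<rbrakk> \<Longrightarrow> card {s \<in> E. v \<in> ends H s} \<noteq> 1"
proof -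
  note D = assms[unfolded smoothing_def]
  show "finite (edges G)" using D by (elim conjE)
  show "nodes G \<subseteq> nodes H" using D by (elim conjE)
  show "\<Union>(edges G) = edges H" using D by (elim conjE)
  show "\<lbrakk>E \<in> edges G; E' \<in> edges G; E \<inter> E' \<noteq> {}\<rbrakk> \<Longrightarrow> E = E'" using D by (elim conjE) blast
  have B: "\<forall>E\<in>edges G. E \<noteq> {} \<and> ends G E \<subseteq> nodes G \<and> (\<exists>u v. ends G E = {u, v}) \<and>
       (\<forall>v\<in>nodes G. card {s \<in> E. v \<in> ends H s} = end_mult G E v) \<and>
       (\<forall>v\<in>nodes H - nodes G. card {s \<in> E. v \<in> ends H s} \<noteq> 1)" using D by (elim conjE)
  show "E \<in> edges G \<Longrightarrow> E \<noteq> {}" by (drule B[THEN bspec]) (elim conjE)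
  show "E \<in> edges G \<Longrightarrow> ends G E \<subseteq> nodes G" by (drule B[THEN bspec]) (elim conjE)
  show "E \<in> edges G \<Longrightarrow> \<exists>u v. ends G E = {u, v}" by (drule B[THEN bspec]) (elim conjE)
  show "\<lbrakk>E \<in> edges G; v \<in> nodes G\<rbrakk> \<Longrightarrow> card {s \<in> E. v \<in> ends H s} = end_mult G E v"
    by (drule B[THEN bspec]) (elim conjE, erule bspec)
  show "\<lbrakk>E \<in> edges G; v \<in> nodes H - nodes G\<rbrakk> \<Longrightarrow> card {s \<in> E. v \<in> ends H s} \<noteq> 1"
    by (drule B[THEN bspec]) (elim conjE, erule bspec)
qed

lemma smoothing_singleton:
  assumes "finite (edges H)"
    and "\<And>e. e \<in> edges H \<Longrightarrow> ends H e \<subseteq> nodes H \<and> (\<exists>u v. u \<noteq> v \<and> ends H e = {u, v})"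
  shows "smoothing H (singleton_edges H)"
proof -
  have "card {s. s = e \<and> v \<in> ends H s} = end_mult (singleton_edges H) {e} v" if e: "e \<in> edges H" for e v
  proof -
    have "ends H e \<noteq> {v}" using assms(2)[OF e] by auto
    moreover have "{s. s = e \<and> v \<in> ends H s} = (if v \<in> ends H e then {e} else {})" by auto
    ultimately show ?thesis by (simp add: end_mult_def singleton_edges_def)
  qed
  moreover have "\<exists>u v. ends H e = {u, v}" if "e \<in> edges H" for e using assms(2)[OF that] by blast
  ultimately show ?thesis
    using assms by (auto simp: smoothing_def singleton_edges_def)
qed

text \<open>Two distinct edges exhaust valency two, so \<open>v\<close> carries no loop.
  Disjointness of the fibres makes \<open>a \<union> b\<close> a fresh name, so updating
  \<open>ends\<close> there overwrites no existing edge.\<close>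

lemma smooth_node_step:
  assumes inv: "smoothing H G" and step: "smooth_node G G'"
  obtains v a b p q where "v \<in> nodes G" "a \<in> edges G" "b \<in> edges G" "a \<noteq> b" "a \<inter> b = {}"
    "ends G a = {v, p}" "ends G b = {v, q}" "p \<noteq> v" "q \<noteq> v" "p \<in> nodes G" "q \<in> nodes G"
    "\<And>E. E \<in> edges G \<Longrightarrow> v \<in> ends G E \<Longrightarrow> E = a \<or> E = b" "valency G v = 2" "a \<union> b \<notin> edges G"
    "nodes G' = nodes G - {v}" "edges G' = insert (a \<union> b) (edges G - {a, b})"
    "ends G' = (ends G)(a \<union> b := {p, q})"
  using step
proof cases
  case (1 v a b)
  have fin: "finite (edges G)" using smoothingD(1)[OF inv] .
  have sub: "{a, b} \<subseteq> {e \<in> edges G. v \<in> ends G e}" using 1 by auto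
  have fin': "finite {e \<in> edges G. v \<in> ends G e}" "finite {e \<in> edges G. ends G e = {v}}" using fin by auto
  have "card {a, b} \<le> card {e \<in> edges G. v \<in> ends G e}" using sub fin'(1) by (intro card_mono)
  moreover have "card {a, b} = 2" using 1(6) by simp
  ultimately have c2: "card {e \<in> edges G. v \<in> ends G e} = 2" "card {e \<in> edges G. ends G e = {v}} = 0"
    using 1(3) by (simp_all add: valency_def)
  have eq: "{a, b} = {e \<in> edges G. v \<in> ends G e}"
    using card_subset_eq[OF fin'(1) sub] c2(1) \<open>card {a, b} = 2\<close> by simp
  have nl: "{e \<in> edges G. ends G e = {v}} = {}" using c2(2) fin'(2) by simp
  have two: "\<exists>u w. ends G E = {u, w}" if "E \<in> edges G" for E
    using smoothingD(7)[OF inv that] .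
  obtain p q where pq: "ends G a = {v, p}" "ends G b = {v, q}"
    using doubleton_with[OF two[OF 1(4)] 1(7)] doubleton_with[OF two[OF 1(5)] 1(8)] by metis
  have ne: "p \<noteq> v" "q \<noteq> v" using nl pq 1 by auto
  have disj: "E \<inter> E' = {} \<or> E = E'" "E \<noteq> {}" if "E \<in> edges G" "E' \<in> edges G" for E E'
    using smoothingD(4,5)[OF inv] that by blast+
  have nodes: "p \<in> nodes G" "q \<in> nodes G" using smoothingD(6)[OF inv 1(4)] smoothingD(6)[OF inv 1(5)] pq by auto
  have "a \<union> b \<notin> edges G"
  proof
    assume m: "a \<union> b \<in> edges G"
    then have "a \<union> b = a" "a \<union> b = b" using disj[OF m 1(4)] disj[OF m 1(5)] disj(2)[OF 1(4) 1(4)] disj(2)[OF 1(5) 1(5)] by blast+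
    then show False using 1 by simp
  qed
  moreover have "(ends G a \<union> ends G b) - {v} = {p, q}" using pq ne by auto
  moreover have "a \<inter> b = {}" using disj(1)[OF 1(4,5)] 1(6) by blast
  moreover have "E = a \<or> E = b" if "E \<in> edges G" "v \<in> ends G E" for E using eq that by blast
  ultimately show ?thesis
    by (intro that[of v a b p q]) (use 1 pq ne nodes in simp_all)
qed

lemma smoothing_step:
  assumes inv: "smoothing H G" and fin: "finite (edges H)" and step: "smooth_node G G'"
  shows "smoothing H G'"
proof -
  obtain v a b p q where s: "v \<in> nodes G" "a \<in> edges G" "b \<in> edges G" "a \<noteq> b" "a \<inter> b = {}"
    "ends G a = {v, p}" "ends G b = {v, q}" "p \<noteq> v" "q \<noteq> v" "p \<in> nodes G" "q \<in> nodes G"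
    "\<And>E. E \<in> edges G \<Longrightarrow> v \<in> ends G E \<Longrightarrow> E = a \<or> E = b" "valency G v = 2" "a \<union> b \<notin> edges G"
    "nodes G' = nodes G - {v}" "edges G' = insert (a \<union> b) (edges G - {a, b})"
    "ends G' = (ends G)(a \<union> b := {p, q})"
    using smooth_node_step[OF inv step] by metis
  let ?c = "\<lambda>E x. card {s \<in> E. x \<in> ends H s}"
  have old: "ends G' E = ends G E" if "E \<in> edges G" for E using that s(14,17) by auto
  have finE: "finite E" if "E \<in> edges G" for E
    using smoothingD(3)[OF inv] that fin finite_subset[of E "edges H"] by blast
  have cab: "?c (a \<union> b) x = ?c a x + ?c b x" for x
  proof -
    have "{s \<in> a \<union> b. x \<in> ends H s} = {s \<in> a. x \<in> ends H s} \<union> {s \<in> b. x \<in> ends H s}" by blast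
    then show ?thesis using s(5) finE[OF s(2)] finE[OF s(3)] by (simp add: card_Un_disjoint disjoint_iff)
  qed
  have cm: "?c E x = end_mult G E x" if "E \<in> edges G" "x \<in> nodes G" for E x
    using smoothingD(8)[OF inv that] .
  have cn: "?c E x \<noteq> 1" if "E \<in> edges G" "x \<in> nodes H - nodes G" for E x
    using smoothingD(9)[OF inv that] .
  have disj: "E \<inter> E' = {} \<or> E = E'" if "E \<in> edges G" "E' \<in> edges G" for E E'
    using smoothingD(4)[OF inv] that by blast
  have A: "finite (edges G')" "nodes G' \<subseteq> nodes H" "\<Union>(edges G') = edges H"
    using smoothingD(1-3)[OF inv] s(2,3,15,16) by auto
  have Dj: "\<forall>E\<in>edges G'. \<forall>E'\<in>edges G'. E \<inter> E' \<noteq> {} \<longrightarrow> E = E'"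
  proof -
    have ab: "E \<inter> (a \<union> b) = {}" if "E \<in> edges G - {a, b}" for E
      using disj[of E a] disj[of E b] s(2,3) that by blast
    show ?thesis
    proof (intro ballI impI)
      fix E E' assume E: "E \<in> edges G'" "E' \<in> edges G'" and ne: "E \<inter> E' \<noteq> {}"
      have m: "D = a \<union> b \<or> D \<in> edges G - {a, b}" if "D \<in> edges G'" for D using that s(16) by blast
      show "E = E'"
      proof (cases "E = a \<union> b \<or> E' = a \<union> b")
        case True
        then show ?thesis using m[OF E(1)] m[OF E(2)] ab[of E] ab[of E'] ne by (metis Int_commute)
      next
        case False
        then show ?thesis using m[OF E(1)] m[OF E(2)] disj[of E E'] ne by (metis Diff_iff)
      qed
    qed
  qed
  have B: "E \<noteq> {} \<and> ends G' E \<subseteq> nodes G' \<and> (\<exists>u v. ends G' E = {u, v}) \<and>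
       (\<forall>v\<in>nodes G'. ?c E v = end_mult G' E v) \<and> (\<forall>v\<in>nodes H - nodes G'. ?c E v \<noteq> 1)" if E: "E \<in> edges G'" for E
  proof (cases "E = a \<union> b")
    case True
    have "?c (a \<union> b) x = end_mult G' (a \<union> b) x" if "x \<in> nodes G'" for x
    proof -
      have x: "x \<in> nodes G" "x \<noteq> v" using that s(15) by auto
      then have "?c (a \<union> b) x = end_mult G a x + end_mult G b x" using cab cm s(2,3) by simp
      \<comment> \<open>\<open>p\<close> and \<open>q\<close> may coincide; the merged edge is then
        a loop, of multiplicity 2 at that node.\<close>
      also have "\<dots> = end_mult G' (a \<union> b) x"
        using x(2) s(6,7,8,9,17) by (auto simp: end_mult_def)
      finally show ?thesis .
    qed
    moreover have "?c (a \<union> b) x \<noteq> 1" if x: "x \<in> nodes H - nodes G'" for x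
    proof (cases "x = v")
      case True
      \<comment> \<open>Each of the two edges ends once at the removed node, so the merged fibre
        meets it twice.\<close>
      have "end_mult G a v = 1" "end_mult G b v = 1" using s(6-9) by (auto simp: end_mult_def)
      then show ?thesis using True cab cm s(1-3) by simp
    next
      case False
      then show ?thesis using x s(15) cab cn[OF s(2), of x] cn[OF s(3), of x] by auto
    qed
    moreover have "a \<union> b \<noteq> {}" using smoothingD(5)[OF inv s(2)] by blast
    ultimately show ?thesis using True s(8-11,15,17) by auto
  next
    case False
    then have EG: "E \<in> edges G" "E \<noteq> a" "E \<noteq> b" using E s(16) by auto
    then have vE: "v \<notin> ends G E" using s(12) by blast
    have "end_mult G' E = end_mult G E" using old[OF EG(1)] by (simp add: end_mult_def fun_eq_iff)
    moreover have "?c E x \<noteq> 1" if x: "x \<in> nodes H - nodes G'" for x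
    proof (cases "x = v")
      case True
      then show ?thesis using cm[OF EG(1) s(1)] vE by (auto simp: end_mult_def)
    next
      case False
      then show ?thesis using x s(15) cn[OF EG(1)] by auto
    qed
    moreover have "E \<noteq> {} \<and> ends G E \<subseteq> nodes G \<and> (\<exists>u v. ends G E = {u, v})"
      using smoothingD(5-7)[OF inv EG(1)] by blast
    ultimately show ?thesis using old[OF EG(1)] vE s(15) cm[OF EG(1)] by auto
  qed
  show ?thesis
    unfolding smoothing_def
    by (intro conjI[OF A(1)] conjI[OF A(2)] conjI[OF A(3)] conjI[OF Dj] ballI) (rule B)
qed

text \<open>The fibres partition the edges of \<open>H\<close> and the multiplicities add up, so
  contraction does not change the valency of a surviving node.\<close>

lemma smoothing_valency:
  assumes inv: "smoothing H G" and fin: "finite (edges H)" and v: "v \<in> nodes G"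
  shows "valency G v = card {s \<in> edges H. v \<in> ends H s}"
proof -
  have finG: "finite (edges G)" using smoothingD(1)[OF inv] .
  have "{s \<in> edges H. v \<in> ends H s} = (\<Union>E\<in>edges G. {s \<in> E. v \<in> ends H s})"
    using smoothingD(3)[OF inv] by blast
  also have "card \<dots> = (\<Sum>E\<in>edges G. card {s \<in> E. v \<in> ends H s})"
  proof (rule card_UN_disjoint[OF finG])
    show "\<forall>E\<in>edges G. finite {s \<in> E. v \<in> ends H s}"
    proof
      fix E assume "E \<in> edges G"
      then have "{s \<in> E. v \<in> ends H s} \<subseteq> edges H" using smoothingD(3)[OF inv] by blast
      then show "finite {s \<in> E. v \<in> ends H s}" using fin by (rule finite_subset)
    qed
    show "\<forall>i\<in>edges G. \<forall>j\<in>edges G. i \<noteq> j \<longrightarrow> {s \<in> i. v \<in> ends H s} \<inter> {s \<in> j. v \<in> ends H s} = {}"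
      using smoothingD(4)[OF inv] by blast
  qed
  also have "\<dots> = (\<Sum>E\<in>edges G. end_mult G E v)"
    using smoothingD(8)[OF inv _ v] by (intro sum.cong) auto
  finally show ?thesis using valency_sum[OF finG] by simp
qed

lemma smoothing_end_mem:
  assumes inv: "smoothing H G" and E: "E \<in> edges G" and v: "v \<in> nodes G" and fin_edges: "finite (edges H)"
  shows "v \<in> ends G E \<longleftrightarrow> (\<exists>s\<in>E. v \<in> ends H s)"
proof -
  have "E \<subseteq> edges H" using smoothingD(3)[OF inv] E by blast
  then have fin: "finite {s \<in> E. v \<in> ends H s}" using fin_edges by (auto intro: finite_subset)
  have "card {s \<in> E. v \<in> ends H s} = end_mult G E v"
    using smoothingD(8)[OF inv E v] .
  moreover have "end_mult G E v = 0 \<longleftrightarrow> v \<notin> ends G E" by (auto simp: end_mult_def)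
  ultimately have "v \<notin> ends G E \<longleftrightarrow> card {s \<in> E. v \<in> ends H s} = 0" by metis
  then have "v \<notin> ends G E \<longleftrightarrow> {s \<in> E. v \<in> ends H s} = {}" unfolding card_0_eq[OF fin] .
  then show ?thesis by blast
qed

text \<open>A removed node has degree 2 already in \<open>H\<close>, which no end of
  \<open>s\<close> has, so the singleton fibre of \<open>s\<close> is not merged.\<close>

lemma smoothing_keeps_edge:
  assumes inv: "smoothing H G" and fin: "finite (edges H)" and step: "smooth_node G G'"
    and s: "{s} \<in> edges G" "\<And>v. v \<in> ends H s \<Longrightarrow> card {s \<in> edges H. v \<in> ends H s} \<noteq> 2"
  shows "{s} \<in> edges G'"
proof -
  obtain v a b p q where st: "v \<in> nodes G" "a \<in> edges G" "b \<in> edges G"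
    "ends G a = {v, p}" "ends G b = {v, q}" "valency G v = 2" "edges G' = insert (a \<union> b) (edges G - {a, b})"
    using smooth_node_step[OF inv step] by metis
  have "v \<notin> ends H s" using s(2) st(6) smoothing_valency[OF inv fin st(1)] by auto
  then have "v \<notin> ends G {s}" using smoothing_end_mem[OF inv s(1) st(1) fin] by simp
  then show ?thesis using st s(1) by auto
qed

text \<open>\<open>\<sigma>\<close> is a two-colouring of the triangles that changes only across
  \<open>s1\<close>; the invariant carries a separation in \<open>\<Delta>\<close> over to the
  skeleton. Away from \<open>s1\<close> the colour is controlled at the smoothed nodes too, since
  interior points are later read off from dual edges inside a fibre.\<close>

definition side_consistent :: "('v, 'e) mgraph \<Rightarrow> ('v \<Rightarrow> bool) \<Rightarrow> 'e \<Rightarrow> ('v, 'e set) mgraph \<Rightarrow> bool" where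
  "side_consistent H \<sigma> s1 G \<longleftrightarrow> (\<forall>E\<in>edges G.
     (s1 \<notin> E \<longrightarrow> (\<exists>c. \<forall>s\<in>E. \<forall>v\<in>ends H s. \<sigma> v = c)) \<and>
     (s1 \<in> E \<longrightarrow> (\<exists>u w. ends G E = {u, w} \<and> \<sigma> u \<noteq> \<sigma> w)))"

text \<open>At most one of the two merged fibres contains \<open>s1\<close>; the other carries the
  colour of \<open>v\<close> unchanged to its far end.\<close>

lemma side_consistent_step:
  assumes inv: "smoothing H G" and fin: "finite (edges H)" and step: "smooth_node G G'"
    and con: "side_consistent H \<sigma> s1 G"
  shows "side_consistent H \<sigma> s1 G'"
proof -
  obtain v a b p q where s: "v \<in> nodes G" "a \<in> edges G" "b \<in> edges G" "a \<noteq> b" "a \<inter> b = {}"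
    "ends G a = {v, p}" "ends G b = {v, q}" "p \<noteq> v" "q \<noteq> v" "p \<in> nodes G" "q \<in> nodes G"
    "\<And>E. E \<in> edges G \<Longrightarrow> v \<in> ends G E \<Longrightarrow> E = a \<or> E = b" "valency G v = 2" "a \<union> b \<notin> edges G"
    "nodes G' = nodes G - {v}" "edges G' = insert (a \<union> b) (edges G - {a, b})"
    "ends G' = (ends G)(a \<union> b := {p, q})"
    using smooth_node_step[OF inv step] by metis
  have ea: "\<exists>s\<in>a. v \<in> ends H s" "\<exists>s\<in>a. p \<in> ends H s" "\<exists>s\<in>b. v \<in> ends H s" "\<exists>s\<in>b. q \<in> ends H s"
    using smoothing_end_mem[OF inv s(2) s(1) fin] smoothing_end_mem[OF inv s(2) s(10) fin]
      smoothing_end_mem[OF inv s(3) s(1) fin] smoothing_end_mem[OF inv s(3) s(11) fin] s(6,7) by auto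
  have const: "\<exists>c. \<forall>s\<in>E. \<forall>v\<in>ends H s. \<sigma> v = c" if "E \<in> edges G" "s1 \<notin> E" for E
    using con that unfolding side_consistent_def by blast
  have jump: "\<exists>u w. ends G E = {u, w} \<and> \<sigma> u \<noteq> \<sigma> w" if "E \<in> edges G" "s1 \<in> E" for E
    using con that unfolding side_consistent_def by blast
  have same: "\<sigma> x = \<sigma> y" if "E \<in> edges G" "s1 \<notin> E" "\<exists>s\<in>E. x \<in> ends H s" "\<exists>s\<in>E. y \<in> ends H s" for E x y
    using const[OF that(1,2)] that(3,4) by metis
  have "\<exists>c. \<forall>s\<in>a \<union> b. \<forall>v\<in>ends H s. \<sigma> v = c" if "s1 \<notin> a \<union> b"
  proof -
    have "\<forall>s\<in>a \<union> b. \<forall>x\<in>ends H s. \<sigma> x = \<sigma> v"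
      using that same[OF s(2) _ _ ea(1)] same[OF s(3) _ _ ea(3)] by blast
    then show ?thesis by blast
  qed
  moreover have "\<sigma> p \<noteq> \<sigma> q" if "s1 \<in> a \<union> b"
  proof (cases "s1 \<in> a")
    case True
    then have "\<sigma> v \<noteq> \<sigma> p" using jump[OF s(2)] s(6) by (auto simp: doubleton_eq_iff)
    moreover have "\<sigma> v = \<sigma> q" using same[OF s(3) _ ea(3,4)] True s(5) by blast
    ultimately show ?thesis by auto
  next
    case False
    then have "\<sigma> v \<noteq> \<sigma> q" using that jump[OF s(3)] s(7) by (auto simp: doubleton_eq_iff)
    moreover have "\<sigma> v = \<sigma> p" using same[OF s(2) False ea(1,2)] .
    ultimately show ?thesis by auto
  qed
  moreover have "ends G' E = ends G E" if "E \<in> edges G" for E using that s(14,17) by auto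
  ultimately show ?thesis
    unfolding side_consistent_def using const jump s(16,17) by (metis DiffD1 fun_upd_same insertE)
qed

text \<open>Expresses that the skeleton edge containing \<open>s\<close> is not a bridge, in a form
  that passes through single contractions.\<close>

definition cycle_transport :: "'e \<Rightarrow> ('v, 'e set) mgraph \<Rightarrow> bool" where
  "cycle_transport s G \<longleftrightarrow> (\<forall>E\<in>edges G. s \<in> E \<longrightarrow>
     (\<forall>u\<in>ends G E. \<forall>w\<in>ends G E. (u, w) \<in> (adjacency (G\<lparr>edges := edges G - {E}\<rparr>))\<^sup>*))"

lemma rtrancl_hom:
  assumes "(x, y) \<in> R\<^sup>*" "\<And>x y. (x, y) \<in> R \<Longrightarrow> (f x, f y) \<in> S\<^sup>*"
  shows "(f x, f y) \<in> S\<^sup>*"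
  using assms(1) by (induction rule: rtrancl_induct) (auto intro: assms(2) rtrancl_trans)

text \<open>Detours are transported by collapsing the removed node onto one of its
  neighbours.\<close>

lemma cycle_transport_step:
  assumes inv: "smoothing H G" and step: "smooth_node G G'" and con: "cycle_transport s1 G"
  shows "cycle_transport s1 G'"
proof -
  obtain v a b p q where s: "v \<in> nodes G" "a \<in> edges G" "b \<in> edges G" "a \<noteq> b" "a \<inter> b = {}"
    "ends G a = {v, p}" "ends G b = {v, q}" "p \<noteq> v" "q \<noteq> v" "p \<in> nodes G" "q \<in> nodes G"
    "\<And>E. E \<in> edges G \<Longrightarrow> v \<in> ends G E \<Longrightarrow> E = a \<or> E = b" "valency G v = 2" "a \<union> b \<notin> edges G"
    "nodes G' = nodes G - {v}" "edges G' = insert (a \<union> b) (edges G - {a, b})"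
    "ends G' = (ends G)(a \<union> b := {p, q})"
    using smooth_node_step[OF inv step] by metis
  have old: "ends G' E = ends G E" if "E \<in> edges G" for E using that s(14,17) by auto
  have path: "(u, w) \<in> (adjacency (G\<lparr>edges := edges G - {E}\<rparr>))\<^sup>*"
    if "E \<in> edges G" "s1 \<in> E" "u \<in> ends G E" "w \<in> ends G E" for E u w
    using con that unfolding cycle_transport_def by blast
  have "(u, w) \<in> (adjacency (G'\<lparr>edges := edges G' - {E'}\<rparr>))\<^sup>*"
    if E': "E' \<in> edges G'" "s1 \<in> E'" and uw: "u \<in> ends G' E'" "w \<in> ends G' E'" for E' u w
  proof (cases "E' = a \<union> b")
    case False
    then have E: "E' \<in> edges G" "E' \<noteq> a" "E' \<noteq> b" using E' s(16) by auto
    \<comment> \<open>Moving \<open>v\<close> to \<open>q\<close> contracts \<open>b\<close> to a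
      point and turns \<open>a\<close> into the merged edge.\<close>
    let ?f = "\<lambda>x. if x = v then q else x"
    let ?S = "adjacency (G'\<lparr>edges := edges G' - {E'}\<rparr>)"
    have "(?f x, ?f y) \<in> ?S\<^sup>*" if xy: "(x, y) \<in> adjacency (G\<lparr>edges := edges G - {E'}\<rparr>)" for x y
    proof -
      obtain D where D: "D \<in> edges G" "D \<noteq> E'" "ends G D = {x, y}" using xy by (auto simp: adjacency_def)
      consider "D = a" | "D = b" | "D \<noteq> a" "D \<noteq> b" by blast
      then show ?thesis
      proof cases
        case 1
        have "(p, q) \<in> ?S" "(q, p) \<in> ?S" using s(16,17) False by (auto simp: adjacency_def)
        then show ?thesis using 1 D(3) s(6,8) by (auto simp: doubleton_eq_iff)
      next
        case 2
        then show ?thesis using D(3) s(7,9) by (auto simp: doubleton_eq_iff)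
      next
        case 3
        then have "v \<notin> {x, y}" using s(12) D by blast
        moreover have "(x, y) \<in> ?S" using 3 D old[OF D(1)] s(16) by (auto simp: adjacency_def)
        ultimately show ?thesis by auto
      qed
    qed
    then have "(?f u, ?f w) \<in> ?S\<^sup>*"
      using rtrancl_hom[OF path[OF E(1) E'(2)], of u w ?f] uw old[OF E(1)] by simp
    moreover have "u \<noteq> v" "w \<noteq> v" using s(12)[OF E(1)] E uw old[OF E(1)] by auto
    ultimately show ?thesis by simp
  next
    case True
    let ?S = "adjacency (G'\<lparr>edges := edges G' - {E'}\<rparr>)"
    \<comment> \<open>The merged edge itself is cut. The detour for its half \<open>c\<close>
      containing \<open>s1\<close> runs from \<open>x\<close> to \<open>v\<close>; collapsing
      \<open>v\<close> onto \<open>y\<close> contracts the other half and leaves a route from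
      \<open>x\<close> to \<open>y\<close>.\<close>
    have key: "(x, y) \<in> ?S\<^sup>*"
      if c: "s1 \<in> c" "c \<in> edges G" "c = a \<and> d = b \<or> c = b \<and> d = a" "ends G c = {v, x}" "ends G d = {v, y}"
        "x \<noteq> v" "y \<noteq> v" for c d x y
    proof -
      let ?f = "\<lambda>t. if t = v then y else t"
      have "(?f k, ?f l) \<in> ?S\<^sup>*" if kl: "(k, l) \<in> adjacency (G\<lparr>edges := edges G - {c}\<rparr>)" for k l
      proof -
        obtain D where D: "D \<in> edges G" "D \<noteq> c" "ends G D = {k, l}" using kl by (auto simp: adjacency_def)
        show ?thesis
        proof (cases "D = d")
          case True
          then show ?thesis using D(3) c(5,7) by (auto simp: doubleton_eq_iff)
        next
          case False
          then have D': "D \<noteq> a" "D \<noteq> b" using D(2) c(3) by auto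
          then have "v \<notin> {k, l}" using s(12) D by blast
          moreover have "(k, l) \<in> ?S"
            using D' D old[OF D(1)] s(14,16) True by (auto simp: adjacency_def)
          ultimately show ?thesis by auto
        qed
      qed
      moreover have "(x, v) \<in> (adjacency (G\<lparr>edges := edges G - {c}\<rparr>))\<^sup>*"
        using path[OF c(2,1)] c(4) by simp
      ultimately have "(?f x, ?f v) \<in> ?S\<^sup>*" by (rule rtrancl_hom[rotated])
      then show ?thesis using c(6) by simp
    qed
    have "(p, q) \<in> ?S\<^sup>*"
    proof (cases "s1 \<in> a")
      case True
      then show ?thesis using key[of a b p q] s by blast
    next
      case False
      then have "s1 \<in> b" using E' \<open>E' = a \<union> b\<close> by blast
      then have "(q, p) \<in> ?S\<^sup>*" using key[of b a q p] s by blast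
      then show ?thesis by (rule adjacency_rtrancl_sym)
    qed
    then have "(p, q) \<in> ?S\<^sup>*" "(q, p) \<in> ?S\<^sup>*" by (auto intro: adjacency_rtrancl_sym)
    moreover have "u \<in> {p, q}" "w \<in> {p, q}" using uw True s(17) by auto
    ultimately show ?thesis by auto
  qed
  then show ?thesis unfolding cycle_transport_def by blast
qed

section \<open>The skeleton of a triangulation\<close>

lemma other_element:
  assumes "finite S" "s \<in> S" "card S \<noteq> 1"
  obtains s' where "s' \<in> S" "s' \<noteq> s"
proof -
  have "S \<noteq> {s}" using assms(3) by auto
  then show ?thesis using that assms(2) by blast
qed

context unimodular_polygon
begin

lemma dual_nodes: "nodes (dual_graph \<Delta>) = \<Delta>"
  by (simp add: dual_graph_def)

lemma verts_finite: "T \<in> \<Delta> \<Longrightarrow> finite (verts T)"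
  using triangle_corners by (metis finite.emptyI finite_insert)

lemma dual_edges_finite: "finite (edges (dual_graph \<Delta>))"
proof -
  let ?V = "\<Union>(verts ` \<Delta>)"
  have "edges (dual_graph \<Delta>) \<subseteq> (\<lambda>(u, w). closed_segment u w) ` (?V \<times> ?V)"
  proof
    fix s assume s: "s \<in> edges (dual_graph \<Delta>)"
    obtain u w T where uw: "s = closed_segment u w" "T \<in> \<Delta>" "{u, w} \<subseteq> verts T"
      using dual_edge_obtain[OF s] by metis
    then have "(u, w) \<in> ?V \<times> ?V" by auto
    then show "s \<in> (\<lambda>(u, w). closed_segment u w) ` (?V \<times> ?V)" using uw(1) by (intro image_eqI) auto
  qed
  moreover have "finite ?V" using verts_finite \<Delta>_finite by blast
  ultimately show ?thesis by (meson finite_SigmaI finite_imageI finite_subset)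
qed

lemma dual_ends_pair:
  assumes "s \<in> edges (dual_graph \<Delta>)"
  obtains T T' where "T \<noteq> T'" "T \<in> \<Delta>" "T' \<in> \<Delta>" "ends (dual_graph \<Delta>) s = {T, T'}"
proof -
  obtain u w T T' where s: "s = closed_segment u w" "u \<noteq> w" "T \<in> \<Delta>" "T' \<in> \<Delta>" "T \<noteq> T'"
    "{u, w} \<subseteq> verts T" "{u, w} \<subseteq> verts T'"
    using dual_edge_obtain[OF assms] by metis
  have "X = T \<or> X = T'" if "X \<in> \<Delta>" "s edge_of X" for X
  proof -
    have "{u, w} \<subseteq> verts X" using that segment_edge_iff[OF that(1) s(2)] s(1) by simp
    then show ?thesis using at_most_two_triangles[OF s(3,4) that(1) s(5,2,6,7)] by simp
  qed
  moreover have "s edge_of T" "s edge_of T'"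
    using segment_edge_iff[OF s(3,2)] segment_edge_iff[OF s(4,2)] s(1,6,7) by simp_all
  ultimately have "ends (dual_graph \<Delta>) s = {T, T'}"
    unfolding dual_ends using s(3,4) by blast
  then show ?thesis using that s by blast
qed

lemma segment_ends:
  assumes "u \<noteq> w" "closed_segment u w \<in> edges (dual_graph \<Delta>)"
  shows "T \<in> ends (dual_graph \<Delta>) (closed_segment u w) \<longleftrightarrow> T \<in> \<Delta> \<and> {u, w} \<subseteq> verts T"
  unfolding dual_ends using segment_edge_iff[OF _ assms(1)] by blast

end

locale polygon_skeleton = unimodular_polygon +
  fixes H :: "(point set, point set) mgraph" and G :: "(point set, point set set) mgraph"
  assumes pruning: "delete_leaf\<^sup>*\<^sup>* (dual_graph \<Delta>) H"
    and contraction: "smooth_node\<^sup>*\<^sup>* (singleton_edges H) G"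
begin

lemma H_induced: "induced_subgraph H (dual_graph \<Delta>)"
  using delete_leaf_induced[OF pruning] by (simp add: dual_nodes) (auto simp: dual_ends)

lemma H_ends: "ends H = ends (dual_graph \<Delta>)"
  and H_edges: "s \<in> edges H \<longleftrightarrow> s \<in> edges (dual_graph \<Delta>) \<and> ends (dual_graph \<Delta>) s \<subseteq> nodes H"
  using H_induced by (auto simp: induced_subgraph_def)

lemma H_edges_finite: "finite (edges H)"
  using dual_edges_finite H_edges by (meson finite_subset subsetI)

lemma H_ends_pair:
  assumes "s \<in> edges H"
  obtains T T' where "T \<noteq> T'" "T \<in> \<Delta>" "T' \<in> \<Delta>" "ends H s = {T, T'}"
  using dual_ends_pair assms H_edges H_ends by metis

lemma mem_H_ends: "T \<in> ends H s \<longleftrightarrow> T \<in> \<Delta> \<and> s edge_of T"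
  by (simp add: H_ends dual_ends)

text \<open>Each triangle at \<open>z\<close> has two spokes, dual to edges towards triangles at
  \<open>z\<close>, so \<open>delete_leaf_keeps\<close> protects the whole star.\<close>

lemma star_in_H:
  assumes z: "z \<in> interior P" and T: "T \<in> \<Delta>" "z \<in> verts T"
  shows "T \<in> nodes H"
proof -
  let ?X = "{T \<in> \<Delta>. z \<in> verts T}"
  have "?X \<subseteq> nodes H"
  proof (rule delete_leaf_keeps[OF pruning dual_edges_finite])
    fix X assume X: "X \<in> ?X"
    then obtain a b where ab: "verts X = {z, a, b}" "det2 (a - z) (b - z) = 1"
      using corners_at by (metis (mono_tags, lifting) mem_Collect_eq)
    then have ne: "z \<noteq> a" "z \<noteq> b" "a \<noteq> b" by auto
    have sub: "{z, a} \<subseteq> verts X" "{z, b} \<subseteq> verts X" unfolding ab(1) by auto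
    have spoke: "closed_segment z u \<in> edges (dual_graph \<Delta>) \<and> X \<in> ends (dual_graph \<Delta>) (closed_segment z u)
      \<and> ends (dual_graph \<Delta>) (closed_segment z u) \<subseteq> ?X" if u: "z \<noteq> u" "{z, u} \<subseteq> verts X" for u
    proof -
      have e: "closed_segment z u \<in> edges (dual_graph \<Delta>)"
        using spoke_dual_edge[OF z _ u] X by simp
      then show ?thesis using segment_ends[OF u(1) e] X u(2) by blast
    qed
    have "closed_segment z a \<noteq> closed_segment z b" using ne by (simp add: doubleton_eq_iff)
    then show "\<exists>e e'. e \<in> edges (dual_graph \<Delta>) \<and> e' \<in> edges (dual_graph \<Delta>) \<and> e \<noteq> e' \<and>
      X \<in> ends (dual_graph \<Delta>) e \<inter> ends (dual_graph \<Delta>) e' \<and>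
      ends (dual_graph \<Delta>) e \<subseteq> ?X \<and> ends (dual_graph \<Delta>) e' \<subseteq> ?X"
      using spoke[OF ne(1) sub(1)] spoke[OF ne(2) sub(2)]
      by (intro exI[of _ "closed_segment z a"] exI[of _ "closed_segment z b"] conjI IntI) simp_all
  qed (auto simp: dual_nodes dual_ends)
  then show ?thesis using T by blast
qed

lemma spoke_in_H:
  assumes z: "z \<in> interior P" and u: "z \<noteq> u" "closed_segment z u \<in> edges (dual_graph \<Delta>)"
  shows "closed_segment z u \<in> edges H"
  unfolding H_edges using u(2) segment_ends[OF u] star_in_H[OF z] by blast

lemma smoothing_steps: "smooth_node\<^sup>*\<^sup>* (singleton_edges H) K \<Longrightarrow> smoothing H K"
proof (induction rule: rtranclp_induct)
  case base
  have "ends H e \<subseteq> nodes H \<and> (\<exists>u v. u \<noteq> v \<and> ends H e = {u, v})" if e: "e \<in> edges H" for e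
  proof -
    obtain T T' where "T \<noteq> T'" "ends H e = {T, T'}" using H_ends_pair[OF e] by metis
    then show ?thesis using e H_edges H_ends by metis
  qed
  then show ?case using H_edges_finite by (intro smoothing_singleton)
next
  case (step K L)
  then show ?case using smoothing_step H_edges_finite by metis
qed

lemma G_smoothing: "smoothing H G"
  using smoothing_steps contraction .

lemma G_end_mem: "\<lbrakk>E \<in> edges G; T \<in> nodes G\<rbrakk> \<Longrightarrow> T \<in> ends G E \<longleftrightarrow> (\<exists>s\<in>E. T \<in> \<Delta> \<and> s edge_of T)"
  using smoothing_end_mem[OF G_smoothing _ _ H_edges_finite] mem_H_ends by simp

lemma G_nodes: "nodes G \<subseteq> \<Delta>"
  using smoothingD(2)[OF G_smoothing] H_induced by (auto simp: induced_subgraph_def dual_nodes)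

lemma G_cover: "\<Union>(edges G) = edges H"
  using smoothingD(3)[OF G_smoothing] .

lemma G_disjoint: "\<lbrakk>E \<in> edges G; E' \<in> edges G; s \<in> E; s \<in> E'\<rbrakk> \<Longrightarrow> E = E'"
  using smoothingD(4)[OF G_smoothing] by blast

lemma G_side_consistent:
  assumes "\<And>s. s \<in> edges H \<Longrightarrow> s \<noteq> s1 \<Longrightarrow> \<exists>c. \<forall>T\<in>ends H s. \<sigma> T = c"
    and "\<exists>u w. ends H s1 = {u, w} \<and> \<sigma> u \<noteq> \<sigma> w"
  shows "side_consistent H \<sigma> s1 G"
  using contraction
proof (induction rule: rtranclp_induct)
  case base
  show ?case unfolding side_consistent_def
  proof (intro ballI conjI impI)
    fix E assume "E \<in> edges (singleton_edges H)"
    then obtain s where s: "E = {s}" "s \<in> edges H" by (auto simp: singleton_edges_def)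
    { assume "s1 \<notin> E"
      then show "\<exists>c. \<forall>s\<in>E. \<forall>v\<in>ends H s. \<sigma> v = c" using assms(1)[OF s(2)] s(1) by auto }
    { assume "s1 \<in> E"
      then have "ends (singleton_edges H) E = ends H s1" using s(1) by (simp add: singleton_edges_def)
      then show "\<exists>u w. ends (singleton_edges H) E = {u, w} \<and> \<sigma> u \<noteq> \<sigma> w" using assms(2) by simp }
  qed
next
  case (step K L)
  then show ?case using side_consistent_step smoothing_steps H_edges_finite by metis
qed

lemma G_cycle_transport:
  assumes "\<And>T T'. T \<in> ends H s \<Longrightarrow> T' \<in> ends H s \<Longrightarrow> (T, T') \<in> (adjacency (H\<lparr>edges := edges H - {s}\<rparr>))\<^sup>*"
  shows "cycle_transport s G"
  using contraction
proof (induction rule: rtranclp_induct)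
  case base
  show ?case unfolding cycle_transport_def
  proof (intro ballI impI)
    fix E T T' assume E: "E \<in> edges (singleton_edges H)" "s \<in> E"
      and T: "T \<in> ends (singleton_edges H) E" "T' \<in> ends (singleton_edges H) E"
    then have Es: "E = {s}" by (auto simp: singleton_edges_def)
    have "T \<in> ends H s" "T' \<in> ends H s" using T unfolding Es by (simp_all add: singleton_edges_def)
    then have "(T, T') \<in> (adjacency (H\<lparr>edges := edges H - {s}\<rparr>))\<^sup>*" by (rule assms)
    moreover have "adjacency (H\<lparr>edges := edges H - {s}\<rparr>)
      \<subseteq> adjacency ((singleton_edges H)\<lparr>edges := edges (singleton_edges H) - {E}\<rparr>)"
    proof (rule subrelI)
      fix X Y assume "(X, Y) \<in> adjacency (H\<lparr>edges := edges H - {s}\<rparr>)"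
      then obtain s' where s': "s' \<in> edges H" "s' \<noteq> s" "ends H s' = {X, Y}" by (auto simp: adjacency_def)
      have "{s'} \<in> edges (singleton_edges H) - {E}" "ends (singleton_edges H) {s'} = {X, Y}"
        using s' unfolding Es by (simp_all add: singleton_edges_def)
      then show "(X, Y) \<in> adjacency ((singleton_edges H)\<lparr>edges := edges (singleton_edges H) - {E}\<rparr>)"
        unfolding adjacency_def by (intro CollectI case_prodI bexI[of _ "{s'}"]) simp_all
    qed
    ultimately show "(T, T') \<in> (adjacency ((singleton_edges H)\<lparr>edges := edges (singleton_edges H) - {E}\<rparr>))\<^sup>*"
      using rtrancl_mono by blast
  qed
next
  case (step K L)
  then show ?case using cycle_transport_step smoothing_steps by metis
qed

lemma G_keeps_edge:
  assumes "s \<in> edges H" "\<And>T. T \<in> ends H s \<Longrightarrow> card {s \<in> edges H. T \<in> ends H s} \<noteq> 2"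
  shows "{s} \<in> edges G"
  using contraction
proof (induction rule: rtranclp_induct)
  case base
  show ?case using assms(1) by (simp add: singleton_edges_def)
next
  case (step K L)
  show ?case
    by (rule smoothing_keeps_edge[OF smoothing_steps[OF step.hyps(1)] H_edges_finite step.hyps(2) step.IH assms(2)])
qed

text \<open>Going the other way around \<open>v\<close> joins the two triangles at the spoke without
  crossing it, and this detour descends to the skeleton. So the fibre of a bridge contains no edge
  with an interior end point.\<close>

lemma spoke_fibre_connected:
  assumes v: "v \<in> interior P" "v \<noteq> u0" and E: "E \<in> edges G" "closed_segment v u0 \<in> E"
    and u: "u \<in> ends G E" "w \<in> ends G E"
  shows "(u, w) \<in> (adjacency (G\<lparr>edges := edges G - {E}\<rparr>))\<^sup>*"
proof -
  let ?s = "closed_segment v u0"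
  let ?R = "adjacency (H\<lparr>edges := edges H - {?s}\<rparr>)"
  have sub: "star_adjacent v u0 \<subseteq> ?R"
  proof
    fix p assume "p \<in> star_adjacent v u0"
    then obtain X Y x where p: "p = (X, Y)" "X \<in> \<Delta>" "Y \<in> \<Delta>" "X \<noteq> Y" "x \<noteq> v" "x \<noteq> u0"
      "{v, x} \<subseteq> verts X" "{v, x} \<subseteq> verts Y"
      by (auto simp: star_adjacent_def)
    have e: "closed_segment v x \<in> edges (dual_graph \<Delta>)"
      using dual_edgeI[OF p(2-4) p(5)[symmetric] p(7,8)] .
    then have "closed_segment v x \<in> edges H" using spoke_in_H[OF v(1) p(5)[symmetric]] by simp
    moreover have "closed_segment v x \<noteq> ?s" using p(5,6) by (simp add: doubleton_eq_iff)
    moreover have "ends H (closed_segment v x) = {X, Y}"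
    proof -
      obtain T T' where TT: "ends H (closed_segment v x) = {T, T'}"
        using H_ends_pair[OF \<open>closed_segment v x \<in> edges H\<close>] by metis
      have "X \<in> {T, T'}" "Y \<in> {T, T'}"
        using segment_ends[OF p(5)[symmetric] e] p(2,3,7,8) TT H_ends by simp_all
      then show ?thesis unfolding TT using p(4) by auto
    qed
    ultimately show "p \<in> ?R"
      unfolding p(1) adjacency_def by (intro CollectI case_prodI bexI[of _ "closed_segment v x"]) (simp_all del: closed_segment_eq)
  qed
  have "cycle_transport ?s G"
  proof (rule G_cycle_transport)
    fix T T' assume "T \<in> ends H ?s" "T' \<in> ends H ?s"
    then have T: "T \<in> \<Delta>" "T' \<in> \<Delta>" "?s edge_of T" "?s edge_of T'" by (simp_all add: mem_H_ends)
    moreover have "v \<in> verts T" "v \<in> verts T'"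
      using segment_edge_iff[OF T(1) v(2)] segment_edge_iff[OF T(2) v(2)] T(3,4) by simp_all
    ultimately have "T \<in> \<Delta>" "T' \<in> \<Delta>" "v \<in> verts T" "v \<in> verts T'" by simp_all
    then have "(T, T') \<in> (star_adjacent v u0)\<^sup>*"
      using star_connected[OF v(1) v(2)[symmetric]] by blast
    then show "(T, T') \<in> ?R\<^sup>*" using rtrancl_mono[OF sub] by blast
  qed
  then show ?thesis using E u unfolding cycle_transport_def by blast
qed

text \<open>A fibre has no dead end at a smoothed node, and the fibre of a loop meets its node
  twice; at every other end the hypothesis on \<open>F\<close> supplies a further fibre.\<close>

lemma lift_core:
  assumes F: "F \<subseteq> edges G"
    and core: "\<And>E T. E \<in> F \<Longrightarrow> T \<in> ends G E \<Longrightarrow> ends G E = {T} \<or> (\<exists>E'\<in>F. E' \<noteq> E \<and> T \<in> ends G E')"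
  shows "edge_core (\<Union>F)"
  unfolding edge_core_def
proof (intro conjI ballI impI)
  have sub: "\<Union>F \<subseteq> edges H" using F G_cover by blast
  then show "\<Union>F \<subseteq> edges (dual_graph \<Delta>)" using H_edges by blast
  fix s T assume s: "s \<in> \<Union>F" and T: "T \<in> \<Delta>" "s edge_of T"
  then obtain E where E: "E \<in> F" "s \<in> E" by blast
  have EG: "E \<in> edges G" using E F by blast
  have "{s \<in> E. T \<in> ends H s} \<subseteq> edges H" using sub E by blast
  then have finE: "finite {s \<in> E. T \<in> ends H s}" using H_edges_finite by (rule finite_subset)
  have sin: "s \<in> {s \<in> E. T \<in> ends H s}" using E T mem_H_ends by simp
  have within: "\<exists>s'\<in>\<Union>F. s' \<noteq> s \<and> s' edge_of T" if c: "card {s \<in> E. T \<in> ends H s} \<noteq> 1"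
  proof -
    obtain s' where "s' \<in> {s \<in> E. T \<in> ends H s}" "s' \<noteq> s"
      using other_element[OF finE sin c] by metis
    then show ?thesis using E(1) mem_H_ends by blast
  qed
  have "ends H s \<subseteq> nodes H" using sub s H_edges H_ends by (metis subsetD)
  then have "T \<in> nodes H" using sin by blast
  show "\<exists>s'\<in>\<Union>F. s' \<noteq> s \<and> s' edge_of T"
  proof (cases "T \<in> nodes G")
    case True
    then have TE: "T \<in> ends G E" using G_end_mem[OF EG True] E(2) T by blast
    from core[OF E(1) TE] show ?thesis
    proof
      assume "ends G E = {T}"
      then have "card {s \<in> E. T \<in> ends H s} = 2"
        using smoothingD(8)[OF G_smoothing EG True] by (simp add: end_mult_def)
      then show ?thesis using within by simp
    next
      assume "\<exists>E'\<in>F. E' \<noteq> E \<and> T \<in> ends G E'"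
      then obtain E' where E': "E' \<in> F" "E' \<noteq> E" "T \<in> ends G E'" by blast
      have E'G: "E' \<in> edges G" using E' F by blast
      then obtain s' where "s' \<in> E'" "s' edge_of T" using G_end_mem[OF _ True] E'(3) by blast
      moreover have "s' \<noteq> s" using G_disjoint[OF E'G EG] E'(2) E(2) \<open>s' \<in> E'\<close> by blast
      ultimately show ?thesis using E'(1) by blast
    qed
  next
    case False
    then show ?thesis using within smoothingD(9)[OF G_smoothing EG, of T] \<open>T \<in> nodes H\<close> by blast
  qed
qed

lemma subgraph_core:
  assumes B: "subgraph B G" "genus B > 0"
  obtains F where "F \<subseteq> edges B" "F \<noteq> {}" "edge_core (\<Union>F)" "\<Union>F \<noteq> {}"
proof -
  have sub: "edges B \<subseteq> edges G" "nodes B \<subseteq> nodes G" "ends B = ends G" 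
    "\<And>E. E \<in> edges B \<Longrightarrow> ends B E \<subseteq> nodes B"
    using B(1) unfolding subgraph_def by (elim conjE; simp)+
  have "finite (nodes B)" using sub(2) G_nodes \<Delta>_finite by (meson finite_subset subset_trans)
  moreover have "finite (edges B)" using sub(1) smoothingD(1)[OF G_smoothing] finite_subset by blast
  moreover have "ends B E \<subseteq> nodes B \<and> (\<exists>u v. ends B E = {u, v})" if "E \<in> edges B" for E
    using sub that smoothingD(7)[OF G_smoothing, of E] by auto
  ultimately obtain F where F: "F \<subseteq> edges B" "F \<noteq> {}"
    "\<forall>e\<in>F. \<forall>v\<in>ends B e. ends B e = {v} \<or> (\<exists>e'\<in>F. e' \<noteq> e \<and> v \<in> ends B e')"
    using genus_pos_core[OF _ _ B(2)] by metis
  have FG: "F \<subseteq> edges G" using F(1) sub(1) by blast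
  have "edge_core (\<Union>F)" using F(3) unfolding sub(3) by (intro lift_core[OF FG]) blast
  moreover have "\<Union>F \<noteq> {}" using F(2) FG smoothingD(5)[OF G_smoothing] by blast
  ultimately show ?thesis using that F by blast
qed

section \<open>The triangle at a cut edge\<close>

text \<open>Both spokes at the interior vertex survive pruning, so with \<open>[a, b]\<close> the
  triangle has three nonredundant edges and cannot be smoothed away.\<close>

lemma valency_three_edges:
  assumes z: "z \<in> interior P" and T: "T \<in> \<Delta>" "verts T = {z, a, b}" "z \<noteq> a" "z \<noteq> b" "a \<noteq> b"
    and ab: "closed_segment a b \<in> edges H"
  shows "card {s \<in> edges H. T \<in> ends H s} \<noteq> 2"
proof -
  have sub: "{z, a} \<subseteq> verts T" "{z, b} \<subseteq> verts T" "{a, b} \<subseteq> verts T" unfolding T(2) by auto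
  have "closed_segment z a \<in> edges H" "closed_segment z b \<in> edges H"
    using spoke_in_H[OF z] spoke_dual_edge[OF z T(1)] T(3,4) sub by blast+
  moreover have "T \<in> ends H (closed_segment z a)" "T \<in> ends H (closed_segment z b)" "T \<in> ends H (closed_segment a b)"
    unfolding mem_H_ends using segment_edge_iff[OF T(1)] T(1,3-5) sub by blast+
  ultimately have "{closed_segment z a, closed_segment z b, closed_segment a b} \<subseteq> {s \<in> edges H. T \<in> ends H s}"
    using ab by blast
  moreover have "finite {s \<in> edges H. T \<in> ends H s}" using H_edges_finite by simp
  ultimately have "card {closed_segment z a, closed_segment z b, closed_segment a b} \<le> card {s \<in> edges H. T \<in> ends H s}"
    by (intro card_mono)
  moreover have "card {closed_segment z a, closed_segment z b, closed_segment a b} = 3"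
    using T(3-5) by (simp add: doubleton_eq_iff)
  ultimately show ?thesis by simp
qed

text \<open>
  Since \<open>e\<close> is the only edge leaving \<open>B\<close>, no edge of \<open>\<Delta>\<close> in its fibre can have an interior end point:
  the triangles around such a point would provide a detour. So the edge of \<open>T\<close> opposite to \<open>z\<close> is a
  chord, and it separates \<open>B\<close> from the rest of \<open>G\<close>.
\<close>

lemma cut_branch:
  assumes conn: "connected_graph G" and T: "T \<in> nodes G" "T \<notin> nodes B" "z \<in> verts T" and z: "z \<in> interior P"
    and B: "subgraph B G" "genus B > 0"
    and e: "e \<in> edges G" "ends G e = {T, x}" "x \<in> nodes B"
    and shore: "\<And>E. E \<in> edges G \<Longrightarrow> E \<noteq> e \<Longrightarrow> ends G E \<subseteq> nodes B \<or> ends G E \<inter> nodes B = {}"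
  obtains a b where "verts T = {z, a, b}" "det2 (a - z) (b - z) = 1" "chord b a" "a + b - z \<in> interior P"
    "e = {closed_segment b a}"
    "\<And>E s X. \<lbrakk>E \<in> edges G; E \<noteq> e; ends G E \<inter> nodes B = {}; s \<in> E; X \<in> \<Delta>; s edge_of X\<rbrakk> \<Longrightarrow> \<not> beyond b a X"
proof -
  have TD: "T \<in> \<Delta>" using T(1) G_nodes by blast
  obtain a b where ab: "verts T = {z, a, b}" "det2 (a - z) (b - z) = 1"
    using corners_at[OF TD T(3)] by metis
  have ne: "z \<noteq> a" "z \<noteq> b" "a \<noteq> b" using ab(2) by auto
  \<comment> \<open>No walk from \<open>T\<close> enters \<open>B\<close> without \<open>e\<close>,
    since every other edge stays on its shore.\<close>
  have outside: "y \<notin> nodes B" if "(T, y) \<in> (adjacency (G\<lparr>edges := edges G - {e}\<rparr>))\<^sup>*" for y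
    using that
  proof (induction rule: rtrancl_induct)
    case base
    show ?case by (rule T(2))
  next
    case (step y w)
    obtain D where D: "D \<in> edges G" "D \<noteq> e" "ends G D = {y, w}"
      using step.hyps(2) by (auto simp: adjacency_def)
    have "{y, w} \<subseteq> nodes B \<or> {y, w} \<inter> nodes B = {}" using shore[OF D(1,2)] unfolding D(3) .
    then show ?case using step.IH by blast
  qed
  have "T \<in> ends G e" using e(2) by simp
  then obtain s where s: "s \<in> e" "s edge_of T" using G_end_mem[OF e(1) T(1)] by blast
  have sH: "s \<in> edges H" using s(1) e(1) G_cover by blast
  \<comment> \<open>A spoke of an interior vertex in the fibre would yield such a walk from
    \<open>T\<close> to \<open>x\<close>.\<close>
  have no_int: "v \<notin> interior P" if "s = closed_segment v u" "v \<noteq> u" for v u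
  proof
    assume "v \<in> interior P"
    then have "(T, x) \<in> (adjacency (G\<lparr>edges := edges G - {e}\<rparr>))\<^sup>*"
      using spoke_fibre_connected[of v u e T x] that s(1) e(1,2) by simp
    then show False using outside e(3) by blast
  qed
  obtain p q where pq: "p \<noteq> q" "{p, q} \<subseteq> verts T" "s = closed_segment p q"
    using edge_of_iff[OF TD] s(2) by metis
  have "z \<noteq> p" "z \<noteq> q"
    using no_int[of p q] no_int[of q p] pq(1,3) z by (metis closed_segment_commute)+
  \<comment> \<open>Neither end of \<open>s\<close> is \<open>z\<close>, so \<open>s\<close> is the
    opposite side of \<open>T\<close>.\<close>
  then have "{p, q} = {b, a}" using pq(1,2) unfolding ab(1) by auto
  then have sba: "s = closed_segment b a" using pq(3) by (simp only: closed_segment_eq)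
  have bnd: "b \<notin> interior P" "a \<notin> interior P"
    using no_int[OF sba ne(3)[symmetric]] no_int[of a b] sba ne(3) by (simp_all add: closed_segment_commute)
  have sD: "closed_segment b a \<in> edges (dual_graph \<Delta>)" using sH H_edges sba by simp
  have ch: "chord b a" using dual_edge_chord[OF sD bnd ne(3)[symmetric]] .
  define \<sigma> where "\<sigma> = beyond b a"
  have dz: "det2 (a - b) (z - b) = - 1" using ab(2) by (simp add: det2_def algebra_simps)
  have "verts T = {b, a, z}" unfolding ab(1) by auto
  then have \<sigma>T: "\<not> \<sigma> T" using beyond_third[of T b a z] dz by (simp add: \<sigma>_def)
  obtain T' where T': "T' \<in> \<Delta>" "T' \<noteq> T" "ends H s = {T, T'}"
  proof -
    obtain X Y where XY: "X \<noteq> Y" "X \<in> \<Delta>" "Y \<in> \<Delta>" "ends H s = {X, Y}" using H_ends_pair[OF sH] by metis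
    have "T \<in> {X, Y}" unfolding XY(4)[symmetric] mem_H_ends using TD s(2) by simp
    then show ?thesis using that[of X] that[of Y] XY by (auto simp: insert_commute)
  qed
  have T'v: "{b, a} \<subseteq> verts T'"
  proof -
    have "T' \<in> ends H s" using T'(3) by simp
    then show ?thesis using segment_edge_iff[OF T'(1) ne(3)[symmetric]] unfolding mem_H_ends sba by simp
  qed
  have \<sigma>T': "\<sigma> T'"
  proof -
    obtain c where c: "verts T' = {b, a, c}" using corners_edge[OF T'(1) T'v ne(3)[symmetric]] by metis
    have "det2 (a - b) (z - b) * det2 (a - b) (c - b) = - 1"
      using opposite_sides[OF TD T'(1) T'(2)[symmetric] ne(3)[symmetric] \<open>verts T = {b, a, z}\<close> c] .
    then show ?thesis using dz beyond_third[OF c] by (simp add: \<sigma>_def)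
  qed
  have side: "side_consistent H \<sigma> s G"
  proof (rule G_side_consistent)
    fix s' assume s': "s' \<in> edges H" "s' \<noteq> s"
    obtain X Y where XY: "X \<noteq> Y" "X \<in> \<Delta>" "Y \<in> \<Delta>" "ends H s' = {X, Y}" using H_ends_pair[OF s'(1)] by metis
    obtain k l where kl: "k \<noteq> l" "s' = closed_segment k l"
      using dual_edge_obtain H_edges s'(1) by metis
    have sub: "{k, l} \<subseteq> verts X" "{k, l} \<subseteq> verts Y"
    proof -
      have "X \<in> ends H s'" "Y \<in> ends H s'" using XY(4) by simp_all
      then show "{k, l} \<subseteq> verts X" "{k, l} \<subseteq> verts Y"
        unfolding mem_H_ends kl(2)
        using segment_edge_iff[OF XY(2) kl(1)] segment_edge_iff[OF XY(3) kl(1)] by simp_all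
    qed
    have "{k, l} \<noteq> {b, a}" using s'(2) unfolding kl(2) sba by simp
    then have "\<sigma> X = \<sigma> Y"
      using chord_adjacent[OF ch XY(2,3) kl(1) sub] chord_adjacent[OF ch XY(3,2) kl(1) sub(2,1)]
      unfolding \<sigma>_def by blast
    then show "\<exists>c. \<forall>T\<in>ends H s'. \<sigma> T = c" unfolding XY(4) by simp
  next
    show "\<exists>u w. ends H s = {u, w} \<and> \<sigma> u \<noteq> \<sigma> w" using T'(3) \<sigma>T \<sigma>T' by blast
  qed
  note side_bspec = bspec[OF side[unfolded side_consistent_def]]
  have "\<exists>u w. ends G e = {u, w} \<and> \<sigma> u \<noteq> \<sigma> w"
    using side_bspec[OF e(1), THEN conjunct2] s(1) by (rule mp)
  then have \<sigma>x: "\<sigma> x" using \<sigma>T e(2) by (metis doubleton_eq_iff)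
  have const: "\<sigma> X = \<sigma> Y" if E: "E \<in> edges G" "E \<noteq> e"
    and X: "s1 \<in> E" "X \<in> \<Delta>" "s1 edge_of X" and Y: "s2 \<in> E" "Y \<in> \<Delta>" "s2 edge_of Y" for E s1 s2 X Y
  proof -
    have "s \<notin> E" using G_disjoint[OF E(1) e(1)] s(1) E(2) by blast
    with side_bspec[OF E(1), THEN conjunct1] have "\<exists>c. \<forall>s\<in>E. \<forall>v\<in>ends H s. \<sigma> v = c" by (rule mp)
    then obtain c where c: "\<And>s v. s \<in> E \<Longrightarrow> v \<in> ends H s \<Longrightarrow> \<sigma> v = c" by blast
    have "\<sigma> X = c" using X by (intro c[OF X(1)]) (simp add: mem_H_ends)
    moreover have "\<sigma> Y = c" using Y by (intro c[OF Y(1)]) (simp add: mem_H_ends)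
    ultimately show ?thesis by simp
  qed
  have end_edge: "\<exists>s\<in>E. u \<in> \<Delta> \<and> s edge_of u" if "E \<in> edges G" "u \<in> ends G E" for E u
    using G_end_mem[OF that(1)] smoothingD(6)[OF G_smoothing that(1)] that(2) by blast
  \<comment> \<open>Lying beyond the chord and belonging to \<open>B\<close> agree at the ends of
    \<open>e\<close>, and no other edge changes either, so they agree along every walk in the
    connected skeleton.\<close>
  have \<sigma>B: "\<sigma> y \<longleftrightarrow> y \<in> nodes B" if y: "y \<in> nodes G" for y
  proof -
    obtain K where K: "graph_components G = {K}" using conn by (auto simp: connected_graph_def)
    have "graph_component G T = K" "graph_component G y = K"
      using K T(1) y unfolding graph_components_eq by blast+
    moreover have "y \<in> graph_component G y" using y by (simp add: graph_component_def)
    ultimately have "(T, y) \<in> (adjacency G)\<^sup>*" by (auto simp: graph_component_def)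
    then show ?thesis
    proof (induction rule: rtrancl_induct)
      case base
      show ?case using \<sigma>T T(2) by simp
    next
      case (step y w)
      obtain D where D: "D \<in> edges G" "ends G D = {y, w}"
        using step.hyps(2) by (auto simp: adjacency_def)
      show ?case
      proof (cases "D = e")
        case True
        then have "w = T \<or> w = x" using D(2) e(2) by (metis doubleton_eq_iff)
        then show ?thesis using \<sigma>T T(2) \<sigma>x e(3) by blast
      next
        case False
        obtain s1 s2 where "s1 \<in> D" "y \<in> \<Delta>" "s1 edge_of y" "s2 \<in> D" "w \<in> \<Delta>" "s2 edge_of w"
          using end_edge[OF D(1), of y] end_edge[OF D(1), of w] D(2) by auto
        then have "\<sigma> y = \<sigma> w" using const[OF D(1) False] by blast
        moreover have "{y, w} \<subseteq> nodes B \<or> {y, w} \<inter> nodes B = {}" using shore[OF D(1) False] unfolding D(2) .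
        ultimately show ?thesis using step.IH by blast
      qed
    qed
  qed
  have fibre_side: "\<sigma> X \<longleftrightarrow> ends G E \<subseteq> nodes B" if E: "E \<in> edges G" "E \<noteq> e" and X: "s1 \<in> E" "X \<in> \<Delta>" "s1 edge_of X" for E s1 X
  proof -
    obtain u w where u: "ends G E = {u, w}" using smoothingD(7)[OF G_smoothing E(1)] by blast
    have uG: "u \<in> nodes G" using smoothingD(6)[OF G_smoothing E(1)] u by blast
    obtain s2 where "s2 \<in> E" "u \<in> \<Delta>" "s2 edge_of u" using end_edge[OF E(1), of u] u by blast
    then have "\<sigma> X = \<sigma> u" using const[OF E X] by blast
    moreover have "u \<in> nodes B \<longleftrightarrow> ends G E \<subseteq> nodes B" using shore[OF E] u by blast
    ultimately show ?thesis using \<sigma>B[OF uG] by blast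
  qed
  have near: "\<not> beyond b a X" if "E \<in> edges G" "E \<noteq> e" "ends G E \<inter> nodes B = {}" "s1 \<in> E" "X \<in> \<Delta>" "s1 edge_of X" for E s1 X
  proof -
    have "\<not> ends G E \<subseteq> nodes B" using that(3) smoothingD(7)[OF G_smoothing that(1)] by auto
    then show ?thesis using fibre_side[OF that(1,2,4-6)] by (simp add: \<sigma>_def)
  qed
  \<comment> \<open>The core of \<open>B\<close> supplies an interior lattice point on the far side.
    It is not an end of the chord, so it lies strictly beyond it and forces (1, 1) into the
    interior.\<close>
  have apex: "a + b - z \<in> interior P"
  proof -
    obtain F where F: "F \<subseteq> edges B" "F \<noteq> {}" "edge_core (\<Union>F)" "\<Union>F \<noteq> {}" using subgraph_core[OF B] by metis
    obtain k l where kl: "closed_segment k l \<in> \<Union>F" "k \<noteq> l" "k \<in> interior P" "k \<in> lattice_points"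
      using core_interior_endpoint[OF F(3,4)] by metis
    obtain E where E: "E \<in> F" "closed_segment k l \<in> E" using kl(1) by blast
    have EB: "E \<in> edges B" "E \<in> edges G" "ends G E \<subseteq> nodes B"
      using E(1) F(1) B(1) unfolding subgraph_def by (metis subsetD)+
    have Ee: "E \<noteq> e" using EB(3) e(2) T(2) by blast
    have klD: "closed_segment k l \<in> edges (dual_graph \<Delta>)" using E EB(2) G_cover H_edges by blast
    obtain X where X: "X \<in> \<Delta>" "closed_segment k l edge_of X"
      using klD unfolding dual_graph_def mgraph.simps by blast
    have "\<sigma> X" using fibre_side[OF EB(2) Ee E(2) X] EB(3) by blast
    then have "\<forall>y\<in>verts X. 0 \<le> det2 (a - b) (y - b)"
      using chord_side[OF ch X(1)] unfolding \<sigma>_def beyond_def by force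
    moreover have kX: "k \<in> verts X" using segment_edge_iff[OF X(1) kl(2)] X(2) by simp
    ultimately have "0 \<le> det2 (a - b) (k - b)" by blast
    moreover have "det2 (a - b) (k - b) \<noteq> 0"
      using chord_endpoint[OF ch _ _ kl(4)] kl(3) bnd interior_subset by blast
    ultimately have pos: "0 < det2 (a - b) (k - b)" by simp
    obtain i j :: int where ij: "k = z + of_int i *\<^sub>R (a - z) + of_int j *\<^sub>R (b - z)"
      using triangle_integer_coords[OF TD ab kl(4)] by metis
    have "det2 (a - b) (k - b) = of_int i + of_int j - 1"
      unfolding det2_triangle_combination[OF ij] dz by simp
    then have "i + j > 1" using pos by linarith
    moreover have "a \<in> P" "b \<in> P" using chord_in_P[OF ch] by simp_all
    ultimately show ?thesis using parallelogram_point_interior[OF z bnd(2,1) _ _ kl(3) ij] by simp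
  qed
  have "{s} \<in> edges G"
  proof (rule G_keeps_edge[OF sH])
    fix X assume "X \<in> ends H s"
    then have "X = T \<or> X = T'" unfolding T'(3) by simp
    then show "card {s \<in> edges H. X \<in> ends H s} \<noteq> 2"
    proof
      assume X: "X = T"
      show ?thesis unfolding X
        using valency_three_edges[OF z TD ab(1) ne] sH sba by (simp add: closed_segment_commute)
    next
      assume X: "X = T'"
      have v: "verts T' = {a, b, a + b - z}"
        using opposite_triangle_apex[OF TD ab T'(1,2) _ z bnd(2,1) apex] T'v by (simp add: insert_commute)
      have v': "verts T' = {a + b - z, b, a}" unfolding v by auto
      have "a + b - z \<noteq> b" "a + b - z \<noteq> a" using ne by (auto simp: algebra_simps)
      then show ?thesis unfolding X
        using valency_three_edges[OF apex T'(1) v' _ _ ne(3)[symmetric]] sH sba by simp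
    qed
  qed
  then have "e = {closed_segment b a}" using G_disjoint[OF e(1) _ s(1)] unfolding sba by simp
  then show ?thesis by (rule that[OF ab ch apex _ near])
qed

text \<open>On the near side \<open>i + j\<close> is at most 1; \<open>nonpositive_coord\<close> and
  its mirror image in \<open>a\<close> and \<open>b\<close> then give both signs.\<close>

lemma near_coords:
  assumes T: "T \<in> \<Delta>" "verts T = {z, a, b}" "det2 (a - z) (b - z) = 1" and z: "z \<in> interior P"
    and ch: "chord b a" and apex: "a + b - z \<in> interior P"
    and p: "p \<in> interior P" "p \<in> lattice_points" "X \<in> \<Delta>" "p \<in> verts X" "\<not> beyond b a X"
  obtains i j where "p = z + i *\<^sub>R (a - z) + j *\<^sub>R (b - z)" "i \<le> 0" "j \<le> 0"
proof -
  obtain i j :: int where ij: "p = z + of_int i *\<^sub>R (a - z) + of_int j *\<^sub>R (b - z)"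
    using triangle_integer_coords[OF T p(2)] by metis
  have dz: "det2 (a - b) (z - b) = - 1" using T(3) by (simp add: det2_def algebra_simps)
  have "det2 (a - b) (p - b) = of_int i + of_int j - 1"
    unfolding det2_triangle_combination[OF ij] dz by simp
  moreover have "det2 (a - b) (p - b) \<le> 0" using p(4,5) by (force simp: beyond_def)
  ultimately have le: "i + j \<le> 1" by linarith
  have bnd: "b \<notin> interior P" "a \<notin> interior P" using ch by (auto simp: chord_def)
  have "j \<le> 0" using nonpositive_coord[OF z bnd(1) apex p(1) ij le] .
  moreover have "p = z + of_int j *\<^sub>R (b - z) + of_int i *\<^sub>R (a - z)" unfolding ij by simp
  then have "i \<le> 0"
    using nonpositive_coord[OF z bnd(2) _ p(1), of b j i] apex le by (simp add: add.commute)
  ultimately show ?thesis using that[OF ij] by simp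
qed

end

section \<open>The two split lines\<close>

lemma affine_hull_segment: "affine hull (closed_segment u w) = {p. \<exists>t. p = u + t *\<^sub>R (w - u)}"
  by (auto simp: segment_convex_hull affine_hull_2_alt)

lemma affine_hull_segment_det2:
  "u \<noteq> w \<Longrightarrow> p \<in> affine hull (closed_segment u w) \<longleftrightarrow> det2 (w - u) (p - u) = 0"
  unfolding affine_hull_segment mem_Collect_eq
  using det2_zero_collinear[of w u p] by (auto simp: det2_scaleR)

lemma lines_meet_once:
  assumes "det2 (w - a) (d - a) \<noteq> 0"
  shows "affine hull (closed_segment a w) \<inter> affine hull (closed_segment d w) = {w}"
proof -
  have "p = w" if p: "p \<in> affine hull (closed_segment a w)" "p \<in> affine hull (closed_segment d w)" for p
  proof (rule ccontr)
    assume "p \<noteq> w"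
    obtain s where s: "p = a + s *\<^sub>R (w - a)" using p(1) unfolding affine_hull_segment by blast
    obtain t where t: "p = d + t *\<^sub>R (w - d)" using p(2) unfolding affine_hull_segment by blast
    have "t \<noteq> 1" using \<open>p \<noteq> w\<close> t by auto
    have "(1 - t) *\<^sub>R (d - a) = (s - t) *\<^sub>R (w - a)"
      using s t by (simp add: algebra_simps)
    then have "(1 - t) * det2 (w - a) (d - a) = (s - t) * det2 (w - a) (w - a)"
      by (metis det2_scaleR(2))
    then show False using assms \<open>t \<noteq> 1\<close> by simp
  qed
  moreover have "w \<in> affine hull (closed_segment a w)" "w \<in> affine hull (closed_segment d w)"
    by (auto intro: hull_inc)
  ultimately show ?thesis by blast
qed

lemma connected_avoids_line:
  assumes K: "connected K" "K \<inter> affine hull (closed_segment u w) = {}" "u \<noteq> w"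
    and y: "y \<in> K" "det2 (w - u) (y - u) < 0"
  shows "closure K \<subseteq> {p. det2 (w - u) (p - u) \<le> 0}"
proof (rule closure_minimal)
  let ?g = "\<lambda>p. det2 (w - u) (p - u)"
  have "open {p. ?g p < 0}" "open {p. 0 < ?g p}"
    unfolding det2_def by (intro open_Collect_less continuous_intros)+
  moreover have "K \<subseteq> {p. ?g p < 0} \<union> {p. 0 < ?g p}"
    using K(2) affine_hull_segment_det2[OF K(3)] by force
  ultimately have "{p. 0 < ?g p} \<inter> K = {}"
    using connectedD[OF K(1), of "{p. ?g p < 0}" "{p. 0 < ?g p}"] y by force
  then show "K \<subseteq> {p. ?g p \<le> 0}" by force
  show "closed {p. ?g p \<le> 0}"
    unfolding det2_def by (intro closed_Collect_le continuous_intros)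
qed

text \<open>
  \<open>P'\<close> lies in the wedge of the two half-planes containing \<open>z\<close>, and \<open>w\<close> is the apex of this wedge.
\<close>

lemma wedge_apex_extreme:
  assumes P': "P' \<in> closure ` components (P - (affine hull (closed_segment a b) \<union> affine hull (closed_segment c d)))"
    and ne: "a \<noteq> b" "c \<noteq> d"
    and z: "z \<in> P'" "det2 (b - a) (z - a) < 0" "det2 (d - c) (z - c) < 0"
    and w: "w \<in> P'" "affine hull (closed_segment a b) \<inter> affine hull (closed_segment c d) = {w}"
  shows "w extreme_point_of P'"
proof -
  let ?g = "\<lambda>p. det2 (b - a) (p - a)" and ?h = "\<lambda>p. det2 (d - c) (p - c)"
  obtain K where K: "P' = closure K" "K \<in> components (P - (affine hull (closed_segment a b) \<union> affine hull (closed_segment c d)))"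
    using P' by blast
  have conn: "connected K" using K(2) in_components_connected by blast
  have avoid: "K \<inter> affine hull (closed_segment a b) = {}" "K \<inter> affine hull (closed_segment c d) = {}"
    using in_components_subset[OF K(2)] by blast+
  let ?U = "{p. ?g p < 0} \<inter> {p. ?h p < 0}"
  \<comment> \<open>\<open>z\<close> is only known to lie in the closure of the component; the open
    wedge around it meets the component itself.\<close>
  have "open ?U"
    unfolding det2_def by (intro open_Int open_Collect_less continuous_intros)
  moreover have "z \<in> ?U \<inter> closure K" using z K(1) by simp
  ultimately have "?U \<inter> K \<noteq> {}" using open_Int_closure_eq_empty[of ?U K] by blast
  then obtain y where y: "y \<in> K" "?g y < 0" "?h y < 0" by blast
  have sub: "?g p \<le> 0 \<and> ?h p \<le> 0" if "p \<in> P'" for p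
    using connected_avoids_line[OF conn avoid(1) ne(1) y(1,2)]
      connected_avoids_line[OF conn avoid(2) ne(2) y(1,3)] that unfolding K(1) by blast
  have w0: "?g w = 0" "?h w = 0"
    using w(2) affine_hull_segment_det2[OF ne(1)] affine_hull_segment_det2[OF ne(2)] by blast+
  show ?thesis
    unfolding extreme_point_of_def
  proof (intro conjI ballI notI)
    show "w \<in> P'" by (rule w(1))
    fix u v assume uv: "u \<in> P'" "v \<in> P'" "w \<in> open_segment u v"
    then obtain t where t: "0 < t" "t < 1" "w = (1 - t) *\<^sub>R u + t *\<^sub>R v" "u \<noteq> v" by (auto simp: in_segment)
    have gt: "?g w = (1 - t) * ?g u + t * ?g v" "?h w = (1 - t) * ?h u + t * ?h v"
      unfolding t(3) by (simp_all add: det2_def algebra_simps)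
    \<comment> \<open>A proper average of two nonpositive numbers vanishes only if both do, which
      puts \<open>u\<close> and \<open>v\<close> on both lines.\<close>
    have zero: "k = 0 \<and> l = 0" if "0 = (1 - t) * k + t * l" "k \<le> 0" "l \<le> 0" for k l :: real
    proof -
      have "(1 - t) * k \<le> 0" "t * l \<le> 0" using t(1,2) that by (simp_all add: mult_nonneg_nonpos)
      then have "(1 - t) * k = 0" "t * l = 0" using that(1) by linarith+
      then show ?thesis using t(1,2) by simp
    qed
    have "?g u = 0 \<and> ?g v = 0" "?h u = 0 \<and> ?h v = 0"
      using zero gt w0 sub uv(1,2) by metis+
    then have "u = w" "v = w"
      using w(2) affine_hull_segment_det2[OF ne(1)] affine_hull_segment_det2[OF ne(2)] by blast+
    then show False using t(4) by simp
  qed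
qed

theorem lemma8:
  fixes P P' S1 S2 T1 T2 :: "point set" and \<Delta> :: "point set set"
    and G C G1 G2 G3 :: "(point set, point set set) mgraph"
    and e1 e2 :: "point set set" and z :: point
  assumes "lattice_polygon P"
    and "unimodular_triangulation P \<Delta>"
    and "skeleton \<Delta> G"
    and "heavy_cycle \<Delta> G C T1 T2 e1 e2 G1 G2 G3"
    and "dual_lattice_point P \<Delta> G C z"
    and "dual_split_line P \<Delta> e1 S1"
    and "dual_split_line P \<Delta> e2 S2"
    and "heavy_component P S1 S2 (graph_union G3 C) P'"
  shows "\<exists>w. closed_segment z w edge_of T1 \<and> closed_segment z w edge_of T2 \<and>
             S1 \<inter> S2 = {w} \<and> w extreme_point_of P' \<and> w \<in> frontier P"
proof -
  obtain H where H: "delete_leaf\<^sup>*\<^sup>* (dual_graph \<Delta>) H" "smooth_node\<^sup>*\<^sup>* (singleton_edges H) G"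
    using assms(3) unfolding skeleton_def by (elim exE conjE)
  interpret polygon_skeleton P \<Delta> H G
    using assms(1,2) H by unfold_locales
  note hv = assms(4)[unfolded heavy_cycle_def]
  have conn: "connected_graph G" using hv by (elim conjE)
  have sC: "subgraph C G" using hv by (elim conjE)
  have TC: "T1 \<in> nodes C" "T2 \<in> nodes C" "T1 \<noteq> T2" using hv by - (elim conjE, assumption)+
  have B1: "subgraph G1 G" "genus G1 > 0" using hv by - (elim conjE, assumption)+
  have B2: "subgraph G2 G" "genus G2 > 0" using hv by - (elim conjE, assumption)+
  have B3: "subgraph G3 G" "genus G3 > 0" using hv by - (elim conjE, assumption)+
  have dis: "nodes G1 \<inter> nodes G2 = {}" "nodes G1 \<inter> nodes G3 = {}" "nodes G2 \<inter> nodes G3 = {}"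
    "{T1, T2} \<inter> (nodes G1 \<union> nodes G2 \<union> nodes G3) = {}" using hv by - (elim conjE, assumption)+
  have "\<exists>x\<in>nodes G1. ends G e1 = {T1, x}" "\<exists>x\<in>nodes G2. ends G e2 = {T2, x}"
    using hv by - (elim conjE, assumption)+
  then obtain x y where x: "x \<in> nodes G1" "ends G e1 = {T1, x}" and y: "y \<in> nodes G2" "ends G e2 = {T2, y}"
    by blast
  have edges_G: "edges G = edges G1 \<union> edges G2 \<union> {e1, e2} \<union> edges (graph_union G3 C)"
    using hv by (elim conjE)
  have "\<exists>f g1 g2 x1 x2 Q.
        ends G f = {T1, T2} \<and> ends G g1 = {T1, x1} \<and> ends G g2 = {T2, x2} \<and>
        subgraph Q G3 \<and> path_graph Q x1 x2 \<and>
        edges C = {f, g1, g2} \<union> edges Q \<and> nodes C = {T1, T2} \<union> nodes Q" using hv by (elim conjE)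
  then obtain f g1 g2 Q where f: "ends G f = {T1, T2}" and fC: "edges C = {f, g1, g2} \<union> edges Q"
    and Q: "subgraph Q G3" "nodes C = {T1, T2} \<union> nodes Q"
    by (elim exE conjE)
  have fC: "f \<in> edges C" unfolding fC by simp
  have nodesC: "nodes C \<subseteq> {T1, T2} \<union> nodes G3" using Q by (auto simp: subgraph_def)
  have sub_ends: "ends G E \<subseteq> nodes B" if "subgraph B G" "E \<in> edges B" for B E
    using that unfolding subgraph_def by (metis)
  have TG: "T1 \<in> nodes G" "T2 \<in> nodes G" using TC sC by (auto simp: subgraph_def)
  have TD: "T1 \<in> \<Delta>" "T2 \<in> \<Delta>" using TG G_nodes by blast+
  have edges_cases: "E \<in> edges G1 \<or> E \<in> edges G2 \<or> E = e1 \<or> E = e2 \<or> E \<in> edges G3 \<or> E \<in> edges C"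
    if "E \<in> edges G" for E using that edges_G by (auto simp: graph_union_def)
  have e12: "e1 \<in> edges G" "e2 \<in> edges G" using edges_G by auto
  \<comment> \<open>Only \<open>e1\<close> leaves \<open>G1\<close>; this is the form in which
    \<open>cut_branch\<close> takes the cut.\<close>
  have shore1: "ends G E \<subseteq> nodes G1 \<or> ends G E \<inter> nodes G1 = {}" if E: "E \<in> edges G" "E \<noteq> e1" for E
  proof -
    have out: "({T1, T2} \<union> nodes G2 \<union> nodes G3) \<inter> nodes G1 = {}" using dis by auto
    have "ends G E \<subseteq> nodes G1 \<or> ends G E \<subseteq> {T1, T2} \<union> nodes G2 \<union> nodes G3"
      using edges_cases[OF E(1)]
    proof (elim disjE)
      assume "E \<in> edges G1"
      then show ?thesis using sub_ends[OF B1(1)] by simp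
    next
      assume "E \<in> edges G2"
      then have "ends G E \<subseteq> nodes G2" by (rule sub_ends[OF B2(1)])
      then show ?thesis by (intro disjI2) auto
    next
      assume "E = e2"
      then show ?thesis using y by (intro disjI2) auto
    next
      assume "E \<in> edges G3"
      then have "ends G E \<subseteq> nodes G3" by (rule sub_ends[OF B3(1)])
      then show ?thesis by (intro disjI2) auto
    next
      assume "E \<in> edges C"
      then have "ends G E \<subseteq> nodes C" by (rule sub_ends[OF sC])
      then show ?thesis using nodesC by (intro disjI2) auto
    qed (use E(2) in simp)
    then show ?thesis using out by (elim disjE) auto
  qed
  have shore2: "ends G E \<subseteq> nodes G2 \<or> ends G E \<inter> nodes G2 = {}" if E: "E \<in> edges G" "E \<noteq> e2" for E
  proof -
    have out: "({T1, T2} \<union> nodes G1 \<union> nodes G3) \<inter> nodes G2 = {}" using dis by auto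
    have "ends G E \<subseteq> nodes G2 \<or> ends G E \<subseteq> {T1, T2} \<union> nodes G1 \<union> nodes G3"
      using edges_cases[OF E(1)]
    proof (elim disjE)
      assume "E \<in> edges G2"
      then show ?thesis using sub_ends[OF B2(1)] by simp
    next
      assume "E \<in> edges G1"
      then have "ends G E \<subseteq> nodes G1" by (rule sub_ends[OF B1(1)])
      then show ?thesis by (intro disjI2) auto
    next
      assume "E = e1"
      then show ?thesis using x by (intro disjI2) auto
    next
      assume "E \<in> edges G3"
      then have "ends G E \<subseteq> nodes G3" by (rule sub_ends[OF B3(1)])
      then show ?thesis by (intro disjI2) auto
    next
      assume "E \<in> edges C"
      then have "ends G E \<subseteq> nodes C" by (rule sub_ends[OF sC])
      then show ?thesis using nodesC by (intro disjI2) auto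
    qed (use E(2) in simp)
    then show ?thesis using out by (elim disjE) auto
  qed
  obtain R where z: "z \<in> interior P" "z \<in> lattice_points" and R: "bounds_region \<Delta> G C R" "z \<in> R"
    using assms(5) by (auto simp: dual_lattice_point_def)
  \<comment> \<open>The edge \<open>f\<close> of the cycle joins \<open>T1\<close> and
    \<open>T2\<close>, so its drawing passes through both barycentres, which therefore lie on the
    frontier of \<open>R\<close>.\<close>
  have zv: "z \<in> verts T" if T: "T \<in> ends G f" "T \<in> nodes G" for T
  proof -
    have fG: "f \<in> edges G" using fC sC by (auto simp: subgraph_def)
    obtain s where s: "s \<in> f" "T \<in> \<Delta>" "s edge_of T" using G_end_mem[OF fG T(2)] T(1) by blast
    have "T \<in> ends (dual_graph \<Delta>) s" using s(2,3) by (simp add: dual_ends)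
    then have "barycenter T \<in> dual_curve \<Delta> s" unfolding dual_curve_def by blast
    then have "barycenter T \<in> drawing \<Delta> C" using s(1) fC unfolding drawing_def by blast
    moreover have "frontier R = drawing \<Delta> C" and comp: "R \<in> components (- drawing \<Delta> G)"
      using R(1) by (simp_all add: bounds_region_def)
    ultimately have cl: "barycenter T \<in> closure R" unfolding frontier_def by blast
    have "R \<inter> dual_curve \<Delta> (closed_segment z a) = {}"
      if a: "a \<noteq> z" "closed_segment z a \<in> edges (dual_graph \<Delta>)" for a
    proof -
      have "closed_segment z a \<in> \<Union>(edges G)" using spoke_in_H[OF z(1)] a G_cover by simp
      then have "dual_curve \<Delta> (closed_segment z a) \<subseteq> drawing \<Delta> G" unfolding drawing_def by blast
      then show ?thesis using in_components_subset[OF comp] by blast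
    qed
    then show ?thesis using region_vertex[OF z R(2) in_components_connected[OF comp] _ s(2) cl] by blast
  qed
  have z1: "z \<in> verts T1" and z2: "z \<in> verts T2" using zv f TG by simp_all
  have Tn: "T1 \<notin> nodes G1" "T2 \<notin> nodes G2" "T1 \<notin> nodes G3" using dis(4) by auto
  obtain a b where b1: "verts T1 = {z, a, b}" "det2 (a - z) (b - z) = 1" "chord b a" "a + b - z \<in> interior P"
    "e1 = {closed_segment b a}"
    and near1: "\<And>E s X. \<lbrakk>E \<in> edges G; E \<noteq> e1; ends G E \<inter> nodes G1 = {}; s \<in> E; X \<in> \<Delta>; s edge_of X\<rbrakk> \<Longrightarrow> \<not> beyond b a X"
    proof (rule cut_branch[OF conn TG(1) Tn(1) z1 z(1) B1 e12(1) x(2,1)], goal_cases)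
    case (1 E)
    show ?case using 1(2,3) by (rule shore1)
  next
    case 2
    show ?case using 2(2-) by (rule 2(1))
  qed
  obtain c d where b2: "verts T2 = {z, c, d}" "det2 (c - z) (d - z) = 1" "chord d c" "c + d - z \<in> interior P"
    "e2 = {closed_segment d c}"
    and near2: "\<And>E s X. \<lbrakk>E \<in> edges G; E \<noteq> e2; ends G E \<inter> nodes G2 = {}; s \<in> E; X \<in> \<Delta>; s edge_of X\<rbrakk> \<Longrightarrow> \<not> beyond d c X"
    proof (rule cut_branch[OF conn TG(2) Tn(2) z2 z(1) B2 e12(2) y(2,1)], goal_cases)
    case (1 E)
    show ?case using 1(2,3) by (rule shore2)
  next
    case 2
    show ?case using 2(2-) by (rule 2(1))
  qed
  obtain F where F: "F \<subseteq> edges G3" "F \<noteq> {}" "edge_core (\<Union>F)" "\<Union>F \<noteq> {}" using subgraph_core[OF B3] by metis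
  have F_ends: "E \<in> edges G" "ends G E \<subseteq> nodes G3" if "E \<in> F" for E
    using that F(1) B3(1) sub_ends[OF B3(1)] by (auto simp: subgraph_def)
  \<comment> \<open>A core edge in \<open>T1\<close> would make \<open>T1\<close> an end of an edge
    of \<open>G3\<close>. As \<open>T1\<close> is a triangle at \<open>z\<close> missed by the core,
    an interior end point other than \<open>z\<close> must exist.\<close>
  have "\<not> s edge_of T1" if s: "s \<in> \<Union>F" for s
  proof
    assume "s edge_of T1"
    then obtain E where "E \<in> F" "T1 \<in> ends G E" using s G_end_mem[OF _ TG(1)] TD(1) F_ends(1) by blast
    then show False using F_ends(2) Tn(3) by blast
  qed
  then obtain p q where p: "closed_segment p q \<in> \<Union>F" "p \<noteq> q" "p \<in> interior P" "p \<in> lattice_points" "p \<noteq> z"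
    using core_second_interior_endpoint[OF F(3,4) z TD(1) z1] by metis
  obtain E where E: "E \<in> F" "closed_segment p q \<in> E" using p(1) by blast
  have EG: "E \<in> edges G" "ends G E \<subseteq> nodes G3" using F_ends[OF E(1)] .
  have "T2 \<notin> nodes G3" using dis(4) by blast
  then have Ene: "E \<noteq> e1" "E \<noteq> e2" using EG(2) x(2) y(2) Tn(3) by auto
  have Eout: "ends G E \<inter> nodes G1 = {}" "ends G E \<inter> nodes G2 = {}" using EG(2) dis(2,3) by blast+
  have pqD: "closed_segment p q \<in> edges (dual_graph \<Delta>)" using E(2) EG(1) G_cover H_edges by blast
  obtain X where X: "X \<in> \<Delta>" "closed_segment p q edge_of X"
    using pqD unfolding dual_graph_def mgraph.simps by blast
  have pX: "p \<in> verts X" using segment_edge_iff[OF X(1) p(2)] X(2) by simp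
  obtain i j where ij: "p = z + i *\<^sub>R (a - z) + j *\<^sub>R (b - z)" "i \<le> 0" "j \<le> 0"
    using near_coords[OF TD(1) b1(1,2) z(1) b1(3,4) p(3,4) X(1) pX near1[OF EG(1) Ene(1) Eout(1) E(2) X]] by metis
  obtain k l where kl: "p = z + k *\<^sub>R (c - z) + l *\<^sub>R (d - z)" "k \<le> 0" "l \<le> 0"
    using near_coords[OF TD(2) b2(1,2) z(1) b2(3,4) p(3,4) X(1) pX near2[OF EG(1) Ene(2) Eout(2) E(2) X]] by metis
  obtain w where w: "w \<noteq> z" "verts T1 \<inter> verts T2 = {z, w}"
    using common_vertex[OF TD(1) b1(1) TD(2) b2(1) TC(3) p(5) ij kl] by metis
  have w12: "{z, w} \<subseteq> verts T1" "{z, w} \<subseteq> verts T2" using w(2) by blast+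
  have wab: "w = a \<or> w = b" "w = c \<or> w = d"
    using w12 w(1) unfolding b1(1) b2(1) by blast+
  have S: "S1 = affine hull (closed_segment b a)" "S2 = affine hull (closed_segment d c)"
    using assms(6,7) unfolding dual_split_line_def b1(5) b2(5) by blast+
  have S_inter: "S1 \<inter> S2 = {w}"
  proof -
    \<comment> \<open>\<open>w\<close> may be either end of each chord; with \<open>a'\<close> and
      \<open>d'\<close> for the other ends, both lines are written as passing through
      \<open>w\<close>.\<close>
    obtain a' where a': "chord a' w" "verts T1 = {z, a', w}" "S1 = affine hull (closed_segment a' w)"
      using wab(1)
    proof
      assume "w = a"
      then show ?thesis using that[of b] b1(1,3) S(1) by (simp add: insert_commute)
    next
      assume "w = b"
      moreover have "chord a b" using b1(3) chord_commute by simp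
      moreover have "S1 = affine hull (closed_segment a b)" using S(1) by (simp only: closed_segment_commute)
      ultimately show ?thesis using that[of a] b1(1) by simp
    qed
    obtain d' where d': "d' \<noteq> w" "verts T2 = {z, w, d'}" "S2 = affine hull (closed_segment d' w)"
      using wab(2)
    proof
      assume "w = c"
      then show ?thesis using that[of d] b2(1,3) S(2) by (simp add: chord_def)
    next
      assume "w = d"
      moreover have "S2 = affine hull (closed_segment c d)" using S(2) by (simp only: closed_segment_commute)
      moreover have "c \<noteq> d" using b2(3) by (auto simp: chord_def)
      moreover have "verts T2 = {z, d, c}" unfolding b2(1) by auto
      ultimately show ?thesis using that[of c] by simp
    qed
    have "det2 (w - a') (d' - a') \<noteq> 0"
      using adjacent_chord_lines_differ[OF a'(1) TD(2,1) a'(2) d'(2) TC(3) d'(1)] .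
    then show ?thesis using lines_meet_once a'(3) d'(3) by simp
  qed
  have P': "P' \<in> closure ` components (P - (S1 \<union> S2))" "T1 \<subseteq> P'"
    using assms(8) TC(1) unfolding heavy_component_def graph_union_def by auto
  have inP': "z \<in> P'" "w \<in> P'" using P'(2) w12(1) verts_subset by blast+
  have ne: "b \<noteq> a" "d \<noteq> c" using b1(3) b2(3) by (auto simp: chord_def)
  have neg: "det2 (a - b) (z - b) < 0" "det2 (c - d) (z - d) < 0"
    using b1(2) b2(2) by (simp_all add: det2_def algebra_simps)
  have ext: "w extreme_point_of P'"
    using wedge_apex_extreme[OF P'(1)[unfolded S] ne inP'(1) neg inP'(2) S_inter[unfolded S]] .
  have "w \<in> P" "w \<notin> interior P"
    using wab(1) chord_in_P[OF b1(3)] b1(3) by (auto simp: chord_def)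
  then have "w \<in> frontier P" using P_closed by (simp add: frontier_def)
  moreover have "closed_segment z w edge_of T1" "closed_segment z w edge_of T2"
    using segment_edge_iff[OF TD(1) w(1)[symmetric]] segment_edge_iff[OF TD(2) w(1)[symmetric]] w12 by simp_all
  ultimately show ?thesis using S_inter ext by blast
qed

end
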